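(* Let $\Gamma$ be a countable discrete group and $\mu$ a probability measure on $\Gamma$ with $H(\mu)<\infty$. Let $\{(B_\sigma,\nu_\sigma) : \sigma\in\Sigma\}$ be a collection of $(\Gamma,\mu)$-boundaries closed under joins and meets. Then the supremum $(B^+,\nu^+)$ of the collection is the unique $(\Gamma,\mu)$-boundary such that (1) for all $\sigma\in\Sigma$, $(B^+,\nu^+)\ge(B_\sigma,\nu_\sigma)$; and (2) $h_\mu(B^+,\nu^+)=\sup_{\sigma}h_\mu(B_\sigma,\nu_\sigma)$. Assuming in addition that $\mu$ has finite support, the infimum $(B^-,\nu^-)$ of the collection is the unique $(\Gamma,\mu)$-boundary such that (3) for all $\sigma\in\Sigma$, $(B^-,\nu^-)\le(B_\sigma,\nu_\sigma)$; and (4) $h_\mu(B^-,\nu^-)=\inf_{\sigma}h_\mu(B_\sigma,\nu_\sigma)$.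
   Context: The Shannon entropy is $H(\mu)=\sum_g -\log(\mu(g))\mu(g)$. A standard (Lebesgue) probability space $(X,\lambda)$ with a measurable $\Gamma$-action is $(\Gamma,\mu)$-stationary if $\mu*\lambda=\lambda$, where $\mu*\lambda=\sum_{g\in\Gamma}\mu(g)\,g\lambda$. Up to measurable isomorphism one may assume $X$ is compact metrizable and the action is continuous. A $(\Gamma,\mu)$-boundary is a $(\Gamma,\mu)$-stationary space $(B,\nu)$ that is $\mu$-proximal: for $\mu^{\mathbf{N}}$-almost every $(g_i)\in\Gamma^{\mathbf{N}}$, the weak* limit $\lim_n g_1\cdots g_n\nu$ is a Dirac mass. Boundaries are considered up to $\Gamma$-equivariant measurable isomorphism. The set $\mathcal{BL}(\Gamma,\mu)$ of all $(\Gamma,\mu)$-boundaries is ordered by: $(B_1,\nu_1)\ge(B_2,\nu_2)$ iff there is a measurable $\Gamma$-equivariant factor map $(B_1,\nu_1)\to(B_2,\nu_2)$. With this order it is a lattice, with join $\vee$ and meet $\wedge$; its maximal element is the Poisson boundary, so boundaries may be identified with complete $\Gamma$-invariant sub-$\sigma$-algebras of the $\sigma$-algebra of the Poisson boundary. The supremum of a collection of boundaries is the smallest boundary that is greater than or equal to every member of the collection; the infimum is the largest boundary that is less than or equal to every member. The Furstenberg entropy of a $(\Gamma,\mu)$-stationary space $(X,\lambda)$ is $$h_\mu(X,\lambda)=\int_\Gamma\int_X -\log\left(\frac{d g^{-1}\lambda}{d\lambda}(x)\right)d\lambda(x)\,d\mu(g).$$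
   Formalization: Γ-actions are required to preserve null sets (else uniqueness fails, e.g. μ=δ_e); existence of the supremum is asserted only if supp μ generates Γ as a semigroup, the characterization whenever it exists; collections are nonempty; boundaries are realized on subsets of the reals. *)

theory Defs
  imports "HOL-Probability.Probability" "HOL-Algebra.Group_Action"
begin

text \<open>
  Throughout, \<open>G\<close> is a countable (discrete) group and \<open>\<mu> :: 'g pmf\<close> is a probability measure on it.
  A space with an action is a measure together with a map sending each group element to a
  self-map of the underlying set.
\<close>

record ('g, 'x) gspace =
  msr :: "'x measure"
  act :: "'g \<Rightarrow> 'x \<Rightarrow> 'x"

definition borel_sets :: "'x topology \<Rightarrow> 'x set set" where
  "borel_sets T = sigma_sets (topspace T) {U. openin T U}"

definition standard_borel :: "'x measure \<Rightarrow> bool" where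
  "standard_borel M \<longleftrightarrow>
     (\<exists>T. completely_metrizable_space T \<and> second_countable T \<and>
          topspace T = space M \<and> borel_sets T = sets M)"

text \<open>The translate \<open>g\<lambda>\<close>.\<close>

definition translate :: "('g, 'x) gspace \<Rightarrow> 'g \<Rightarrow> 'x measure" where
  "translate X g = distr (msr X) (msr X) (act X g)"

text \<open>
  Standard probability spaces are represented by their Borel sigma-algebra rather than by its
  completion; all maps between them are taken modulo null sets. As usual for actions on such
  spaces, the action preserves the null sets, so that every \<open>d g\<lambda> / d\<lambda>\<close> exists.
\<close>

definition measured_gspace :: "('g, 'm) monoid_scheme \<Rightarrow> ('g, 'x) gspace \<Rightarrow> bool" where
  "measured_gspace G X \<longleftrightarrow>
     standard_borel (msr X) \<and> prob_space (msr X) \<and>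
     group_action G (space (msr X)) (act X) \<and>
     (\<forall>g\<in>carrier G. act X g \<in> measurable (msr X) (msr X) \<and>
                     absolutely_continuous (msr X) (translate X g))"

text \<open>\<open>\<mu> * \<lambda> = \<lambda>\<close>, evaluated on each measurable set.\<close>

definition stationary :: "('g, 'm) monoid_scheme \<Rightarrow> 'g pmf \<Rightarrow> ('g, 'x) gspace \<Rightarrow> bool" where
  "stationary G \<mu> X \<longleftrightarrow>
     measured_gspace G X \<and>
     (\<forall>A\<in>sets (msr X).
        (\<integral>\<^sup>+ g. emeasure (translate X g) A \<partial>measure_pmf \<mu>) = emeasure (msr X) A)"

definition factor_map ::
  "('g, 'm) monoid_scheme \<Rightarrow> ('g, 'x) gspace \<Rightarrow> ('g, 'y) gspace \<Rightarrow> ('x \<Rightarrow> 'y) \<Rightarrow> bool" where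
  "factor_map G X Y f \<longleftrightarrow>
     f \<in> measurable (msr X) (msr Y) \<and> distr (msr X) (msr Y) f = msr Y \<and>
     (\<forall>g\<in>carrier G. AE x in msr X. f (act X g x) = act Y g (f x))"

definition isomorphic_gspaces ::
  "('g, 'm) monoid_scheme \<Rightarrow> ('g, 'x) gspace \<Rightarrow> ('g, 'y) gspace \<Rightarrow> bool" where
  "isomorphic_gspaces G X Y \<longleftrightarrow>
     (\<exists>f f'. factor_map G X Y f \<and> factor_map G Y X f' \<and>
             (AE x in msr X. f' (f x) = x) \<and> (AE y in msr Y. f (f' y) = y))"

definition compact_model ::
  "('g, 'm) monoid_scheme \<Rightarrow> ('g, 'x) gspace \<Rightarrow> 'x topology \<Rightarrow> bool" where
  "compact_model G Y T \<longleftrightarrow>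
     measured_gspace G Y \<and>
     compact_space T \<and> metrizable_space T \<and>
     topspace T = space (msr Y) \<and> borel_sets T = sets (msr Y) \<and>
     (\<forall>g\<in>carrier G. continuous_map T T (act Y g))"

definition weak_star_limit :: "'x topology \<Rightarrow> (nat \<Rightarrow> 'x measure) \<Rightarrow> 'x measure \<Rightarrow> bool" where
  "weak_star_limit T N M \<longleftrightarrow>
     (\<forall>f. continuous_map T euclideanreal f \<longrightarrow> (\<lambda>n. \<integral>x. f x \<partial>N n) \<longlonglongrightarrow> (\<integral>x. f x \<partial>M))"

text \<open>The product of the first \<open>n\<close> increments \<open>w 0, \<dots>, w (n - 1)\<close>, in this order.\<close>

primrec walk :: "('g, 'm) monoid_scheme \<Rightarrow> (nat \<Rightarrow> 'g) \<Rightarrow> nat \<Rightarrow> 'g" where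
  "walk G w 0 = \<one>\<^bsub>G\<^esub>"
| "walk G w (Suc n) = walk G w n \<otimes>\<^bsub>G\<^esub> w n"

text \<open>
  Every compact metrizable space and every standard Borel space has at most the cardinality of
  the continuum, so up to isomorphism (and homeomorphism) its underlying set is a set of reals.
  The type \<^typ>\<open>real\<close> below, equipped with arbitrary sigma-algebras and topologies on
  its subsets, therefore represents all of them.
\<close>

definition proximal :: "('g, 'm) monoid_scheme \<Rightarrow> 'g pmf \<Rightarrow> ('g, 'x) gspace \<Rightarrow> bool" where
  "proximal G \<mu> X \<longleftrightarrow>
     (\<exists>(Y :: ('g, real) gspace) T. compact_model G Y T \<and> isomorphic_gspaces G X Y \<and>
        (AE w in PiM UNIV (\<lambda>_::nat. measure_pmf \<mu>).
           \<exists>y\<in>topspace T. weak_star_limit T (\<lambda>n. translate Y (walk G w n)) (return (msr Y) y)))"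

definition boundary :: "('g, 'm) monoid_scheme \<Rightarrow> 'g pmf \<Rightarrow> ('g, 'x) gspace \<Rightarrow> bool" where
  "boundary G \<mu> X \<longleftrightarrow> stationary G \<mu> X \<and> proximal G \<mu> X"

text \<open>
  The order on boundaries, with isomorphism as its equality: \<open>Y\<close> is below \<open>X\<close> iff \<open>X\<close> factors
  onto \<open>Y\<close>. Suprema, infima, joins and meets are \<^const>\<open>least\<close> upper and
  \<^const>\<open>greatest\<close> lower bounds in this order.
\<close>

definition BL :: "('g, 'm) monoid_scheme \<Rightarrow> 'g pmf \<Rightarrow> ('g, real) gspace gorder" where
  "BL G \<mu> = \<lparr>carrier = {X. boundary G \<mu> X}, eq = isomorphic_gspaces G,
             le = (\<lambda>Y X. \<exists>f. factor_map G X Y f)\<rparr>"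

definition shannon_entropy :: "('g, 'm) monoid_scheme \<Rightarrow> 'g pmf \<Rightarrow> ennreal" where
  "shannon_entropy G \<mu> =
     (\<integral>\<^sup>+ g. ennreal (- ln (pmf \<mu> g) * pmf \<mu> g) \<partial>count_space (carrier G))"

text \<open>
  For stationary \<open>X\<close> and \<open>g\<close> in the support of \<open>\<mu>\<close> the inner integral is a relative entropy
  between \<open>0\<close> and \<open>- ln (pmf \<mu> g)\<close>, so under finite Shannon entropy both integrals are proper.
\<close>

definition furstenberg_entropy ::
  "('g, 'm) monoid_scheme \<Rightarrow> 'g pmf \<Rightarrow> ('g, 'x) gspace \<Rightarrow> real" where
  "furstenberg_entropy G \<mu> X =
     (\<integral>g. (\<integral>x. - ln (enn2real (RN_deriv (msr X) (translate X (inv\<^bsub>G\<^esub> g)) x)) \<partial>msr X)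
        \<partial>measure_pmf \<mu>)"

text \<open>The support of \<open>\<mu>\<close> generates \<open>G\<close> as a semigroup.\<close>

definition generating :: "('g, 'm) monoid_scheme \<Rightarrow> 'g pmf \<Rightarrow> bool" where
  "generating G \<mu> \<longleftrightarrow>
     (\<forall>g\<in>carrier G. \<exists>n w. (\<forall>i. w i \<in> set_pmf \<mu>) \<and> walk G w n = g)"

end

theory Submission
  imports Defs
begin

text \<open>
  Call \<open>g \<mapsto> (g\<lambda>)(A)\<close> the Poisson transform of a measurable set \<open>A\<close>. Proximality means that the
  transforms of all measurable sets tend to 0 or 1 along almost every path of the random walk. So
  transforms determine sets modulo null sets, \<open>X\<close> factors onto \<open>Y\<close> iff every transform of a set of
  \<open>Y\<close> is the transform of a set of \<open>X\<close>, and the boundaries below \<open>X\<close> correspond to the complete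
  invariant sub-sigma-algebras \<open>F\<close> of \<open>X\<close>.

  The Furstenberg entropy of the factor belonging to \<open>F\<close> is the \<open>\<mu>\<close>-average of
  \<open>\<integral> - ln (E(\<rho>\<^sub>g|F)) d\<lambda>\<close> with \<open>\<rho>\<^sub>g = d g\<^sup>-\<^sup>1\<lambda> / d\<lambda>\<close>. Stationarity gives \<open>\<rho>\<^sub>g \<ge> \<mu>(g)\<close>, so the logarithm
  is Lipschitz on the range of the conditional expectations and the entropy is continuous along
  increasing and decreasing nets of sigma-algebras. It is strictly monotone: by Gibbs' inequality
  equal entropies force each \<open>\<rho>\<^sub>g\<close> to be \<open>F\<close>-measurable, the extension is then relatively measure
  preserving, and the 0-1 limits rule out a proper extension of this kind. The supremum of a
  directed collection is generated by its members, and the infimum is their intersection.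
\<close>

section \<open>Conditional expectations along directed families\<close>

text \<open>Boundaries live on unrelated spaces, so they are compared through functions on the
  group: \<open>corr\<close> matches sets with equal Poisson transforms. Limits 0 and 1 multiply
  like truth values, and this is what makes the matching respect intersections. Weak* convergence
  yields the 0-1 law for closed sets only; Doob's maximal inequality, which controls a transform
  along a whole path by its value at the identity, carries it through countable unions. Three
  obstacles shape the rest. The collection may be uncountable, so conditional expectations converge
  in mean along nets, and a sequence is extracted when the entropies are averaged. A complete
  sigma-algebra need not be countably generated, so its factor is coded by a countable subfamily
  that is dense in measure. The Lipschitz constant 1/\<mu>(g) of the g-term is not uniform in g; the
  terms are dominated by - ln \<mu>(g), whose mean is the Shannon entropy. The supremum is
  constructed inside the Poisson boundary, where stationarity gives quasi-invariance for the support
  and the generating assumption extends it to the group.\<close>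

datatype bool_expr = Atom nat | Neg bool_expr | Or bool_expr bool_expr

instance bool_expr :: countable
  by countable_datatype

text \<open>The expressions form a countable type, so this enumerates the algebra generated by the
  sets \<open>A n\<close>, with \<open>S\<close> as the whole space. The choice of a countable dense
  subfamily rests on this countability.\<close>

primrec bool_set :: "'a set \<Rightarrow> (nat \<Rightarrow> 'a set) \<Rightarrow> bool_expr \<Rightarrow> 'a set" where
  "bool_set S A (Atom n) = A n"
| "bool_set S A (Neg e) = S - bool_set S A e"
| "bool_set S A (Or e f) = bool_set S A e \<union> bool_set S A f"

context prob_space
begin

lemma bool_set_events:
  assumes "\<And>n. A n \<in> events"
  shows "bool_set (space M) A e \<in> events"
  using assms by (induction e) auto

lemma prob_sym_diff_trans:
  assumes "A \<in> events" "B \<in> events" "C \<in> events"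
  shows "prob (sym_diff A C) \<le> prob (sym_diff A B) + prob (sym_diff B C)"
proof -
  have "prob (sym_diff A C) \<le> prob (sym_diff A B \<union> sym_diff B C)"
    using assms by (intro finite_measure_mono) auto
  also have "\<dots> \<le> prob (sym_diff A B) + prob (sym_diff B C)"
    using assms by (intro measure_subadditive) (auto simp: emeasure_eq_measure)
  finally show ?thesis .
qed

text \<open>The sets that the algebra approximates in measure form a sigma-algebra. Only countable
  unions take work: continuity of the measure reduces them to finite ones.\<close>

lemma algebra_dense:
  assumes \<A>: "\<A> \<subseteq> events" "{} \<in> \<A>" "\<And>B. B \<in> \<A> \<Longrightarrow> space M - B \<in> \<A>" "\<And>B C. B \<in> \<A> \<Longrightarrow> C \<in> \<A> \<Longrightarrow> B \<union> C \<in> \<A>"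
    and S: "S \<in> sigma_sets (space M) \<A>" and e: "0 < \<epsilon>"
  shows "\<exists>B\<in>\<A>. prob (sym_diff S B) < \<epsilon>"
proof -
  have B: "B \<in> events" if "B \<in> \<A>" for B using \<A>(1) that by blast
  have "S \<in> events \<and> (\<forall>\<epsilon>>0. \<exists>B\<in>\<A>. prob (sym_diff S B) < \<epsilon>)"
    using S
  proof induction
    case (Basic a)
    then have "\<exists>B\<in>\<A>. prob (sym_diff a B) < \<epsilon>" if "\<epsilon> > 0" for \<epsilon>
      using that by (intro bexI[of _ a]) simp_all
    then show ?case using B Basic by blast
  next
    case Empty
    have "\<exists>B\<in>\<A>. prob (sym_diff {} B) < \<epsilon>" if "\<epsilon> > 0" for \<epsilon>
      using that \<A>(2) by (intro bexI[of _ "{}"]) simp_all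
    then show ?case by blast
  next
    case (Compl a)
    then have a: "a \<in> events" and ex: "\<And>\<epsilon>. \<epsilon> > 0 \<Longrightarrow> \<exists>B\<in>\<A>. prob (sym_diff a B) < \<epsilon>"
      by blast+
    have "sym_diff (space M - a) (space M - C) = sym_diff a C" if "C \<in> \<A>" for C
      using sets.sets_into_space[OF a] sets.sets_into_space[OF B[OF that]] by auto
    then have "\<exists>B\<in>\<A>. prob (sym_diff (space M - a) B) < \<epsilon>" if "\<epsilon> > 0" for \<epsilon>
      using ex[OF that] \<A>(3) by metis
    then show ?case using a by blast
  next
    case (Union a)
    then have a: "\<And>i. a i \<in> events"
      and ex: "\<And>i \<epsilon>. \<epsilon> > 0 \<Longrightarrow> \<exists>B\<in>\<A>. prob (sym_diff (a i) B) < \<epsilon>"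
      by blast+
    \<comment> \<open>A finite union is approximated by the union of approximants. The errors add by
      subadditivity, hence half of the error for each part.\<close>
    have fin: "\<exists>B\<in>\<A>. prob (sym_diff (\<Union>i\<le>n. a i) B) < \<epsilon>" if "\<epsilon> > 0" for n and \<epsilon> :: real
      using that
    proof (induction n arbitrary: \<epsilon>)
      case 0
      then show ?case using ex by simp
    next
      case (Suc n)
      obtain C where C: "C \<in> \<A>" "prob (sym_diff (\<Union>i\<le>n. a i) C) < \<epsilon>/2"
        using Suc.IH[of "\<epsilon>/2"] Suc.prems by auto
      obtain D where D: "D \<in> \<A>" "prob (sym_diff (a (Suc n)) D) < \<epsilon>/2"
        using ex[of "\<epsilon>/2"] Suc.prems by auto
      have U: "(\<Union>i\<le>n. a i) \<in> events" using a by auto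
      note CD = B[OF C(1)] B[OF D(1)]
      have "prob (sym_diff (\<Union>i\<le>Suc n. a i) (C \<union> D))
         \<le> prob (sym_diff (\<Union>i\<le>n. a i) C \<union> sym_diff (a (Suc n)) D)"
        using a CD U by (intro finite_measure_mono) (auto simp: atMost_Suc)
      also have "\<dots> \<le> prob (sym_diff (\<Union>i\<le>n. a i) C) + prob (sym_diff (a (Suc n)) D)"
        using a CD U by (intro measure_subadditive) (auto simp: emeasure_eq_measure)
      also have "\<dots> < \<epsilon>" using C(2) D(2) by simp
      finally show ?case using \<A>(4)[OF C(1) D(1)] by blast
    qed
    have U: "(\<Union>i. a i) \<in> events" using a by auto
    have "\<exists>B\<in>\<A>. prob (sym_diff (\<Union>i. a i) B) < \<epsilon>" if \<epsilon>: "\<epsilon> > 0" for \<epsilon>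
    proof -
      have "(\<lambda>n. prob ((\<Union>i. a i) - (\<Union>i\<le>n. a i))) \<longlonglongrightarrow> prob (\<Inter>n. (\<Union>i. a i) - (\<Union>i\<le>n. a i))"
        using a U by (intro finite_Lim_measure_decseq) (fastforce simp: decseq_def)+
      moreover have "(\<Inter>n. (\<Union>i. a i) - (\<Union>i\<le>n. a i)) = {}" by blast
      ultimately have "(\<lambda>n. prob ((\<Union>i. a i) - (\<Union>i\<le>n. a i))) \<longlonglongrightarrow> 0" by (simp only: measure_empty)
      then have "eventually (\<lambda>n. prob ((\<Union>i. a i) - (\<Union>i\<le>n. a i)) < \<epsilon>/2) sequentially"
        using \<epsilon> by (intro order_tendstoD(2)) auto
      then obtain n where n: "prob ((\<Union>i. a i) - (\<Union>i\<le>n. a i)) < \<epsilon>/2"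
        by (auto simp: eventually_sequentially)
      obtain C where C: "C \<in> \<A>" "prob (sym_diff (\<Union>i\<le>n. a i) C) < \<epsilon>/2"
        using fin[of "\<epsilon>/2" n] \<epsilon> by auto
      have "prob (sym_diff (\<Union>i. a i) C)
         \<le> prob (sym_diff (\<Union>i. a i) (\<Union>i\<le>n. a i)) + prob (sym_diff (\<Union>i\<le>n. a i) C)"
        using a B[OF C(1)] U by (intro prob_sym_diff_trans) auto
      also have "sym_diff (\<Union>i. a i) (\<Union>i\<le>n. a i) = (\<Union>i. a i) - (\<Union>i\<le>n. a i)" by auto
      finally show ?thesis using n C by (intro bexI[of _ C]) simp_all
    qed
    then show ?case using U by blast
  qed
  then show ?thesis using e by blast
qed

lemma bool_set_dense:
  assumes A: "\<And>n. A n \<in> events" and S: "S \<in> sigma_sets (space M) (range A)" and e: "0 < \<epsilon>"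
  shows "\<exists>e. prob (sym_diff S (bool_set (space M) A e)) < \<epsilon>"
proof -
  let ?B = "bool_set (space M) A"
  have sub: "range A \<subseteq> range ?B" by (auto intro: range_eqI[of _ _ "Atom _"])
  have "\<exists>B\<in>range ?B. prob (sym_diff S B) < \<epsilon>"
  proof (rule algebra_dense[OF _ _ _ _ _ e])
    show "range ?B \<subseteq> events" using bool_set_events[of A, OF A] by blast
    \<comment> \<open>Expressions have no constant for the empty set; it arises as the complement of
      a tautology.\<close>
    have "?B (Neg (Or (Atom 0) (Neg (Atom 0)))) = {}"
      using sets.sets_into_space[OF A[of 0]] by auto
    then show "{} \<in> range ?B" by (metis rangeI)
    show "space M - B \<in> range ?B" if "B \<in> range ?B" for B
      using that by (auto intro: range_eqI[of _ _ "Neg _"])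
    show "B \<union> C \<in> range ?B" if "B \<in> range ?B" "C \<in> range ?B" for B C
      using that by (auto intro: range_eqI[of _ _ "Or _ _"])
    show "S \<in> sigma_sets (space M) (range ?B)"
      using S sigma_sets_mono'[OF sub] by blast
  qed
  then show ?thesis by blast
qed

text \<open>A subset of a separable metric space is separable. The sets \<open>bool_set\<close> need
  not belong to the subset, so for every expression and every radius 1/(m+1) one member within that
  radius is picked, if there is one.\<close>

lemma countable_dense_subfamily:
  assumes A: "\<And>n::nat. A n \<in> events" and S: "\<S> \<subseteq> sigma_sets (space M) (range A)" and ne: "\<S> \<noteq> {}"
  obtains D :: "nat \<Rightarrow> 'a set" where "range D \<subseteq> \<S>"
    "\<And>S \<epsilon>. S \<in> \<S> \<Longrightarrow> 0 < \<epsilon> \<Longrightarrow> \<exists>k. prob (sym_diff S (D k)) < \<epsilon>"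
proof -
  note B = bool_set_events[of A, OF A]
  have "sigma_sets (space M) (range A) \<subseteq> events" using A by (intro sets.sigma_sets_subset) auto
  then have SE: "S \<in> events" if "S \<in> \<S>" for S using S that by blast
  define near where "near e m S \<longleftrightarrow> S \<in> \<S> \<and> prob (sym_diff S (bool_set (space M) A e)) < inverse (real (Suc m))" for e m S
  \<comment> \<open>The default keeps \<open>pick\<close> inside the family when no member is
    near.\<close>
  define pick where "pick p = (if \<exists>S. near (fst p) (snd p) S then SOME S. near (fst p) (snd p) S else SOME S. S \<in> \<S>)"
    for p :: "bool_expr \<times> nat"
  have pick: "near e m (pick (e, m))" if "near e m S" for e m S
    using someI[of "near e m" S] that by (auto simp: pick_def)
  have "pick p \<in> \<S>" for p
  proof (cases "\<exists>S. near (fst p) (snd p) S")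
    case True
    then show ?thesis using pick[of "fst p" "snd p"] by (auto simp: near_def)
  next
    case False
    then show ?thesis using ne some_in_eq by (auto simp: pick_def)
  qed
  moreover have "\<exists>k. prob (sym_diff S (pick (from_nat k))) < \<epsilon>" if S1: "S \<in> \<S>" and \<epsilon>: "0 < \<epsilon>" for S \<epsilon>
  proof -
    obtain m where m: "inverse (real (Suc m)) < \<epsilon>/2" using reals_Archimedean[of "\<epsilon>/2"] \<epsilon> by auto
    obtain e where "near e m S"
      using bool_set_dense[of A S "inverse (real (Suc m))"] A S S1 by (auto simp: near_def)
    from pick[OF this] have p: "near e m (pick (e, m))" .
    have "prob (sym_diff S (pick (e, m))) \<le> prob (sym_diff S (bool_set (space M) A e))
        + prob (sym_diff (bool_set (space M) A e) (pick (e, m)))"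
      using SE[OF S1] SE p B by (intro prob_sym_diff_trans) (auto simp: near_def)
    also have "sym_diff (bool_set (space M) A e) (pick (e, m)) = sym_diff (pick (e, m)) (bool_set (space M) A e)" by auto
    finally have "prob (sym_diff S (pick (e, m))) < \<epsilon>"
      using \<open>near e m S\<close> p m by (simp add: near_def)
    then show ?thesis by (intro exI[of _ "to_nat (e, m)"]) simp
  qed
  ultimately show ?thesis using that[of "\<lambda>k. pick (from_nat k)"] by blast
qed

text \<open>Borel-Cantelli: the errors are summable, so almost every point lies in only finitely
  many symmetric differences. The lower limit of the \<open>C n\<close> serves as representative
  because it lies in every sigma-algebra that contains them.\<close>

lemma AE_eventually_mem_iff:
  assumes A: "A \<in> events" and C: "\<And>n::nat. C n \<in> events"
    and close: "\<And>n. prob (sym_diff A (C n)) < (1/2)^n"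
  shows "AE x in M. x \<in> A \<longleftrightarrow> x \<in> (\<Union>n. \<Inter>m. C (n + m))"
proof -
  have "summable (\<lambda>n. prob (sym_diff A (C n)))"
    using close by (intro summable_comparison_test_ev[OF _ summable_geometric[of "1/2::real"]]) (auto simp: less_imp_le)
  then have "AE x in M. eventually (\<lambda>n. x \<in> space M - sym_diff A (C n)) sequentially"
    using A C by (intro borel_cantelli_AE1) (auto simp: emeasure_eq_measure)
  then show ?thesis
  proof eventually_elim
    case (elim x)
    then obtain N where N: "\<And>n. n \<ge> N \<Longrightarrow> x \<in> A \<longleftrightarrow> x \<in> C n"
      by (auto simp: eventually_sequentially)
    show ?case
    proof
      assume "x \<in> A"
      then have "\<forall>m. x \<in> C (N + m)" using N by simp
      then show "x \<in> (\<Union>n. \<Inter>m. C (n + m))" by blast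
    next
      assume "x \<in> (\<Union>n. \<Inter>m. C (n + m))"
      then obtain n where "\<forall>m. x \<in> C (n + m)" by blast
      then have "x \<in> C (n + N)" by blast
      then show "x \<in> A" using N[of "n + N"] by simp
    qed
  qed
qed


section \<open>Sub-sigma-algebras and their conditional expectations\<close>

definition subfield :: "'a set set \<Rightarrow> bool" where
  "subfield F \<longleftrightarrow> sigma_algebra (space M) F \<and> F \<subseteq> events"

text \<open>Sub-sigma-algebras are plain families of sets, so that nets of them are ordered by
  inclusion; \<open>sigma (space M) F\<close> packs one into the measure object that
  \<open>real_cond_exp\<close> expects.\<close>

definition cexp :: "'a set set \<Rightarrow> ('a \<Rightarrow> real) \<Rightarrow> 'a \<Rightarrow> real" where
  "cexp F u = real_cond_exp M (sigma (space M) F) u"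

lemma subfield_events: "subfield events"
  unfolding subfield_def using sets.sigma_algebra_axioms by blast

lemma sets_subfield: "subfield F \<Longrightarrow> sets (sigma (space M) F) = F"
  unfolding subfield_def using sigma_algebra.sets_measure_of_eq by blast

lemma subalgebra_subfield: "subfield F \<Longrightarrow> subalgebra M (sigma (space M) F)"
  unfolding subalgebra_def using sets_subfield[of F] by (auto simp: subfield_def space_measure_of_conv)

lemma sigma_finite_subfield: "subfield F \<Longrightarrow> sigma_finite_subalgebra M (sigma (space M) F)"
  by (intro finite_measure_subalgebra_is_sigma_finite)
    (simp add: finite_measure_subalgebra_def finite_measure_subalgebra_axioms_def
      subalgebra_subfield finite_measure_axioms)

lemma cexp_measurable [measurable]: "cexp F u \<in> borel_measurable M"
  and cexp_measurable_subfield: "cexp F u \<in> borel_measurable (sigma (space M) F)"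
  by (simp_all add: cexp_def)

lemma measurable_subfield_mono:
  assumes "subfield F" "subfield F'" "F \<subseteq> F'" "f \<in> borel_measurable (sigma (space M) F)"
  shows "f \<in> borel_measurable (sigma (space M) F')"
proof -
  have "subalgebra (sigma (space M) F') (sigma (space M) F)"
    using assms(3) by (simp add: subalgebra_def sets_subfield assms(1,2) space_measure_of_conv)
  then show ?thesis using measurable_from_subalg assms(4) by blast
qed

context
  fixes F assumes F: "subfield F"
begin

interpretation sigma_finite_subalgebra M "sigma (space M) F"
  by (rule sigma_finite_subfield[OF F])

lemma cexp_integrable: "integrable M u \<Longrightarrow> integrable M (cexp F u)"
  and cexp_integral: "integrable M u \<Longrightarrow> (\<integral>x. cexp F u x \<partial>M) = (\<integral>x. u x \<partial>M)"
  unfolding cexp_def using real_cond_exp_int by blast+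

lemma cexp_mult_integral:
  assumes "f \<in> borel_measurable (sigma (space M) F)" "u \<in> borel_measurable M" "integrable M (\<lambda>x. f x * u x)"
  shows "integrable M (\<lambda>x. f x * cexp F u x)" "(\<integral>x. f x * cexp F u x \<partial>M) = (\<integral>x. f x * u x \<partial>M)"
  unfolding cexp_def using real_cond_exp_intg[OF assms(3,1,2)] by auto

lemma cexp_add:
  "integrable M u \<Longrightarrow> integrable M v \<Longrightarrow> AE x in M. cexp F (\<lambda>x. u x + v x) x = cexp F u x + cexp F v x"
  unfolding cexp_def by (rule real_cond_exp_add)

lemma cexp_diff:
  "integrable M u \<Longrightarrow> integrable M v \<Longrightarrow> AE x in M. cexp F (\<lambda>x. u x - v x) x = cexp F u x - cexp F v x"
  unfolding cexp_def by (rule real_cond_exp_diff)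

lemma cexp_cmult: "integrable M u \<Longrightarrow> AE x in M. cexp F (\<lambda>x. c * u x) x = c * cexp F u x"
  unfolding cexp_def by (rule real_cond_exp_cmult)

lemma cexp_mono:
  "AE x in M. u x \<le> v x \<Longrightarrow> integrable M u \<Longrightarrow> integrable M v \<Longrightarrow> AE x in M. cexp F u x \<le> cexp F v x"
  unfolding cexp_def by (rule real_cond_exp_mono)

lemma cexp_ge: "integrable M u \<Longrightarrow> AE x in M. c \<le> u x \<Longrightarrow> AE x in M. c \<le> cexp F u x"
  unfolding cexp_def by (rule real_cond_exp_ge_c)

lemma cexp_le: "integrable M u \<Longrightarrow> AE x in M. u x \<le> c \<Longrightarrow> AE x in M. cexp F u x \<le> c"
  unfolding cexp_def by (rule real_cond_exp_le_c)

lemma cexp_id: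
  "integrable M u \<Longrightarrow> u \<in> borel_measurable (sigma (space M) F) \<Longrightarrow> AE x in M. cexp F u x = u x"
  unfolding cexp_def by (rule real_cond_exp_F_meas)

lemma cexp_unique:
  assumes "integrable M u" "integrable M v" "v \<in> borel_measurable (sigma (space M) F)"
    and "\<And>A. A \<in> F \<Longrightarrow> (\<integral>x\<in>A. u x \<partial>M) = (\<integral>x\<in>A. v x \<partial>M)"
  shows "AE x in M. cexp F u x = v x"
  unfolding cexp_def by (rule real_cond_exp_charact) (use assms sets_subfield[OF F] in auto)

lemma cexp_set_integral:
  "integrable M u \<Longrightarrow> A \<in> F \<Longrightarrow> (\<integral>x\<in>A. cexp F u x \<partial>M) = (\<integral>x\<in>A. u x \<partial>M)"
  unfolding cexp_def using real_cond_exp_intA[of u A] sets_subfield[OF F] by simp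

text \<open>Monotonicity applied to w = u - v and to - w bounds \<bar>E(w | F)\<bar> by
  E(\<bar>w\<bar> | F), which has the same integral as \<bar>w\<bar>.\<close>

lemma cexp_L1_contraction:
  assumes u: "integrable M u" and v: "integrable M v"
  shows "(\<integral>x. \<bar>cexp F u x - cexp F v x\<bar> \<partial>M) \<le> (\<integral>x. \<bar>u x - v x\<bar> \<partial>M)"
proof -
  define w where "w x = u x - v x" for x
  have w: "integrable M w" using u v unfolding w_def[abs_def] by simp
  have aw: "integrable M (\<lambda>x. \<bar>w x\<bar>)" using w by simp
  have "AE x in M. cexp F w x \<le> cexp F (\<lambda>x. \<bar>w x\<bar>) x"
    by (intro cexp_mono w aw AE_I2) simp
  moreover have "AE x in M. cexp F (\<lambda>x. - 1 * w x) x \<le> cexp F (\<lambda>x. \<bar>w x\<bar>) x"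
    by (intro cexp_mono aw AE_I2 integrable_mult_right w) simp
  moreover have "AE x in M. cexp F w x = cexp F u x - cexp F v x"
    unfolding w_def by (rule cexp_diff[OF u v])
  moreover have "AE x in M. cexp F (\<lambda>x. - 1 * w x) x = - 1 * cexp F w x" by (rule cexp_cmult[OF w])
  ultimately have "AE x in M. \<bar>cexp F u x - cexp F v x\<bar> \<le> cexp F (\<lambda>x. \<bar>w x\<bar>) x"
    by eventually_elim simp
  then have "(\<integral>x. \<bar>cexp F u x - cexp F v x\<bar> \<partial>M) \<le> (\<integral>x. cexp F (\<lambda>x. \<bar>w x\<bar>) x \<partial>M)"
    by (intro integral_mono_AE integrable_abs Bochner_Integration.integrable_diff cexp_integrable u v aw)
  also have "\<dots> = (\<integral>x. \<bar>u x - v x\<bar> \<partial>M)"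
    by (simp add: cexp_integral[OF aw]) (simp add: w_def)
  finally show ?thesis .
qed

end

section \<open>Convergence in mean along directed families\<close>

lemma L1_triangle:
  fixes u v w :: "'a \<Rightarrow> real"
  assumes "integrable M u" "integrable M v" "integrable M w"
  shows "(\<integral>x. \<bar>u x - w x\<bar> \<partial>M) \<le> (\<integral>x. \<bar>u x - v x\<bar> \<partial>M) + (\<integral>x. \<bar>v x - w x\<bar> \<partial>M)"
proof -
  have "(\<integral>x. \<bar>u x - w x\<bar> \<partial>M) \<le> (\<integral>x. \<bar>u x - v x\<bar> + \<bar>v x - w x\<bar> \<partial>M)"
    using assms by (intro integral_mono) auto
  also have "\<dots> = (\<integral>x. \<bar>u x - v x\<bar> \<partial>M) + (\<integral>x. \<bar>v x - w x\<bar> \<partial>M)"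
    using assms by (intro Bochner_Integration.integral_add) auto
  finally show ?thesis .
qed

text \<open>Nets of sigma-algebras are directed by a relation \<open>R\<close>, which is inclusion for the upward and
  reverse inclusion for the downward martingale theorem.\<close>

definition cexp_converges :: "('a set set \<Rightarrow> 'a set set \<Rightarrow> bool) \<Rightarrow> 'a set set set \<Rightarrow> 'a set set \<Rightarrow> ('a \<Rightarrow> real) \<Rightarrow> bool" where
  "cexp_converges R \<F> H u \<longleftrightarrow>
     (\<forall>\<epsilon>>0. \<exists>F0\<in>\<F>. \<forall>F\<in>\<F>. R F0 F \<longrightarrow> (\<integral>x. \<bar>cexp F u x - cexp H u x\<bar> \<partial>M) < \<epsilon>)"

text \<open>Contractivity makes the functions with convergence a closed linear subspace of L1, so
  indicators, whose combinations are dense, suffice. Directedness provides a stage that is late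
  enough for two summands at once.\<close>

lemma cexp_converges_integrable:
  assumes sub: "\<And>F. F \<in> \<F> \<Longrightarrow> subfield F" and subi: "subfield H"
    and dir: "\<And>F1 F2. F1 \<in> \<F> \<Longrightarrow> F2 \<in> \<F> \<Longrightarrow> \<exists>F3\<in>\<F>. \<forall>F\<in>\<F>. R F3 F \<longrightarrow> R F1 F \<and> R F2 F"
    and base: "\<And>A. A \<in> events \<Longrightarrow> cexp_converges R \<F> H (indicator A)"
    and u: "integrable M u"
  shows "cexp_converges R \<F> H u"
proof -
  \<comment> \<open>Closedness in L1 by three errors: replacing u by v changes both conditional
    expectations by at most the L1 distance of u and v.\<close>
  have approx: "cexp_converges R \<F> H u"
    if u: "integrable M u" and v: "\<And>\<epsilon>. 0 < \<epsilon> \<Longrightarrow> \<exists>v. integrable M v \<and> cexp_converges R \<F> H v \<and> (\<integral>x. \<bar>u x - v x\<bar> \<partial>M) < \<epsilon>" for u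
    unfolding cexp_converges_def
  proof (intro allI impI)
    fix \<epsilon> :: real assume \<epsilon>: "0 < \<epsilon>"
    obtain v where v: "integrable M v" "cexp_converges R \<F> H v" "(\<integral>x. \<bar>u x - v x\<bar> \<partial>M) < \<epsilon>/3"
      using v[of "\<epsilon>/3"] \<epsilon> by auto
    obtain F0 where F0: "F0 \<in> \<F>" "\<And>F. F \<in> \<F> \<Longrightarrow> R F0 F \<Longrightarrow> (\<integral>x. \<bar>cexp F v x - cexp H v x\<bar> \<partial>M) < \<epsilon>/3"
      using v(2)[unfolded cexp_converges_def, rule_format, of "\<epsilon>/3"] \<epsilon> by auto
    have "(\<integral>x. \<bar>cexp F u x - cexp H u x\<bar> \<partial>M) < \<epsilon>" if F: "F \<in> \<F>" "R F0 F" for F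
    proof -
      note i = cexp_integrable[OF sub[OF F(1)]] cexp_integrable[OF subi]
      have "(\<integral>x. \<bar>cexp F u x - cexp H u x\<bar> \<partial>M)
          \<le> (\<integral>x. \<bar>cexp F u x - cexp F v x\<bar> \<partial>M) + (\<integral>x. \<bar>cexp F v x - cexp H u x\<bar> \<partial>M)"
        by (intro L1_triangle i u v)
      moreover have "(\<integral>x. \<bar>cexp F v x - cexp H u x\<bar> \<partial>M)
          \<le> (\<integral>x. \<bar>cexp F v x - cexp H v x\<bar> \<partial>M) + (\<integral>x. \<bar>cexp H v x - cexp H u x\<bar> \<partial>M)"
        by (intro L1_triangle i u v)
      moreover have "(\<integral>x. \<bar>cexp F u x - cexp F v x\<bar> \<partial>M) \<le> (\<integral>x. \<bar>u x - v x\<bar> \<partial>M)"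
        by (rule cexp_L1_contraction[OF sub[OF F(1)] u v(1)])
      moreover have "(\<integral>x. \<bar>cexp H v x - cexp H u x\<bar> \<partial>M) \<le> (\<integral>x. \<bar>v x - u x\<bar> \<partial>M)"
        by (rule cexp_L1_contraction[OF subi v(1) u])
      moreover have "(\<integral>x. \<bar>v x - u x\<bar> \<partial>M) = (\<integral>x. \<bar>u x - v x\<bar> \<partial>M)" by (simp add: abs_minus_commute)
      ultimately show ?thesis using F0(2)[OF F] v(3) by linarith
    qed
    then show "\<exists>F0\<in>\<F>. \<forall>F\<in>\<F>. R F0 F \<longrightarrow> (\<integral>x. \<bar>cexp F u x - cexp H u x\<bar> \<partial>M) < \<epsilon>"
      using F0(1) by blast
  qed
  show ?thesis
    using u
  proof (induction rule: integrable_induct)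
    case (base A c)
    show ?case
      unfolding cexp_converges_def
    proof (intro allI impI)
      fix \<epsilon> :: real assume \<epsilon>: "0 < \<epsilon>"
      have i: "integrable M (indicator A :: 'a \<Rightarrow> real)" using base by (intro integrable_real_indicator) auto
      have eq: "(\<integral>x. \<bar>cexp F (\<lambda>x. indicator A x *\<^sub>R c) x - cexp H (\<lambda>x. indicator A x *\<^sub>R c) x\<bar> \<partial>M)
          = \<bar>c\<bar> * (\<integral>x. \<bar>cexp F (indicator A) x - cexp H (indicator A) x\<bar> \<partial>M)" if F: "F \<in> \<F>" for F
      proof -
        have "AE x in M. \<bar>cexp F (\<lambda>x. indicator A x *\<^sub>R c) x - cexp H (\<lambda>x. indicator A x *\<^sub>R c) x\<bar>
            = \<bar>c\<bar> * \<bar>cexp F (indicator A) x - cexp H (indicator A) x\<bar>"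
          using cexp_cmult[OF sub[OF F] i, of c] cexp_cmult[OF subi i, of c]
        proof eventually_elim
          case (elim x)
          then show ?case by (simp add: mult.commute[of _ c] abs_mult[symmetric] right_diff_distrib)
        qed
        then have "(\<integral>x. \<bar>cexp F (\<lambda>x. indicator A x *\<^sub>R c) x - cexp H (\<lambda>x. indicator A x *\<^sub>R c) x\<bar> \<partial>M)
            = (\<integral>x. \<bar>c\<bar> * \<bar>cexp F (indicator A) x - cexp H (indicator A) x\<bar> \<partial>M)"
          by (intro integral_cong_AE) measurable
        then show ?thesis by simp
      qed
      \<comment> \<open>Dividing by \<bar>c\<bar> + 1 instead of \<bar>c\<bar> covers c = 0.\<close>
      obtain F0 where F0: "F0 \<in> \<F>" "\<And>F. F \<in> \<F> \<Longrightarrow> R F0 F \<Longrightarrow>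
          (\<integral>x. \<bar>cexp F (indicator A) x - cexp H (indicator A) x\<bar> \<partial>M) < \<epsilon> / (\<bar>c\<bar> + 1)"
        using assms(4)[OF base(1), unfolded cexp_converges_def, rule_format, of "\<epsilon> / (\<bar>c\<bar> + 1)"] \<epsilon> by auto
      have "\<bar>c\<bar> * (\<integral>x. \<bar>cexp F (indicator A) x - cexp H (indicator A) x\<bar> \<partial>M) < \<epsilon>"
        if "F \<in> \<F>" "R F0 F" for F
      proof -
        have "\<bar>c\<bar> * (\<integral>x. \<bar>cexp F (indicator A) x - cexp H (indicator A) x\<bar> \<partial>M) \<le> \<bar>c\<bar> * (\<epsilon> / (\<bar>c\<bar> + 1))"
          using F0(2)[OF that] by (intro mult_left_mono) auto
        also have "\<dots> < (\<bar>c\<bar> + 1) * (\<epsilon> / (\<bar>c\<bar> + 1))" using \<epsilon> by (intro mult_strict_right_mono) auto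
        finally show ?thesis by (simp add: add_pos_nonneg less_imp_neq[symmetric])
      qed
      then show "\<exists>F0\<in>\<F>. \<forall>F\<in>\<F>. R F0 F \<longrightarrow>
          (\<integral>x. \<bar>cexp F (\<lambda>x. indicator A x *\<^sub>R c) x - cexp H (\<lambda>x. indicator A x *\<^sub>R c) x\<bar> \<partial>M) < \<epsilon>"
        using F0(1) eq by (intro bexI[of _ F0]) auto
    qed
  next
    case (add f g)
    show ?case
      unfolding cexp_converges_def
    proof (intro allI impI)
      fix \<epsilon> :: real assume \<epsilon>: "0 < \<epsilon>"
      obtain F1 where F1: "F1 \<in> \<F>" "\<And>F. F \<in> \<F> \<Longrightarrow> R F1 F \<Longrightarrow> (\<integral>x. \<bar>cexp F f x - cexp H f x\<bar> \<partial>M) < \<epsilon>/2"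
        using add(3)[unfolded cexp_converges_def, rule_format, of "\<epsilon>/2"] \<epsilon> by auto
      obtain F2 where F2: "F2 \<in> \<F>" "\<And>F. F \<in> \<F> \<Longrightarrow> R F2 F \<Longrightarrow> (\<integral>x. \<bar>cexp F g x - cexp H g x\<bar> \<partial>M) < \<epsilon>/2"
        using add(4)[unfolded cexp_converges_def, rule_format, of "\<epsilon>/2"] \<epsilon> by auto
      obtain F3 where F3: "F3 \<in> \<F>" "\<And>F. F \<in> \<F> \<Longrightarrow> R F3 F \<Longrightarrow> R F1 F \<and> R F2 F"
        using dir[OF F1(1) F2(1)] by blast
      have "(\<integral>x. \<bar>cexp F (\<lambda>x. f x + g x) x - cexp H (\<lambda>x. f x + g x) x\<bar> \<partial>M) < \<epsilon>" if F: "F \<in> \<F>" "R F3 F" for F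
      proof -
        note i = cexp_integrable[OF sub[OF F(1)]] cexp_integrable[OF subi]
        have "AE x in M. \<bar>cexp F (\<lambda>x. f x + g x) x - cexp H (\<lambda>x. f x + g x) x\<bar>
          \<le> \<bar>cexp F f x - cexp H f x\<bar> + \<bar>cexp F g x - cexp H g x\<bar>"
          using cexp_add[OF sub[OF F(1)] add(1,2)] cexp_add[OF subi add(1,2)] by eventually_elim simp
        then have "(\<integral>x. \<bar>cexp F (\<lambda>x. f x + g x) x - cexp H (\<lambda>x. f x + g x) x\<bar> \<partial>M)
          \<le> (\<integral>x. \<bar>cexp F f x - cexp H f x\<bar> + \<bar>cexp F g x - cexp H g x\<bar> \<partial>M)"
          by (intro integral_mono_AE integrable_abs Bochner_Integration.integrable_diff
              Bochner_Integration.integrable_add i add(1,2))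
        also have "\<dots> = (\<integral>x. \<bar>cexp F f x - cexp H f x\<bar> \<partial>M) + (\<integral>x. \<bar>cexp F g x - cexp H g x\<bar> \<partial>M)"
          by (intro Bochner_Integration.integral_add integrable_abs Bochner_Integration.integrable_diff i add(1,2))
        finally show ?thesis using F1(2) F2(2) F3(2)[OF F] F(1) by fastforce
      qed
      then show "\<exists>F0\<in>\<F>. \<forall>F\<in>\<F>. R F0 F \<longrightarrow>
          (\<integral>x. \<bar>cexp F (\<lambda>x. f x + g x) x - cexp H (\<lambda>x. f x + g x) x\<bar> \<partial>M) < \<epsilon>"
        using F3(1) by blast
    qed
  next
    case (lim f s)
    show ?case
    proof (rule approx[OF lim(4)])
      fix \<epsilon> :: real assume \<epsilon>: "0 < \<epsilon>"
      have "(\<lambda>i. \<integral>x. \<bar>f x - s i x\<bar> \<partial>M) \<longlonglongrightarrow> (\<integral>x. 0 \<partial>M)"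
      \<comment> \<open>The approximating simple functions satisfy \<bar>s i\<bar> \<le> 2 *
        \<bar>f\<bar>, whence the bound 3 * \<bar>f\<bar> for the difference.\<close>
      proof (rule integral_dominated_convergence[where w = "\<lambda>x. 3 * \<bar>f x\<bar>"])
        show "AE x in M. (\<lambda>i. \<bar>f x - s i x\<bar>) \<longlonglongrightarrow> 0"
        proof (rule AE_I2)
          fix x assume "x \<in> space M"
          from tendsto_diff[OF tendsto_const[of "f x"] lim(2)[OF this]]
          show "(\<lambda>i. \<bar>f x - s i x\<bar>) \<longlonglongrightarrow> 0" using tendsto_rabs_zero by fastforce
        qed
        show "AE x in M. norm \<bar>f x - s i x\<bar> \<le> 3 * \<bar>f x\<bar>" for i
        proof (rule AE_I2)
          fix x assume "x \<in> space M"
          from lim(3)[OF this, of i] show "norm \<bar>f x - s i x\<bar> \<le> 3 * \<bar>f x\<bar>" by simp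
        qed
      qed (use lim(1,4) in auto)
      then have "eventually (\<lambda>i. (\<integral>x. \<bar>f x - s i x\<bar> \<partial>M) < \<epsilon>) sequentially"
        using \<epsilon> by (intro order_tendstoD(2)) auto
      then obtain i where "(\<integral>x. \<bar>f x - s i x\<bar> \<partial>M) < \<epsilon>" by (auto simp: eventually_sequentially)
      then show "\<exists>v. integrable M v \<and> cexp_converges R \<F> H v \<and> (\<integral>x. \<bar>f x - v x\<bar> \<partial>M) < \<epsilon>"
        using lim(1,5) by blast
    qed
  qed
qed

lemma L1_indicator: "A \<in> events \<Longrightarrow> B \<in> events \<Longrightarrow> (\<integral>x. \<bar>indicator A x - indicator B x :: real\<bar> \<partial>M) = prob (sym_diff A B)"
proof -
  assume AB: "A \<in> events" "B \<in> events"
  have "(\<integral>x. \<bar>indicator A x - indicator B x :: real\<bar> \<partial>M) = (\<integral>x. indicator (sym_diff A B) x \<partial>M)"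
    by (intro Bochner_Integration.integral_cong) (auto simp: indicator_def)
  then show ?thesis using AB by simp
qed

text \<open>A directed union of sigma-algebras is an algebra, so by \<open>algebra_dense\<close>
  some B from a single F0 is close to A. Beyond F0 the set B is measurable, hence E(1_B | F) = 1_B,
  and E(1_A | F) differs from 1_A in mean by at most twice the measure of the symmetric
  difference.\<close>

theorem cexp_converges_upward:
  assumes ne: "\<F> \<noteq> {}" and sub: "\<And>F. F \<in> \<F> \<Longrightarrow> subfield F"
    and dir: "\<And>F1 F2. F1 \<in> \<F> \<Longrightarrow> F2 \<in> \<F> \<Longrightarrow> \<exists>F3\<in>\<F>. F1 \<subseteq> F3 \<and> F2 \<subseteq> F3"
    and gen: "events = sigma_sets (space M) (\<Union>\<F>)"
    and u: "integrable M u"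
  shows "cexp_converges (\<subseteq>) \<F> events u"
proof (rule cexp_converges_integrable[OF sub subfield_events _ _ u])
  fix F1 F2 assume "F1 \<in> \<F>" "F2 \<in> \<F>"
  from dir[OF this] show "\<exists>F3\<in>\<F>. \<forall>F\<in>\<F>. F3 \<subseteq> F \<longrightarrow> F1 \<subseteq> F \<and> F2 \<subseteq> F" by blast
next
  fix A assume A: "A \<in> events"
  show "cexp_converges (\<subseteq>) \<F> events (indicator A)"
    unfolding cexp_converges_def
  proof (intro allI impI)
    fix \<epsilon> :: real assume \<epsilon>: "0 < \<epsilon>"
    have "\<exists>B\<in>\<Union>\<F>. prob (sym_diff A B) < \<epsilon>/2"
    proof (rule algebra_dense)
      have sa: "F \<in> \<F> \<Longrightarrow> sigma_algebra (space M) F" for F using sub by (simp add: subfield_def)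
      show "\<Union>\<F> \<subseteq> events" using sub by (auto simp: subfield_def)
      show "{} \<in> \<Union>\<F>" using ne sa sigma_algebra.axioms(1) algebra.axioms(1) ring_of_sets.axioms(1) semiring_of_sets.empty_sets
        by (metis UnionI equals0I sigma_algebra_iff2)
      show "space M - B \<in> \<Union>\<F>" if B: "B \<in> \<Union>\<F>" for B
      proof -
        obtain F where "F \<in> \<F>" "B \<in> F" using B by blast
        then show ?thesis using sa[of F] unfolding sigma_algebra_iff2 by blast
      qed
      show "B \<union> C \<in> \<Union>\<F>" if BC: "B \<in> \<Union>\<F>" "C \<in> \<Union>\<F>" for B C
      proof -
        obtain F1 F2 where "F1 \<in> \<F>" "B \<in> F1" "F2 \<in> \<F>" "C \<in> F2" using BC by blast
        then obtain F where F: "F \<in> \<F>" "B \<in> F" "C \<in> F" using dir[of F1 F2] by blast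
        interpret sigma_algebra "space M" F using sa[OF F(1)] .
        show ?thesis using F by blast
      qed
      show "A \<in> sigma_sets (space M) (\<Union>\<F>)" using A gen by simp
    qed (use \<epsilon> in simp)
    then obtain B F0 where B: "B \<in> F0" "F0 \<in> \<F>" "prob (sym_diff A B) < \<epsilon>/2" by blast
    have BE: "B \<in> events" using sub[OF B(2)] B(1) by (auto simp: subfield_def)
    have "(\<integral>x. \<bar>cexp F (indicator A) x - cexp events (indicator A) x\<bar> \<partial>M) < \<epsilon>" if F: "F \<in> \<F>" "F0 \<subseteq> F" for F
    proof -
      have i: "integrable M (indicator A :: 'a \<Rightarrow> real)" "integrable M (indicator B :: 'a \<Rightarrow> real)"
        using A BE by (auto intro!: integrable_real_indicator simp: emeasure_eq_measure)
      note sF = sub[OF F(1)]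
      have Bm: "indicator B \<in> borel_measurable (sigma (space M) F)"
        using B F by (intro borel_measurable_indicator) (auto simp: sets_subfield[OF sF])
      have Am: "indicator A \<in> borel_measurable (sigma (space M) events)"
        using A by (intro borel_measurable_indicator) simp
      have "AE x in M. \<bar>cexp F (indicator A) x - cexp events (indicator A) x\<bar>
          \<le> \<bar>cexp F (indicator A) x - cexp F (indicator B) x\<bar> + \<bar>indicator A x - indicator B x\<bar>"
        using cexp_id[OF sF i(2) Bm] cexp_id[OF subfield_events i(1) Am] by eventually_elim simp
      then have "(\<integral>x. \<bar>cexp F (indicator A) x - cexp events (indicator A) x\<bar> \<partial>M)
          \<le> (\<integral>x. \<bar>cexp F (indicator A) x - cexp F (indicator B) x\<bar> + \<bar>indicator A x - indicator B x\<bar> \<partial>M)"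
        by (intro integral_mono_AE integrable_abs Bochner_Integration.integrable_diff
            Bochner_Integration.integrable_add cexp_integrable sF subfield_events i)
      also have "\<dots> = (\<integral>x. \<bar>cexp F (indicator A) x - cexp F (indicator B) x\<bar> \<partial>M) + (\<integral>x. \<bar>indicator A x - indicator B x\<bar> \<partial>M)"
        by (intro Bochner_Integration.integral_add integrable_abs Bochner_Integration.integrable_diff cexp_integrable sF i)
      also have "\<dots> \<le> 2 * prob (sym_diff A B)"
        using cexp_L1_contraction[OF sF i] L1_indicator[OF A BE] by simp
      finally show ?thesis using B(3) by simp
    qed
    then show "\<exists>F0\<in>\<F>. \<forall>F\<in>\<F>. F0 \<subseteq> F \<longrightarrow> (\<integral>x. \<bar>cexp F (indicator A) x - cexp events (indicator A) x\<bar> \<partial>M) < \<epsilon>"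
      using B(2) by blast
  qed
qed


text \<open>Completeness of F at work: two sets that agree almost everywhere differ by null sets,
  which F contains.\<close>

lemma subfield_AE_mem:
  assumes F: "subfield F" "null_sets M \<subseteq> F" and C: "C \<in> F" and A: "A \<in> events"
    and ae: "AE x in M. x \<in> A \<longleftrightarrow> x \<in> C"
  shows "A \<in> F"
proof -
  interpret F: sigma_algebra "space M" F using F by (simp add: subfield_def)
  have CS: "C \<in> events" using F C by (auto simp: subfield_def)
  have "AE x in M. x \<notin> A - C" "AE x in M. x \<notin> C - A"
    using ae by (auto elim!: eventually_mono)
  then have "A - C \<in> null_sets M" "C - A \<in> null_sets M"
    using A CS by (simp_all add: AE_iff_null_sets)
  then have "A - C \<in> F" "C - A \<in> F" using F by auto
  then have "(C - (C - A)) \<union> (A - C) \<in> F" using C by blast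
  moreover have "(C - (C - A)) \<union> (A - C) = A" by blast
  ultimately show ?thesis by simp
qed

lemma borel_measurable_subfield_iff:
  fixes f :: "'a \<Rightarrow> real"
  assumes "subfield F"
  shows "f \<in> borel_measurable (sigma (space M) F) \<longleftrightarrow> (\<forall>S\<in>sets borel. f -` S \<inter> space M \<in> F)"
  unfolding measurable_def by (simp add: sets_subfield[OF assms] space_measure_of_conv)

lemma borel_measurable_subfield_AE:
  fixes f g :: "'a \<Rightarrow> real"
  assumes F: "subfield F" "null_sets M \<subseteq> F" and f: "f \<in> borel_measurable (sigma (space M) F)"
    and g: "g \<in> borel_measurable M" and ae: "AE x in M. g x = f x"
  shows "g \<in> borel_measurable (sigma (space M) F)"
  unfolding borel_measurable_subfield_iff[OF F(1)]
proof
  fix S :: "real set" assume S: "S \<in> sets borel"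
  show "g -` S \<inter> space M \<in> F"
  proof (rule subfield_AE_mem[OF F])
    show "f -` S \<inter> space M \<in> F" using f S by (simp add: borel_measurable_subfield_iff[OF F(1)])
    show "g -` S \<inter> space M \<in> events" using g S by (rule measurable_sets)
    show "AE x in M. x \<in> g -` S \<inter> space M \<longleftrightarrow> x \<in> f -` S \<inter> space M"
      using ae by eventually_elim simp
  qed
qed

text \<open>By Tonelli the sum of the \<bar>d n\<bar> has an integral bounded by a geometric series,
  so it is finite almost everywhere. This turns fast convergence in mean into almost sure
  convergence.\<close>

lemma AE_summable_abs:
  fixes d :: "nat \<Rightarrow> 'a \<Rightarrow> real"
  assumes d: "\<And>n. integrable M (d n)" and le: "\<And>n. (\<integral>x. \<bar>d n x\<bar> \<partial>M) \<le> (1/2)^n"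
  shows "AE x in M. summable (\<lambda>n. \<bar>d n x\<bar>)"
proof -
  have [measurable]: "d n \<in> borel_measurable M" for n using d by auto
  have "(\<integral>\<^sup>+x. (\<Sum>n. ennreal \<bar>d n x\<bar>) \<partial>M) = (\<Sum>n. \<integral>\<^sup>+x. ennreal \<bar>d n x\<bar> \<partial>M)"
    by (rule nn_integral_suminf) measurable
  also have "\<dots> \<le> (\<Sum>n. ennreal ((1/2)^n))"
  proof (rule suminf_le)
    fix n
    have "(\<integral>\<^sup>+x. ennreal \<bar>d n x\<bar> \<partial>M) = ennreal (\<integral>x. \<bar>d n x\<bar> \<partial>M)"
      using d by (intro nn_integral_eq_integral) auto
    then show "(\<integral>\<^sup>+x. ennreal \<bar>d n x\<bar> \<partial>M) \<le> ennreal ((1/2)^n)" using le[of n] by (simp add: ennreal_leI)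
  qed auto
  also have "\<dots> = ennreal (\<Sum>n. (1/2::real)^n)"
    by (intro suminf_ennreal2 summable_geometric) auto
  finally have "(\<integral>\<^sup>+x. (\<Sum>n. ennreal \<bar>d n x\<bar>) \<partial>M) \<noteq> \<infinity>" by (auto simp: top_unique)
  then have "AE x in M. (\<Sum>n. ennreal \<bar>d n x\<bar>) \<noteq> \<infinity>"
    by (intro nn_integral_PInf_AE) auto
  then show ?thesis
    by eventually_elim (auto intro!: summable_suminf_not_top)
qed

lemma subfield_Inter:
  assumes "\<F> \<noteq> {}" "\<And>F. F \<in> \<F> \<Longrightarrow> subfield F"
  shows "subfield (\<Inter>\<F>)"
proof -
  have sa: "sigma_algebra (space M) F" "F \<subseteq> events" if "F \<in> \<F>" for F
    using assms(2)[OF that] by (auto simp: subfield_def)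
  have "sigma_algebra (space M) (\<Inter>\<F>)"
    unfolding sigma_algebra_iff2
  proof (intro conjI allI ballI impI)
    show "\<Inter>\<F> \<subseteq> Pow (space M)" using assms(1) sa(2) sets.sets_into_space by blast
    show "{} \<in> \<Inter>\<F>" using sa(1) by (auto simp: sigma_algebra_iff2)
    show "space M - s \<in> \<Inter>\<F>" if "s \<in> \<Inter>\<F>" for s using sa(1) that by (auto simp: sigma_algebra_iff2)
    show "(\<Union>i. A i) \<in> \<Inter>\<F>" if A: "range A \<subseteq> \<Inter>\<F>" for A :: "nat \<Rightarrow> 'a set"
    proof
      fix F assume F: "F \<in> \<F>"
      then have "range A \<subseteq> F" using A by blast
      then show "(\<Union>i. A i) \<in> F" using sa(1)[OF F] unfolding sigma_algebra_iff2 by blast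
    qed
  qed
  then show ?thesis using assms(1) sa(2) by (auto simp: subfield_def)
qed

lemma bounded_mult_integrable:
  fixes f g :: "'a \<Rightarrow> real"
  assumes [measurable]: "f \<in> borel_measurable M" "g \<in> borel_measurable M"
    and "AE x in M. \<bar>f x\<bar> \<le> 1" "AE x in M. \<bar>g x\<bar> \<le> 1"
  shows "integrable M (\<lambda>x. f x * g x)"
proof (rule integrable_const_bound[where B = 1])
  show "AE x in M. norm (f x * g x) \<le> 1"
    using assms(3,4) by eventually_elim (simp add: abs_mult mult_le_one)
qed measurable

text \<open>For bounded \<open>u\<close>, the conditional expectations along a decreasing chain are Cauchy in \<open>L\<^sup>2\<close>
  because their norms decrease (Pythagoras); the limit along a chain that minimizes the norm
  is measurable for every member of the family.\<close>

lemma cexp_converges_downward_bounded: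
  assumes ne: "\<F> \<noteq> {}" and sub: "\<And>F. F \<in> \<F> \<Longrightarrow> subfield F"
    and dir: "\<And>F1 F2. F1 \<in> \<F> \<Longrightarrow> F2 \<in> \<F> \<Longrightarrow> \<exists>F3\<in>\<F>. F3 \<subseteq> F1 \<and> F3 \<subseteq> F2"
    and null: "\<And>F. F \<in> \<F> \<Longrightarrow> null_sets M \<subseteq> F"
    and um: "u \<in> borel_measurable M" and u1: "AE x in M. \<bar>u x\<bar> \<le> 1"
  shows "cexp_converges (\<supseteq>) \<F> (\<Inter>\<F>) u"
proof -
  have u: "integrable M u" using um u1 by (intro integrable_const_bound[where B = 1]) auto
  have e1: "AE x in M. \<bar>cexp F u x\<bar> \<le> 1" if "F \<in> \<F>" for F
  proof -
    have "AE x in M. - 1 \<le> u x" "AE x in M. u x \<le> 1" using u1 by (auto elim!: eventually_mono)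
    from cexp_ge[OF sub[OF that] u this(1)] cexp_le[OF sub[OF that] u this(2)]
    show ?thesis by eventually_elim simp
  qed
  have ei: "integrable M (cexp F u)" if "F \<in> \<F>" for F by (rule cexp_integrable[OF sub[OF that] u])
  define J where "J F = (\<integral>x. cexp F u x * cexp F u x \<partial>M)" for F
  have mi: "integrable M (\<lambda>x. cexp F u x * cexp F' u x)" if "F \<in> \<F>" "F' \<in> \<F>" for F F'
    using that by (intro bounded_mult_integrable e1 cexp_measurable)
  \<comment> \<open>The factor E(u | F) is measurable for F' and for F, so the other factor E(u |
    F') may be replaced by u and then by E(u | F).\<close>
  have cross: "(\<integral>x. cexp F u x * cexp F' u x \<partial>M) = J F" if F: "F \<in> \<F>" "F' \<in> \<F>" "F \<subseteq> F'" for F F'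
  proof -
    have i: "integrable M (\<lambda>x. cexp F u x * u x)" by (intro bounded_mult_integrable e1 F um u1 cexp_measurable)
    have "(\<integral>x. cexp F u x * cexp F' u x \<partial>M) = (\<integral>x. cexp F u x * u x \<partial>M)"
      by (intro cexp_mult_integral(2)[OF sub[OF F(2)]] um i
          measurable_subfield_mono[OF sub[OF F(1)] sub[OF F(2)] F(3)] cexp_measurable_subfield)
    also have "\<dots> = J F"
      unfolding J_def by (intro cexp_mult_integral(2)[OF sub[OF F(1)], symmetric] um i cexp_measurable_subfield)
    finally show ?thesis .
  qed
  have pyth: "(\<integral>x. (cexp F' u x - cexp F u x)^2 \<partial>M) = J F' - J F" if F: "F \<in> \<F>" "F' \<in> \<F>" "F \<subseteq> F'" for F F'
  proof -
    have "(\<integral>x. (cexp F' u x - cexp F u x)^2 \<partial>M)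
       = (\<integral>x. cexp F' u x * cexp F' u x - 2 * (cexp F u x * cexp F' u x) + cexp F u x * cexp F u x \<partial>M)"
      by (intro Bochner_Integration.integral_cong) (auto simp: power2_eq_square algebra_simps)
    also have "\<dots> = J F' - 2 * J F + J F"
      using mi F cross[OF F] by (simp add: J_def)
    finally show ?thesis by simp
  qed
  have L1: "(\<integral>x. \<bar>cexp F' u x - cexp F u x\<bar> \<partial>M) \<le> t"
    if F: "F \<in> \<F>" "F' \<in> \<F>" "F \<subseteq> F'" and t: "0 < t" "J F' - J F \<le> t^2" for F F' t
  proof -
    have sq: "integrable M (\<lambda>x. (cexp F' u x - cexp F u x)^2)"
    proof -
      have "(\<lambda>x. (cexp F' u x - cexp F u x)^2)
        = (\<lambda>x. cexp F' u x * cexp F' u x - 2 * (cexp F u x * cexp F' u x) + cexp F u x * cexp F u x)"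
        by (auto simp: power2_eq_square algebra_simps)
      then show ?thesis using mi F by simp
    qed
    \<comment> \<open>This is a rearranged square, (\<bar>d\<bar> - t)^2 \<ge> 0; integrated, it
      turns the bound on the L2 distance into one on the L1 distance.\<close>
    have pt: "\<bar>d\<bar> \<le> t/2 + d^2 / (2 * t)" for d :: real
    proof -
      have "0 \<le> (\<bar>d\<bar> - t)^2 / (2 * t)" using t(1) by simp
      also have "(\<bar>d\<bar> - t)^2 / (2 * t) = t/2 + d^2 / (2 * t) - \<bar>d\<bar>"
        using t(1) by (simp add: power2_diff field_simps power2_eq_square)
      finally show ?thesis by simp
    qed
    have "(\<integral>x. \<bar>cexp F' u x - cexp F u x\<bar> \<partial>M) \<le> (\<integral>x. t/2 + (cexp F' u x - cexp F u x)^2 / (2 * t) \<partial>M)"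
      using ei F sq pt by (intro integral_mono) auto
    also have "\<dots> = t/2 + (J F' - J F) / (2 * t)"
      using sq by (simp add: prob_space pyth[OF F])
    also have "\<dots> \<le> t/2 + t^2 / (2 * t)" using t by (intro add_left_mono divide_right_mono) auto
    also have "\<dots> = t" using t(1) by (simp add: power2_eq_square)
    finally show ?thesis .
  qed
  \<comment> \<open>The infimum of the squared norms over the whole family; it need not be
    attained.\<close>
  define j where "j = Inf (J ` \<F>)"
  have Jnn: "0 \<le> J F" for F unfolding J_def by (intro integral_nonneg_AE) auto
  then have bdd: "bdd_below (J ` \<F>)" by (intro bdd_belowI[of _ 0]) auto
  have jle: "j \<le> J F" if "F \<in> \<F>" for F unfolding j_def using bdd that by (intro cInf_lower) auto
  have near: "\<exists>F\<in>\<F>. J F < j + (1/4)^n" for n :: nat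
  proof -
    have "Inf (J ` \<F>) < j + (1/4)^n" by (simp add: j_def)
    then show ?thesis using cInf_lessD[of "J ` \<F>"] ne by blast
  qed
  have Jmono: "J F \<le> J F'" if "F \<in> \<F>" "F' \<in> \<F>" "F \<subseteq> F'" for F F'
  proof -
    have "0 \<le> (\<integral>x. (cexp F' u x - cexp F u x)^2 \<partial>M)" by (intro integral_nonneg_AE) auto
    then show ?thesis using pyth[OF that] by simp
  qed
  \<comment> \<open>A decreasing chain whose squared norms come within (1/4)^n of the infimum. The
    square roots (1/2)^n bound the L1 distances and are summable.\<close>
  have "\<exists>F. \<forall>n. (F n \<in> \<F> \<and> J (F n) < j + (1/4)^n) \<and> F (Suc n) \<subseteq> F n"
  proof (rule dependent_nat_choice)
    show "\<exists>F. F \<in> \<F> \<and> J F < j + (1/4)^0" using near[of 0] by auto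
    fix F n assume F: "F \<in> \<F> \<and> J F < j + (1/4)^n"
    obtain F' where F': "F' \<in> \<F>" "J F' < j + (1/4)^Suc n" using near[of "Suc n"] by blast
    obtain F3 where F3: "F3 \<in> \<F>" "F3 \<subseteq> F" "F3 \<subseteq> F'" using dir F F'(1) by blast
    have "J F3 < j + (1/4)^Suc n" using Jmono[OF F3(1) F'(1) F3(3)] F'(2) by simp
    then show "\<exists>y. (y \<in> \<F> \<and> J y < j + (1/4)^Suc n) \<and> y \<subseteq> F" using F3 by blast
  qed
  then obtain F where F: "\<And>n. F n \<in> \<F>" "\<And>n. J (F n) < j + (1/4)^n" "\<And>n. F (Suc n) \<subseteq> F n" by blast
  \<comment> \<open>Not only later members of the chain but every H below F n is this close, because
    no norm falls below j. Both the measurability of the limit and the convergence along the whole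
    family rest on this.\<close>
  have close: "(\<integral>x. \<bar>cexp (F n) u x - cexp H u x\<bar> \<partial>M) \<le> (1/2)^n" if "H \<in> \<F>" "H \<subseteq> F n" for H n
  proof (rule L1[OF that(1) F(1) that(2)])
    have "J (F n) - J H \<le> (1/4)^n" using F(2)[of n] jle[OF that(1)] by simp
    also have "(1/4::real)^n = ((1/2)^n)^2" by (simp add: power_mult[symmetric] mult.commute[of n 2] power_mult power_divide)
    finally show "J (F n) - J H \<le> ((1/2)^n)^2" .
  qed simp
  define a where "a x = lim (\<lambda>n. cexp (F n) u x)" for x
  have am: "a \<in> borel_measurable M" unfolding a_def by (intro borel_measurable_lim_metric cexp_measurable)
  have "AE x in M. summable (\<lambda>n. \<bar>cexp (F (Suc n)) u x - cexp (F n) u x\<bar>)"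
  proof (rule AE_summable_abs)
    fix n
    show "(\<integral>x. \<bar>cexp (F (Suc n)) u x - cexp (F n) u x\<bar> \<partial>M) \<le> (1/2)^n"
      using close[OF F(1) F(3), of n] by (simp add: abs_minus_commute)
  qed (use ei F(1) in auto)
  then have conv: "AE x in M. (\<lambda>n. cexp (F n) u x) \<longlonglongrightarrow> a x"
  proof eventually_elim
    case (elim x)
    then have "summable (\<lambda>n. cexp (F (Suc n)) u x - cexp (F n) u x)" by (rule summable_rabs_cancel)
    then have "convergent (\<lambda>n. \<Sum>k<n. cexp (F (Suc k)) u x - cexp (F k) u x)"
      by (simp add: summable_iff_convergent)
    then have "convergent (\<lambda>n. cexp (F n) u x - cexp (F 0) u x)"
      by (simp only: sum_lessThan_telescope[of "\<lambda>n. cexp (F n) u x"])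
    then have "convergent (\<lambda>n. (cexp (F n) u x - cexp (F 0) u x) + cexp (F 0) u x)"
      by (intro convergent_add convergent_const)
    then show ?case by (simp add: a_def convergent_LIMSEQ_iff)
  qed
  \<comment> \<open>For a member F' off the chain, sigma-algebras H n below both F' and F n are
    chosen. Their conditional expectations are F'-measurable and have the same almost sure limit as
    the chain, so the limit is F'-measurable by completeness.\<close>
  have aF: "a \<in> borel_measurable (sigma (space M) F')" if F': "F' \<in> \<F>" for F'
  proof -
    have "\<forall>n. \<exists>H\<in>\<F>. H \<subseteq> F' \<and> H \<subseteq> F n" using dir F' F(1) by blast
    then obtain H where H: "\<And>n. H n \<in> \<F>" "\<And>n. H n \<subseteq> F'" "\<And>n. H n \<subseteq> F n" by metis
    define b where "b x = lim (\<lambda>n. cexp (H n) u x)" for x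
    have "b \<in> borel_measurable (sigma (space M) F')"
      unfolding b_def
    proof (rule borel_measurable_lim_metric)
      show "cexp (H n) u \<in> borel_measurable (sigma (space M) F')" for n
        by (rule measurable_subfield_mono[OF sub[OF H(1)] sub[OF F'] H(2) cexp_measurable_subfield])
    qed
    moreover have "AE x in M. summable (\<lambda>n. \<bar>cexp (F n) u x - cexp (H n) u x\<bar>)"
      by (rule AE_summable_abs) (use ei F(1) H(1) close[OF H(1) H(3)] in auto)
    then have "AE x in M. a x = b x"
      using conv
    proof eventually_elim
      case (elim x)
      have "(\<lambda>n. cexp (F n) u x - cexp (H n) u x) \<longlonglongrightarrow> 0"
        using summable_LIMSEQ_zero[OF elim(1)] by (rule tendsto_rabs_zero_cancel)
      from tendsto_diff[OF elim(2) this] have "(\<lambda>n. cexp (H n) u x) \<longlonglongrightarrow> a x" by simp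
      then show ?case by (simp add: b_def limI)
    qed
    ultimately show ?thesis
      by (intro borel_measurable_subfield_AE[OF sub[OF F'] null[OF F'] _ am])
  qed
  have subI: "subfield (\<Inter>\<F>)" by (rule subfield_Inter[OF ne sub])
  have aI: "a \<in> borel_measurable (sigma (space M) (\<Inter>\<F>))"
    using aF unfolding borel_measurable_subfield_iff[OF subI] by (simp add: borel_measurable_subfield_iff sub)
  have e1all: "AE x in M. \<forall>n. \<bar>cexp (F n) u x\<bar> \<le> 1" using e1 F(1) by (simp add: AE_all_countable)
  have a1: "AE x in M. \<bar>a x\<bar> \<le> 1"
    using conv e1all
  proof eventually_elim
    case (elim x)
    show ?case by (rule LIMSEQ_le_const2[OF tendsto_rabs[OF elim(1)]]) (use elim(2) in auto)
  qed
  have ai: "integrable M a" using am a1 by (intro integrable_const_bound[where B = 1]) auto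
  \<comment> \<open>Over a set of the intersection every conditional expectation of the chain has
    the same integral as u, and so has the bounded limit.\<close>
  have ae: "AE x in M. cexp (\<Inter>\<F>) u x = a x"
  proof (rule cexp_unique[OF subI u ai aI])
    fix A assume A: "A \<in> \<Inter>\<F>"
    then have AE: "A \<in> events" using subI by (auto simp: subfield_def)
    have "(\<lambda>n. \<integral>x\<in>A. cexp (F n) u x \<partial>M) \<longlonglongrightarrow> (\<integral>x\<in>A. a x \<partial>M)"
      unfolding set_lebesgue_integral_def
    proof (rule integral_dominated_convergence[where w = "\<lambda>_. 1"])
      show "AE x in M. (\<lambda>n. indicator A x *\<^sub>R cexp (F n) u x) \<longlonglongrightarrow> indicator A x *\<^sub>R a x"
        using conv by eventually_elim (intro tendsto_intros)
      show "AE x in M. norm (indicator A x *\<^sub>R cexp (F n) u x) \<le> 1" for n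
        using e1[OF F(1)[of n]] by eventually_elim (auto simp: indicator_def)
    qed (use AE am in auto)
    moreover have "(\<integral>x\<in>A. cexp (F n) u x \<partial>M) = (\<integral>x\<in>A. u x \<partial>M)" for n
      using A F(1) by (intro cexp_set_integral[OF sub[OF F(1)] u]) auto
    ultimately show "(\<integral>x\<in>A. u x \<partial>M) = (\<integral>x\<in>A. a x \<partial>M)" by (simp add: LIMSEQ_const_iff)
  qed
  have "(\<lambda>n. \<integral>x. \<bar>cexp (F n) u x - a x\<bar> \<partial>M) \<longlonglongrightarrow> (\<integral>x. 0 \<partial>M)"
  proof (rule integral_dominated_convergence[where w = "\<lambda>_. 2"])
    show "AE x in M. (\<lambda>n. \<bar>cexp (F n) u x - a x\<bar>) \<longlonglongrightarrow> 0"
      using conv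
    proof eventually_elim
      case (elim x)
      from tendsto_diff[OF this tendsto_const[of "a x"]] show ?case using tendsto_rabs_zero by fastforce
    qed
    show "AE x in M. norm \<bar>cexp (F n) u x - a x\<bar> \<le> 2" for n
      using e1all a1
    proof eventually_elim
      case (elim x)
      have "\<bar>cexp (F n) u x - a x\<bar> \<le> \<bar>cexp (F n) u x\<bar> + \<bar>a x\<bar>" by (rule abs_triangle_ineq4)
      then show ?case using elim(1)[rule_format, of n] elim(2) by simp
    qed
  qed (use am in auto)
  then have lim0: "(\<lambda>n. \<integral>x. \<bar>cexp (F n) u x - a x\<bar> \<partial>M) \<longlonglongrightarrow> 0" by simp
  show ?thesis
    unfolding cexp_converges_def
  proof (intro allI impI)
    fix \<epsilon> :: real assume \<epsilon>: "0 < \<epsilon>"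
    have "eventually (\<lambda>n. (\<integral>x. \<bar>cexp (F n) u x - a x\<bar> \<partial>M) < \<epsilon>/2) sequentially"
      using \<epsilon> by (intro order_tendstoD(2)[OF lim0]) simp
    moreover have "eventually (\<lambda>n. (1/2::real)^n < \<epsilon>/2) sequentially"
      using \<epsilon> by (intro order_tendstoD(2)[OF LIMSEQ_realpow_zero]) auto
    ultimately have "eventually (\<lambda>n. (\<integral>x. \<bar>cexp (F n) u x - a x\<bar> \<partial>M) < \<epsilon>/2 \<and> (1/2::real)^n < \<epsilon>/2) sequentially"
      by (rule eventually_conj)
    then obtain n where n: "(\<integral>x. \<bar>cexp (F n) u x - a x\<bar> \<partial>M) < \<epsilon>/2" "(1/2::real)^n < \<epsilon>/2"
      by (auto simp: eventually_sequentially)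
    have "(\<integral>x. \<bar>cexp H u x - cexp (\<Inter>\<F>) u x\<bar> \<partial>M) < \<epsilon>" if H: "H \<in> \<F>" "H \<subseteq> F n" for H
    proof -
      have "(\<integral>x. \<bar>cexp H u x - cexp (\<Inter>\<F>) u x\<bar> \<partial>M) = (\<integral>x. \<bar>cexp H u x - a x\<bar> \<partial>M)"
        using ae am by (intro integral_cong_AE) (auto elim!: eventually_mono)
      also have "\<dots> \<le> (\<integral>x. \<bar>cexp H u x - cexp (F n) u x\<bar> \<partial>M) + (\<integral>x. \<bar>cexp (F n) u x - a x\<bar> \<partial>M)"
        by (intro L1_triangle ei H(1) F(1) ai)
      also have "(\<integral>x. \<bar>cexp H u x - cexp (F n) u x\<bar> \<partial>M) = (\<integral>x. \<bar>cexp (F n) u x - cexp H u x\<bar> \<partial>M)"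
        by (simp add: abs_minus_commute)
      finally show ?thesis using close[OF H] n by simp
    qed
    then show "\<exists>F0\<in>\<F>. \<forall>H\<in>\<F>. H \<subseteq> F0 \<longrightarrow> (\<integral>x. \<bar>cexp H u x - cexp (\<Inter>\<F>) u x\<bar> \<partial>M) < \<epsilon>"
      using F(1) by blast
  qed
qed

theorem cexp_converges_downward:
  assumes ne: "\<F> \<noteq> {}" and sub: "\<And>F. F \<in> \<F> \<Longrightarrow> subfield F"
    and dir: "\<And>F1 F2. F1 \<in> \<F> \<Longrightarrow> F2 \<in> \<F> \<Longrightarrow> \<exists>F3\<in>\<F>. F3 \<subseteq> F1 \<and> F3 \<subseteq> F2"
    and null: "\<And>F. F \<in> \<F> \<Longrightarrow> null_sets M \<subseteq> F"
    and u: "integrable M u"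
  shows "cexp_converges (\<supseteq>) \<F> (\<Inter>\<F>) u"
proof (rule cexp_converges_integrable[OF sub subfield_Inter[OF ne sub] _ _ u])
  fix F1 F2 assume "F1 \<in> \<F>" "F2 \<in> \<F>"
  from dir[OF this] show "\<exists>F3\<in>\<F>. \<forall>F\<in>\<F>. F3 \<supseteq> F \<longrightarrow> F1 \<supseteq> F \<and> F2 \<supseteq> F" by blast
next
  fix A assume "A \<in> events"
  then show "cexp_converges (\<supseteq>) \<F> (\<Inter>\<F>) (indicator A)"
    by (intro cexp_converges_downward_bounded[OF ne sub dir null]) (auto simp: indicator_def)
qed

text \<open>With \<open>\<rho>\<close> the density of \<open>g\<^sup>-\<^sup>1\<lambda>\<close>, this is the \<open>g\<close>-term of the Furstenberg entropy of the
  factor belonging to \<open>F\<close>.\<close>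

definition field_entropy :: "'a set set \<Rightarrow> ('a \<Rightarrow> real) \<Rightarrow> real" where
  "field_entropy F \<rho> = (\<integral>x. - ln (cexp F \<rho> x) \<partial>M)"

context
  fixes \<rho> :: "'a \<Rightarrow> real" and c :: real
  assumes c: "0 < c" and \<rho>: "integrable M \<rho>" and ge: "AE x in M. c \<le> \<rho> x" and one: "(\<integral>x. \<rho> x \<partial>M) = 1"
begin

text \<open>The logarithm lies between ln c and a - 1.\<close>

lemma integrable_ln_ge:
  assumes a: "integrable M a" and ac: "AE x in M. c \<le> a x"
  shows "integrable M (\<lambda>x. ln (a x))"
proof (rule Bochner_Integration.integrable_bound[where f = "\<lambda>x. a x + \<bar>ln c\<bar>"])
  show "integrable M (\<lambda>x. a x + \<bar>ln c\<bar>)" using a by simp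
  show "(\<lambda>x. ln (a x)) \<in> borel_measurable M" using a by measurable
  show "AE x in M. norm (ln (a x)) \<le> norm (a x + \<bar>ln c\<bar>)"
    using ac
  proof eventually_elim
    case (elim x)
    have "ln (a x) \<le> a x - 1" using elim c by (intro ln_le_minus_one) simp
    moreover have "ln c \<le> ln (a x)" using elim c by simp
    ultimately have "\<bar>ln (a x)\<bar> \<le> a x + \<bar>ln c\<bar>" using elim c by linarith
    then show ?case using elim c by simp
  qed
qed

lemma cexp_density:
  assumes "subfield F"
  shows "integrable M (cexp F \<rho>)" "AE x in M. c \<le> cexp F \<rho> x" "(\<integral>x. cexp F \<rho> x \<partial>M) = 1"
    "integrable M (\<lambda>x. ln (cexp F \<rho> x))"
  using cexp_integrable[OF assms \<rho>] cexp_ge[OF assms \<rho> ge] cexp_integral[OF assms \<rho>] one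
    integrable_ln_ge[OF cexp_integrable[OF assms \<rho>] cexp_ge[OF assms \<rho> ge]] by auto

text \<open>The lower bound is Jensen's inequality in the form - ln t \<ge> 1 - t, for a density of
  mean 1; the upper bound holds because E(\<rho> | F) stays above c.\<close>

lemma field_entropy_bounds:
  assumes F: "subfield F"
  shows "0 \<le> field_entropy F \<rho>" "field_entropy F \<rho> \<le> - ln c"
proof -
  note d = cexp_density[OF F]
  have "(\<integral>x. 1 - cexp F \<rho> x \<partial>M) \<le> (\<integral>x. - ln (cexp F \<rho> x) \<partial>M)"
  proof (rule integral_mono_AE)
    show "AE x in M. 1 - cexp F \<rho> x \<le> - ln (cexp F \<rho> x)"
      using d(2)
    proof eventually_elim
      case (elim x)
      then show ?case using ln_le_minus_one[of "cexp F \<rho> x"] c by simp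
    qed
  qed (use d in auto)
  then show "0 \<le> field_entropy F \<rho>" using d by (simp add: field_entropy_def prob_space)
  have "(\<integral>x. - ln (cexp F \<rho> x) \<partial>M) \<le> (\<integral>x. - ln c \<partial>M)"
  proof (rule integral_mono_AE)
    show "AE x in M. - ln (cexp F \<rho> x) \<le> - ln c"
      using d(2) by eventually_elim (use c in simp)
  qed (use d in auto)
  then show "field_entropy F \<rho> \<le> - ln c" by (simp add: field_entropy_def prob_space)
qed

text \<open>Above c the logarithm has slope at most 1/c. In the application c is \<mu>(g).\<close>

lemma field_entropy_Lipschitz:
  assumes F: "subfield F" and H: "subfield H"
  shows "\<bar>field_entropy F \<rho> - field_entropy H \<rho>\<bar> \<le> (\<integral>x. \<bar>cexp F \<rho> x - cexp H \<rho> x\<bar> \<partial>M) / c"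
proof -
  note d = cexp_density[OF F] and e = cexp_density[OF H]
  have ln_diff: "ln s - ln t \<le> \<bar>s - t\<bar> / c" if "c \<le> s" "c \<le> t" for s t :: real
  proof -
    have "ln s - ln t = ln (s / t)" using that c by (simp add: ln_div)
    also have "\<dots> \<le> s / t - 1" using that c by (intro ln_le_minus_one) simp
    also have "\<dots> = (s - t) / t" using that c by (simp add: field_simps)
    also have "\<dots> \<le> \<bar>s - t\<bar> / t" using that c by (intro divide_right_mono) auto
    also have "\<dots> \<le> \<bar>s - t\<bar> / c" using that c by (intro divide_left_mono) auto
    finally show ?thesis .
  qed
  have "\<bar>field_entropy F \<rho> - field_entropy H \<rho>\<bar> = \<bar>\<integral>x. - ln (cexp F \<rho> x) + ln (cexp H \<rho> x) \<partial>M\<bar>"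
    using d e by (simp add: field_entropy_def)
  also have "\<dots> \<le> (\<integral>x. \<bar>- ln (cexp F \<rho> x) + ln (cexp H \<rho> x)\<bar> \<partial>M)"
    by (rule integral_abs_bound)
  also have "\<dots> \<le> (\<integral>x. \<bar>cexp F \<rho> x - cexp H \<rho> x\<bar> / c \<partial>M)"
  proof (rule integral_mono_AE)
    show "AE x in M. \<bar>- ln (cexp F \<rho> x) + ln (cexp H \<rho> x)\<bar> \<le> \<bar>cexp F \<rho> x - cexp H \<rho> x\<bar> / c"
      using d(2) e(2)
    proof eventually_elim
      case (elim x)
      then show ?case
        using ln_diff[of "cexp F \<rho> x" "cexp H \<rho> x"] ln_diff[of "cexp H \<rho> x" "cexp F \<rho> x"]
        by (simp add: abs_le_iff abs_minus_commute)
    qed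
  qed (use d e in auto)
  also have "\<dots> = (\<integral>x. \<bar>cexp F \<rho> x - cexp H \<rho> x\<bar> \<partial>M) / c" by simp
  finally show ?thesis .
qed

text \<open>Gibbs' inequality: \<open>t - 1 - ln t \<ge> 0\<close>, with equality only at \<open>t = 1\<close>, for \<open>t = \<rho> / E(\<rho>|F)\<close>.\<close>

lemma field_entropy_le:
  assumes F: "subfield F"
  shows "field_entropy F \<rho> \<le> (\<integral>x. - ln (\<rho> x) \<partial>M)"
    and "field_entropy F \<rho> = (\<integral>x. - ln (\<rho> x) \<partial>M) \<Longrightarrow> AE x in M. cexp F \<rho> x = \<rho> x"
proof -
  note d = cexp_density[OF F]
  have \<rho>m: "\<rho> \<in> borel_measurable M" using \<rho> by auto
  have inv_m: "(\<lambda>x. 1 / cexp F \<rho> x) \<in> borel_measurable (sigma (space M) F)"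
    using cexp_measurable_subfield by measurable
  have i: "integrable M (\<lambda>x. 1 / cexp F \<rho> x * \<rho> x)"
  proof (rule Bochner_Integration.integrable_bound[where f = "\<lambda>x. \<rho> x / c"])
    show "AE x in M. norm (1 / cexp F \<rho> x * \<rho> x) \<le> norm (\<rho> x / c)"
      using d(2) ge
    proof eventually_elim
      case (elim x)
      then have "\<rho> x / cexp F \<rho> x \<le> \<rho> x / c" using c by (intro divide_left_mono) auto
      then show ?case using elim c by simp
    qed
  qed (use \<rho> \<rho>m in auto)
  \<comment> \<open>The reciprocal of E(\<rho> | F) is F-measurable, so \<rho> may be replaced by
    its conditional expectation: the quotient t has mean 1.\<close>
  have "(\<integral>x. 1 / cexp F \<rho> x * \<rho> x \<partial>M) = (\<integral>x. 1 / cexp F \<rho> x * cexp F \<rho> x \<partial>M)"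
    by (rule cexp_mult_integral(2)[OF F inv_m \<rho>m i, symmetric])
  also have "\<dots> = (\<integral>x. 1 \<partial>M)"
  proof (rule integral_cong_AE)
    show "AE x in M. 1 / cexp F \<rho> x * cexp F \<rho> x = 1" using d(2) by eventually_elim (use c in auto)
  qed auto
  finally have int1: "(\<integral>x. 1 / cexp F \<rho> x * \<rho> x \<partial>M) = 1" by (simp add: prob_space)
  \<comment> \<open>This is t - 1 - ln t for t = \<rho> / E(\<rho> | F), with the logarithm split.
    Since t has mean 1, the integral is the difference of the two entropies.\<close>
  define D where "D x = 1 / cexp F \<rho> x * \<rho> x - 1 - ln (\<rho> x) + ln (cexp F \<rho> x)" for x
  have l: "integrable M (\<lambda>x. ln (\<rho> x))" by (rule integrable_ln_ge[OF \<rho> ge])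
  have Di: "integrable M D" unfolding D_def[abs_def] using i l d(4) by auto
  have Dint: "(\<integral>x. D x \<partial>M) = (\<integral>x. - ln (\<rho> x) \<partial>M) - field_entropy F \<rho>"
    unfolding D_def using i l d(4) int1 by (simp add: field_entropy_def prob_space)
  have Deq: "AE x in M. D x = \<rho> x / cexp F \<rho> x - 1 - ln (\<rho> x / cexp F \<rho> x) \<and> 0 < \<rho> x / cexp F \<rho> x"
    using d(2) ge
  proof eventually_elim
    case (elim x)
    then have "0 < \<rho> x" "0 < cexp F \<rho> x" using c by auto
    then show ?case by (simp add: D_def ln_div)
  qed
  have Dnn: "AE x in M. 0 \<le> D x"
    using Deq
  proof eventually_elim
    case (elim x)
    then show ?case using ln_le_minus_one[of "\<rho> x / cexp F \<rho> x"] by simp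
  qed
  then have "0 \<le> (\<integral>x. D x \<partial>M)" by (rule integral_nonneg_AE)
  then show "field_entropy F \<rho> \<le> (\<integral>x. - ln (\<rho> x) \<partial>M)" using Dint by simp
  assume "field_entropy F \<rho> = (\<integral>x. - ln (\<rho> x) \<partial>M)"
  then have "(\<integral>x. D x \<partial>M) = 0" using Dint by simp
  then have "AE x in M. D x = 0" using integral_nonneg_eq_0_iff_AE[OF Di Dnn] by blast
  then show "AE x in M. cexp F \<rho> x = \<rho> x"
    using Deq d(2)
  proof eventually_elim
    case (elim x)
    have "\<rho> x / cexp F \<rho> x = 1" using elim(1,2) by (intro ln_eq_minus_one) auto
    then show ?case using elim(3) c by (simp add: divide_eq_1_iff)
  qed
qed

end

end

section \<open>Harmonic functions along the random walk\<close>

locale random_walk = group G for G :: "('g, 'm) monoid_scheme" (structure) +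
  fixes \<mu> :: "'g pmf"
  assumes countable_carrier: "countable (carrier G)"
    and set_pmf_subset: "set_pmf \<mu> \<subseteq> carrier G"
begin

abbreviation \<Omega> :: "(nat \<Rightarrow> 'g) measure" where
  "\<Omega> \<equiv> PiM UNIV (\<lambda>_::nat. measure_pmf \<mu>)"

sublocale increments: sequence_space "measure_pmf \<mu>"
  by unfold_locales

lemma AE_set_pmf: "AE w in \<Omega>. \<forall>i. w i \<in> set_pmf \<mu>"
  unfolding AE_all_countable
  by (intro allI AE_PiM_component) (auto intro: prob_space_measure_pmf AE_pmfI)

definition clip :: "'g \<Rightarrow> 'g" where
  "clip g = (if g \<in> carrier G then g else \<one>)"

lemma clip_closed [simp]: "clip g \<in> carrier G"
  by (simp add: clip_def)

lemma clip_id: "g \<in> carrier G \<Longrightarrow> clip g = g"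
  by (simp add: clip_def)

text \<open>The type of group elements may be uncountable, and multiplication need not be measurable for
  the product of two discrete sigma-algebras on it. Clipping the increments to the countable
  carrier changes the walk only on a null set and makes it measurable.\<close>

definition W :: "(nat \<Rightarrow> 'g) \<Rightarrow> nat \<Rightarrow> 'g" where
  "W w n = walk G (\<lambda>i. clip (w i)) n"

lemma W_0 [simp]: "W w 0 = \<one>"
  and W_Suc: "W w (Suc n) = W w n \<otimes> clip (w n)"
  by (simp_all add: W_def)

lemma W_closed [simp]: "W w n \<in> carrier G"
  by (induction n) (simp_all add: W_Suc)

lemma AE_walk_eq_W: "AE w in \<Omega>. walk G w = W w"
  using AE_set_pmf
proof eventually_elim
  case (elim w)
  then have "(\<lambda>i. clip (w i)) = w" using set_pmf_subset by (auto simp: clip_def fun_eq_iff)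
  then show ?case by (simp add: W_def fun_eq_iff)
qed

text \<open>Increments are multiplied on the right, so the first one is the leftmost factor:
  prepending an increment translates the remaining walk. All first-step arguments rest on
  this.\<close>

lemma W_case_nat: "W (case_nat s w) (Suc n) = clip s \<otimes> W w n"
  by (induction n) (simp_all add: W_Suc m_assoc)

lemma W_measurable: "(\<lambda>w. W w n) \<in> measurable \<Omega> (count_space (carrier G))"
proof (induction n)
  case 0
  then show ?case by simp
next
  case (Suc n)
  have [measurable]: "(\<lambda>w. w n) \<in> measurable \<Omega> (count_space UNIV)"
    using measurable_component_singleton[of n UNIV "\<lambda>_. measure_pmf \<mu>"]
    by (simp cong: measurable_cong_sets)
  note [measurable] = Suc
  \<comment> \<open>The previous position takes countably many values, so each value of the new
    position is a countable union over them.\<close>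
  have *: "(\<lambda>w. W w (Suc n)) -` {a} \<inter> space \<Omega>
      = (\<Union>b\<in>carrier G. ((\<lambda>w. W w n) -` {b} \<inter> space \<Omega>)
           \<inter> ((\<lambda>w. w n) -` {g. b \<otimes> clip g = a} \<inter> space \<Omega>))" for a
    by (auto simp: W_Suc)
  have "(\<lambda>w. W w (Suc n)) -` {a} \<inter> space \<Omega> \<in> sets \<Omega>" for a
  proof -
    have 1: "(\<lambda>w. W w n) -` {b} \<inter> space \<Omega> \<in> sets \<Omega>" if "b \<in> carrier G" for b
      using that by (intro measurable_sets[OF Suc]) simp
    have 2: "(\<lambda>w. w n) -` {g. b \<otimes> clip g = a} \<inter> space \<Omega> \<in> sets \<Omega>" for b
      by (rule measurable_sets[of _ _ "count_space UNIV"]) simp_all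
    show ?thesis unfolding *
      by (intro sets.countable_UN'[OF countable_carrier] image_subsetI, rule sets.Int) (auto simp del: vimage_Collect_eq intro!: 1 2)
  qed
  then show ?case
    by (simp add: measurable_count_space_eq_countable countable_carrier)
qed

lemma borel_measurable_W: "(\<lambda>w. f (W w n)) \<in> borel_measurable \<Omega>"
  by (rule measurable_compose[OF W_measurable]) simp

lemma W_pred_measurable:
  "{w \<in> space \<Omega>. P (W w n)} \<in> sets \<Omega>"
proof -
  have "{w \<in> space \<Omega>. P (W w n)} = (\<lambda>w. W w n) -` {g\<in>carrier G. P g} \<inter> space \<Omega>"
    by auto
  also have "\<dots> \<in> sets \<Omega>" by (intro measurable_sets[OF W_measurable]) auto
  finally show ?thesis .
qed

text \<open>The increments are independent and identically distributed: a path is a first increment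
  followed by an independent path of the same law.\<close>

lemma nn_integral_first_step:
  assumes [measurable]: "F \<in> borel_measurable \<Omega>"
  shows "(\<integral>\<^sup>+ w. F w \<partial>\<Omega>) = (\<integral>\<^sup>+ s. \<integral>\<^sup>+ w. F (case_nat s w) \<partial>\<Omega> \<partial>measure_pmf \<mu>)"
proof -
  have "(\<integral>\<^sup>+ w. F w \<partial>\<Omega>)
      = (\<integral>\<^sup>+ w. F w \<partial>distr (measure_pmf \<mu> \<Otimes>\<^sub>M \<Omega>) \<Omega> (\<lambda>(s, w). case_nat s w))"
    by (simp only: increments.PiM_iter)
  also have "\<dots> = (\<integral>\<^sup>+ x. F (case x of (s, w) \<Rightarrow> case_nat s w) \<partial>(measure_pmf \<mu> \<Otimes>\<^sub>M \<Omega>))"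
    by (intro nn_integral_distr) measurable
  also have "\<dots> = (\<integral>\<^sup>+ s. \<integral>\<^sup>+ w. F (case_nat s w) \<partial>\<Omega> \<partial>measure_pmf \<mu>)"
    by (subst increments.nn_integral_fst[symmetric]) (auto simp: split_def)
  finally show ?thesis .
qed

text \<open>The mean value property under right multiplication, the direction in which the walk
  moves. The \<open>ennreal\<close> integral matches the form of \<open>stationary\<close>; values
  in [0, 1] make \<phi> along the walk a bounded martingale.\<close>

definition harmonic :: "('g \<Rightarrow> real) \<Rightarrow> bool" where
  "harmonic \<phi> \<longleftrightarrow> (\<forall>g\<in>carrier G. 0 \<le> \<phi> g \<and> \<phi> g \<le> 1 \<and>
     (\<integral>\<^sup>+ s. ennreal (\<phi> (g \<otimes> s)) \<partial>measure_pmf \<mu>) = ennreal (\<phi> g))"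

lemma harmonic_shift:
  assumes "harmonic \<phi>" "g \<in> carrier G"
  shows "harmonic (\<lambda>h. \<phi> (g \<otimes> h))"
proof -
  have "(\<integral>\<^sup>+ s. ennreal (\<phi> (g \<otimes> (h \<otimes> s))) \<partial>measure_pmf \<mu>)
      = (\<integral>\<^sup>+ s. ennreal (\<phi> ((g \<otimes> h) \<otimes> s)) \<partial>measure_pmf \<mu>)" if "h \<in> carrier G" for h
    using set_pmf_subset that assms(2) by (intro nn_integral_cong_AE AE_pmfI) (auto simp: m_assoc)
  then show ?thesis using assms by (auto simp: harmonic_def)
qed

lemma AE_clip: "AE s in measure_pmf \<mu>. clip s = s"
  using set_pmf_subset by (auto intro!: AE_pmfI clip_id)

text \<open>The induction splits off the first increment and not the last, which changes the
  starting point; therefore g is arbitrary.\<close>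

lemma nn_integral_harmonic_W:
  "harmonic \<phi> \<Longrightarrow> g \<in> carrier G \<Longrightarrow> (\<integral>\<^sup>+ w. ennreal (\<phi> (g \<otimes> W w n)) \<partial>\<Omega>) = ennreal (\<phi> g)"
proof (induction n arbitrary: g)
  case 0
  then show ?case by (simp add: prob_space.emeasure_space_1 increments.P.prob_space_axioms)
next
  case (Suc n)
  have "(\<integral>\<^sup>+ w. ennreal (\<phi> (g \<otimes> W w (Suc n))) \<partial>\<Omega>)
      = (\<integral>\<^sup>+ s. \<integral>\<^sup>+ w. ennreal (\<phi> (g \<otimes> W (case_nat s w) (Suc n))) \<partial>\<Omega> \<partial>measure_pmf \<mu>)"
    by (intro nn_integral_first_step borel_measurable_W)
  also have "\<dots> = (\<integral>\<^sup>+ s. \<integral>\<^sup>+ w. ennreal (\<phi> ((g \<otimes> clip s) \<otimes> W w n)) \<partial>\<Omega> \<partial>measure_pmf \<mu>)"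
    using Suc.prems by (simp add: W_case_nat m_assoc)
  also have "\<dots> = (\<integral>\<^sup>+ s. ennreal (\<phi> (g \<otimes> clip s)) \<partial>measure_pmf \<mu>)"
    using Suc by (intro nn_integral_cong) simp
  also have "\<dots> = (\<integral>\<^sup>+ s. ennreal (\<phi> (g \<otimes> s)) \<partial>measure_pmf \<mu>)"
    using AE_clip by (intro nn_integral_cong_AE) auto
  finally show ?case using Suc.prems by (simp add: harmonic_def)
qed

lemma integral_harmonic_W:
  assumes "harmonic \<phi>"
  shows "integrable \<Omega> (\<lambda>w. \<phi> (W w n))" "(\<integral> w. \<phi> (W w n) \<partial>\<Omega>) = \<phi> \<one>"
proof -
  have *: "(\<integral>\<^sup>+ w. ennreal (\<phi> (W w n)) \<partial>\<Omega>) = ennreal (\<phi> \<one>)"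
    using nn_integral_harmonic_W[OF assms one_closed, of n] by simp
  have nn: "\<And>g. g \<in> carrier G \<Longrightarrow> 0 \<le> \<phi> g" using assms by (simp add: harmonic_def)
  show "integrable \<Omega> (\<lambda>w. \<phi> (W w n))"
    by (rule integrableI_nn_integral_finite[OF _ _ *]) (auto intro!: borel_measurable_W nn)
  show "(\<integral> w. \<phi> (W w n) \<partial>\<Omega>) = \<phi> \<one>"
    by (rule integral_eq_nn_integral[THEN trans])
      (auto intro!: borel_measurable_W simp: * nn)
qed

text \<open>The value at the identity is the expectation along the walk at every time, so a bounded
  difference that tends to 0 must have expectation 0.\<close>

lemma harmonic_eqI:
  assumes "harmonic \<phi>" "harmonic \<psi>"
    and lim: "AE w in \<Omega>. (\<lambda>n. \<phi> (W w n) - \<psi> (W w n)) \<longlonglongrightarrow> 0"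
  shows "\<phi> \<one> = \<psi> \<one>"
proof -
  have "(\<lambda>n. \<integral> w. (\<phi> (W w n) - \<psi> (W w n)) \<partial>\<Omega>) \<longlonglongrightarrow> (\<integral> w. 0 \<partial>\<Omega>)"
  proof (rule integral_dominated_convergence[where w = "\<lambda>_. 1"])
    have "\<bar>\<phi> g - \<psi> g\<bar> \<le> 1" if "g \<in> carrier G" for g
      using assms(1,2) that unfolding harmonic_def by (auto simp: abs_le_iff add_increasing2 diff_le_eq)
    then show "\<And>i. AE w in \<Omega>. norm (\<phi> (W w i) - \<psi> (W w i)) \<le> 1" by simp
  qed (use lim in \<open>auto intro!: borel_measurable_W increments.P.integrable_const\<close>)
  moreover have "(\<integral> w. (\<phi> (W w n) - \<psi> (W w n)) \<partial>\<Omega>) = \<phi> \<one> - \<psi> \<one>" for n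
    using integral_harmonic_W[OF assms(1)] integral_harmonic_W[OF assms(2)] by simp
  ultimately show ?thesis by (simp add: LIMSEQ_const_iff)
qed

lemma harmonic_eq_0I:
  assumes "harmonic \<phi>" "AE w in \<Omega>. (\<lambda>n. \<phi> (W w n)) \<longlonglongrightarrow> 0"
  shows "\<phi> \<one> = 0"
  using harmonic_eqI[OF assms(1), of "\<lambda>_. 0"] assms(2) by (simp add: harmonic_def)

lemma ex_le_Suc_shift: "(\<exists>n\<le>Suc N. P n) \<longleftrightarrow> P 0 \<or> (\<exists>n\<le>N. P (Suc n))"
  by (metis Suc_le_mono not0_implies_Suc zero_le)

text \<open>Doob's maximal inequality by first-step analysis. If \<phi> g \<ge> \<epsilon>, the
  right side is at least 1. Otherwise time 0 does not count, and the bounds for the starting points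
  \<open>g \<otimes> s\<close> average to the bound for g by harmonicity.\<close>

lemma maximal_inequality_finite:
  assumes "0 < \<epsilon>"
  shows "harmonic \<phi> \<Longrightarrow> g \<in> carrier G \<Longrightarrow>
    emeasure \<Omega> {w \<in> space \<Omega>. \<exists>n\<le>N. \<epsilon> \<le> \<phi> (g \<otimes> W w n)} \<le> ennreal (\<phi> g / \<epsilon>)"
proof (induction N arbitrary: g)
  case 0
  have "0 \<le> \<phi> g" using 0 by (simp add: harmonic_def)
  have "emeasure \<Omega> {w \<in> space \<Omega>. \<epsilon> \<le> \<phi> g} \<le> ennreal (\<phi> g / \<epsilon>)"
  proof (cases "\<epsilon> \<le> \<phi> g")
    case True
    have "emeasure \<Omega> {w \<in> space \<Omega>. \<epsilon> \<le> \<phi> g} \<le> 1" by (rule increments.P.emeasure_le_1)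
    also have "1 \<le> ennreal (\<phi> g / \<epsilon>)" using assms True by (simp add: ennreal_ge_1)
    finally show ?thesis .
  qed simp
  then show ?case using 0 by simp
next
  case (Suc N)
  let ?E = "{w \<in> space \<Omega>. \<exists>n\<le>Suc N. \<epsilon> \<le> \<phi> (g \<otimes> W w n)}"
  have meas: "{w \<in> space \<Omega>. \<exists>n\<le>k. \<epsilon> \<le> \<phi> (h \<otimes> W w n)} \<in> sets \<Omega>" for k h
  proof -
    have "{w \<in> space \<Omega>. \<exists>n\<le>k. \<epsilon> \<le> \<phi> (h \<otimes> W w n)}
        = (\<Union>n\<le>k. {w \<in> space \<Omega>. \<epsilon> \<le> \<phi> (h \<otimes> W w n)})" by auto
    also have "\<dots> \<in> sets \<Omega>"
      by (intro sets.finite_UN finite_atMost W_pred_measurable[where P = "\<lambda>a. \<epsilon> \<le> \<phi> (h \<otimes> a)"])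
    finally show ?thesis .
  qed
  show ?case
  proof (cases "\<epsilon> \<le> \<phi> g")
    case True
    have "emeasure \<Omega> ?E \<le> 1" by (rule increments.P.emeasure_le_1)
    also have "1 \<le> ennreal (\<phi> g / \<epsilon>)" using assms True by (simp add: ennreal_ge_1)
    finally show ?thesis .
  next
    case False
    have E: "?E \<in> sets \<Omega>" by (rule meas)
    then have "emeasure \<Omega> ?E = (\<integral>\<^sup>+ w. indicator ?E w \<partial>\<Omega>)"
      by (rule nn_integral_indicator[symmetric])
    also have "\<dots> = (\<integral>\<^sup>+ s. \<integral>\<^sup>+ w. indicator ?E (case_nat s w) \<partial>\<Omega> \<partial>measure_pmf \<mu>)"
      using E by (intro nn_integral_first_step borel_measurable_indicator)
    also have "\<dots> = (\<integral>\<^sup>+ s. \<integral>\<^sup>+ w. indicator {w \<in> space \<Omega>. \<exists>n\<le>N. \<epsilon> \<le> \<phi> ((g \<otimes> clip s) \<otimes> W w n)} w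
        \<partial>\<Omega> \<partial>measure_pmf \<mu>)"
    proof (intro nn_integral_cong)
      fix s w
      have "(\<exists>n\<le>Suc N. \<epsilon> \<le> \<phi> (g \<otimes> W (case_nat s w) n))
          \<longleftrightarrow> (\<exists>n\<le>N. \<epsilon> \<le> \<phi> (g \<otimes> W (case_nat s w) (Suc n)))"
        using False Suc.prems by (simp add: ex_le_Suc_shift)
      then show "indicator ?E (case_nat s w) =
        (indicator {w \<in> space \<Omega>. \<exists>n\<le>N. \<epsilon> \<le> \<phi> ((g \<otimes> clip s) \<otimes> W w n)} w :: ennreal)"
        using Suc.prems by (auto simp: indicator_def W_case_nat m_assoc space_PiM)
    qed
    also have "\<dots> = (\<integral>\<^sup>+ s. emeasure \<Omega> {w \<in> space \<Omega>. \<exists>n\<le>N. \<epsilon> \<le> \<phi> ((g \<otimes> clip s) \<otimes> W w n)}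
        \<partial>measure_pmf \<mu>)"
      by (intro nn_integral_cong nn_integral_indicator meas)
    also have "\<dots> \<le> (\<integral>\<^sup>+ s. ennreal (\<phi> (g \<otimes> clip s) / \<epsilon>) \<partial>measure_pmf \<mu>)"
      using Suc by (intro nn_integral_mono) simp
    also have "\<dots> = (\<integral>\<^sup>+ s. ennreal (\<phi> (g \<otimes> s)) / ennreal \<epsilon> \<partial>measure_pmf \<mu>)"
    proof (intro nn_integral_cong_AE AE_pmfI)
      fix s assume "s \<in> set_pmf \<mu>"
      then have "s \<in> carrier G" using set_pmf_subset by auto
      then show "ennreal (\<phi> (g \<otimes> clip s) / \<epsilon>) = ennreal (\<phi> (g \<otimes> s)) / ennreal \<epsilon>"
        using Suc.prems assms by (simp add: clip_id divide_ennreal harmonic_def)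
    qed
    also have "\<dots> = ennreal (\<phi> g) / ennreal \<epsilon>"
      using Suc.prems by (simp add: nn_integral_divide harmonic_def)
    also have "\<dots> = ennreal (\<phi> g / \<epsilon>)"
      using Suc.prems assms by (intro divide_ennreal) (auto simp: harmonic_def)
    finally show ?thesis .
  qed
qed

lemma maximal_inequality:
  assumes "0 < \<epsilon>" "harmonic \<phi>"
  shows "emeasure \<Omega> {w \<in> space \<Omega>. \<exists>n. \<epsilon> \<le> \<phi> (W w n)} \<le> ennreal (\<phi> \<one> / \<epsilon>)"
proof -
  let ?A = "\<lambda>N. {w \<in> space \<Omega>. \<exists>n\<le>N. \<epsilon> \<le> \<phi> (W w n)}"
  have "?A N = (\<Union>n\<le>N. {w \<in> space \<Omega>. \<epsilon> \<le> \<phi> (W w n)})" for N by auto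
  then have meas: "?A N \<in> sets \<Omega>" for N
    by (auto intro!: sets.finite_UN W_pred_measurable[where P = "\<lambda>g. \<epsilon> \<le> \<phi> g"])
  have "{w \<in> space \<Omega>. \<exists>n. \<epsilon> \<le> \<phi> (W w n)} = (\<Union>N. ?A N)" by auto
  moreover have "emeasure \<Omega> (\<Union>N. ?A N) = (SUP N. emeasure \<Omega> (?A N))"
  proof (rule SUP_emeasure_incseq[symmetric])
    show "range ?A \<subseteq> sets \<Omega>" using meas by (rule image_subsetI)
    show "incseq ?A" by (rule incseq_SucI, rule subsetI, elim CollectE conjE exE, intro CollectI conjI)
      (simp_all, metis le_SucI)
  qed
  moreover have "\<dots> \<le> ennreal (\<phi> \<one> / \<epsilon>)"
    using maximal_inequality_finite[OF assms(1) assms(2) one_closed] by (intro SUP_least) simp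
  ultimately show ?thesis by simp
qed

text \<open>For fixed \<epsilon> the event that every \<open>\<phi> m\<close> reaches \<epsilon>
  somewhere on the path has probability at most \<open>\<phi> m \<one> / \<epsilon>\<close> for each
  m, hence 0. The uniformity in n is what later permits exchanging the limits in m and n.\<close>

lemma AE_uniformly_small:
  assumes \<phi>: "\<And>m::nat. harmonic (\<phi> m)" and lim: "(\<lambda>m. \<phi> m \<one>) \<longlonglongrightarrow> 0"
  shows "AE w in \<Omega>. \<forall>\<epsilon>>0. \<exists>m. \<forall>n. \<phi> m (W w n) < \<epsilon>"
proof -
  have "AE w in \<Omega>. \<exists>m. \<forall>n. \<phi> m (W w n) < \<epsilon>" if "0 < \<epsilon>" for \<epsilon> :: real
  proof (rule AE_I)
    let ?E = "\<lambda>m. {w \<in> space \<Omega>. \<exists>n. \<epsilon> \<le> \<phi> m (W w n)}"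
    have "?E m = (\<Union>n. {w \<in> space \<Omega>. \<epsilon> \<le> \<phi> m (W w n)})" for m by auto
    then have meas: "?E m \<in> sets \<Omega>" for m
      by (auto intro!: sets.countable_UN W_pred_measurable[where P = "\<lambda>g. \<epsilon> \<le> \<phi> m g"])
    show "{w \<in> space \<Omega>. \<not> (\<exists>m. \<forall>n. \<phi> m (W w n) < \<epsilon>)} \<subseteq> (\<Inter>m. ?E m)"
      by (auto simp: not_less)
    show "(\<Inter>m. ?E m) \<in> sets \<Omega>" using meas by (intro sets.countable_INT) auto
    have "emeasure \<Omega> (\<Inter>m. ?E m) \<le> ennreal (\<phi> m \<one> / \<epsilon>)" for m
      using maximal_inequality[OF that \<phi>] emeasure_mono[OF INT_lower[of m UNIV ?E] meas]
      by (meson UNIV_I order_trans)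
    moreover have "(\<lambda>m. ennreal (\<phi> m \<one> / \<epsilon>)) \<longlonglongrightarrow> ennreal (0 / \<epsilon>)"
      using lim that by (intro tendsto_ennrealI tendsto_divide) auto
    ultimately show "emeasure \<Omega> (\<Inter>m. ?E m) = 0"
      by (metis (no_types, lifting) LIMSEQ_le_const div_0 ennreal_0 le_zero_eq)
  qed
  then have "AE w in \<Omega>. \<forall>k::nat. \<exists>m. \<forall>n. \<phi> m (W w n) < inverse (Suc k)"
    unfolding AE_all_countable by simp
  then show ?thesis
  proof eventually_elim
    case (elim w)
    show ?case
    proof (intro allI impI)
      fix \<epsilon> :: real assume "0 < \<epsilon>"
      then obtain k where "inverse (Suc k) < \<epsilon>" using reals_Archimedean by blast
      then show "\<exists>m. \<forall>n. \<phi> m (W w n) < \<epsilon>" using elim by (meson less_trans)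
    qed
  qed
qed

end

section \<open>Coding of Polish spaces\<close>

text \<open>The points of the boundaries in \<open>BL\<close> are reals, so the Cantor space of all
  subsets of the natural numbers is transported to this type by an arbitrary bijection.\<close>

definition bits :: "real \<Rightarrow> nat set" where
  "bits = (SOME b. bij b)"

lemma bij_bits: "bij bits"
proof -
  obtain b :: "real \<Rightarrow> nat set" where "bij b"
    using eqpoll_sym[OF nat_sets_eqpoll_reals] unfolding eqpoll_def by blast
  then show ?thesis unfolding bits_def by (rule someI[of bij b])
qed

definition code :: "(nat \<Rightarrow> 'x set) \<Rightarrow> 'x \<Rightarrow> real" where
  "code A x = inv_into UNIV bits {k. x \<in> A k}"

lemma bits_inv [simp]: "bits (inv_into UNIV bits S) = S"
  by (simp add: bij_bits bij_is_surj f_inv_into_f surj_f_inv_f)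

lemma bits_eq_iff: "bits r = bits s \<longleftrightarrow> r = s"
  using bij_bits by (auto simp: bij_def inj_def)

lemma bits_code [simp]: "bits (code A x) = {k. x \<in> A k}"
  by (simp add: code_def)

definition digit :: "nat \<Rightarrow> real set" where
  "digit k = {r. k \<in> bits r}"

text \<open>The Borel sigma-algebra of Cantor space carried over by \<open>bits\<close>; it is in
  general unrelated to the usual Borel sets of the reals.\<close>

definition cantor :: "real measure" where
  "cantor = sigma UNIV (range digit)"

lemma space_cantor [simp]: "space cantor = UNIV"
  by (simp add: cantor_def)

lemma sets_cantor: "sets cantor = sigma_sets UNIV (range digit)"
  by (simp add: cantor_def)

lemma digit_sets [measurable]: "digit k \<in> sets cantor"
  by (simp add: sets_cantor)

lemma pred_bits [measurable]: "Measurable.pred cantor (\<lambda>r. k \<in> bits r)"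
  using digit_sets[of k] by (simp add: pred_def digit_def)

lemma measurable_into_cantor:
  assumes "\<And>k. {x \<in> space M. k \<in> bits (f x)} \<in> sets M"
  shows "f \<in> measurable M cantor"
proof (rule measurable_sigma_sets[OF sets_cantor])
  fix D assume "D \<in> range digit"
  then obtain k where "D = digit k" by blast
  then have "f -` D \<inter> space M = {x \<in> space M. k \<in> bits (f x)}" by (auto simp: digit_def)
  then show "f -` D \<inter> space M \<in> sets M" using assms by simp
qed auto

lemma code_measurable:
  assumes "\<And>k. A k \<in> sets M"
  shows "code A \<in> measurable M cantor"
proof (rule measurable_into_cantor)
  fix k
  have "{x \<in> space M. k \<in> bits (code A x)} = A k"
    using sets.sets_into_space[OF assms[of k]] by auto
  then show "{x \<in> space M. k \<in> bits (code A x)} \<in> sets M" using assms by simp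
qed

text \<open>A point of a Polish space is determined by the set of basic open sets that contain it, and the
  sets of indices that arise in this way are cut out by countably many conditions: they are the
  filters all of whose members contain arbitrarily small members together with their closures.\<close>

lemma standard_borel_coding:
  fixes M :: "'x measure"
  assumes "standard_borel M" "space M \<noteq> {}"
  obtains A :: "nat \<Rightarrow> 'x set" and \<psi> :: "real \<Rightarrow> 'x"
  where "\<And>k. A k \<in> sets M" "\<psi> \<in> measurable cantor M" "\<And>x. x \<in> space M \<Longrightarrow> \<psi> (code A x) = x"
proof -
  obtain T where T: "completely_metrizable_space T" "second_countable T"
    and top: "topspace T = space M" and bor: "borel_sets T = sets M"
    using assms(1) by (auto simp: standard_borel_def)
  obtain S d where "Metric_space S d" and mc: "Metric_space.mcomplete S d"
    and TS: "T = Metric_space.mtopology S d"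
    using T(1) by (auto simp: completely_metrizable_space_def)
  interpret Metric_space S d by fact
  have S: "S = space M" using top TS by simp
  obtain \<B> where \<B>: "countable \<B>" "\<And>V. V \<in> \<B> \<Longrightarrow> openin T V"
    "\<And>U x. openin T U \<Longrightarrow> x \<in> U \<Longrightarrow> \<exists>V\<in>\<B>. x \<in> V \<and> V \<subseteq> U"
    using T(2) unfolding second_countable_def by metis
  obtain x0 where x0: "x0 \<in> space M" using assms(2) by blast
  have "\<B> \<noteq> {}" using \<B>(3)[of "topspace T" x0] openin_topspace[of T] x0 top by auto
  define A where "A = from_nat_into \<B>"
  have ran: "range A = \<B>" unfolding A_def by (rule range_from_nat_into) fact+
  have opA: "openin T (A k)" for k using \<B>(2) ran by blast
  have A_sub: "A k \<subseteq> S" for k using openin_subset[OF opA[of k]] top S by simp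
  have base: "\<exists>k. x \<in> A k \<and> A k \<subseteq> U" if "openin T U" "x \<in> U" for U x
    using \<B>(3)[OF that] ran by (metis rangeE)
  have opens: "U \<in> sigma_sets (space M) (range A)" if "openin T U" for U
  proof -
    have "U = (\<Union>k\<in>{k. A k \<subseteq> U}. A k)" using base[OF that] by blast
    also have "\<dots> \<in> sigma_sets (space M) (range A)"
      by (rule sigma_sets_UNION) (auto intro: sigma_sets.Basic)
    finally show ?thesis .
  qed
  have sets_M: "sets M = sigma_sets (space M) (range A)"
  proof
    show "sets M \<subseteq> sigma_sets (space M) (range A)"
      unfolding bor[symmetric] borel_sets_def top by (rule sigma_sets_mono) (use opens in auto)
    show "sigma_sets (space M) (range A) \<subseteq> sets M"
      unfolding bor[symmetric] borel_sets_def top by (rule sigma_sets_mono')  (use opA in auto)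
  qed
  have A_sets: "A k \<in> sets M" for k unfolding sets_M by (auto intro: sigma_sets.Basic)
  \<comment> \<open>The quantifiers over indices are countable, and the conditions on the sets
    \<open>A p\<close> do not involve r. So K is a measurable condition on the digits of r.\<close>
  define K where "K r \<longleftrightarrow> (\<exists>n. n \<in> bits r) \<and>
     (\<forall>n m j. n \<in> bits r \<longrightarrow> m \<in> bits r \<longrightarrow> (\<exists>p. p \<in> bits r \<and> (A p \<noteq> {} \<and> T closure_of A p \<subseteq> A n \<inter> A m \<and>
          (\<exists>a. A p \<subseteq> mcball a (inverse (Suc j)))))) \<and>
     (\<forall>m n. m \<in> bits r \<longrightarrow> A m \<subseteq> A n \<longrightarrow> n \<in> bits r)" for r
  have K_meas [measurable]: "Measurable.pred cantor K"
    unfolding K_def by measurable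
  have K_code: "K (code A x)" if x: "x \<in> space M" for x
  proof -
    have "\<exists>n. x \<in> A n" using base[of "topspace T" x] openin_topspace[of T] x top by auto
    moreover have "\<exists>p. x \<in> A p \<and> (A p \<noteq> {} \<and> T closure_of A p \<subseteq> A n \<inter> A m \<and>
          (\<exists>a. A p \<subseteq> mcball a (inverse (Suc j))))" if nm: "x \<in> A n" "x \<in> A m" for n m and j :: nat
    proof -
      have "openin mtopology (A n \<inter> A m)" using opA TS by blast
      then obtain r where r: "r > 0" "mball x r \<subseteq> A n \<inter> A m"
        using nm unfolding openin_mtopology by blast
      \<comment> \<open>Below r/2 the closed ball of radius e still lies in the open ball of radius
        r; the other bound makes the member as small as required.\<close>
      define e where "e = min (r/2) (inverse (Suc j))"
      have e: "e > 0" "e < r" "e \<le> inverse (Suc j)" using r by (auto simp: e_def)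
      obtain p where p: "x \<in> A p" "A p \<subseteq> mball x e"
        using base[of "mball x e" x] TS x[folded S] e(1) openin_mball centre_in_mball_iff by blast
      have pc: "A p \<subseteq> mcball x e" using p(2) mball_subset_mcball by blast
      then have "T closure_of A p \<subseteq> mcball x e" unfolding TS
        by (intro closure_of_minimal) auto
      also have "\<dots> \<subseteq> mball x r" using e(2) by (rule mcball_subset_mball_concentric)
      finally have "T closure_of A p \<subseteq> A n \<inter> A m" using r by blast
      moreover have "A p \<subseteq> mcball x (inverse (Suc j))"
        using pc mcball_subset_concentric[OF e(3)] by blast
      ultimately show ?thesis using p(1) by blast
    qed
    ultimately show ?thesis unfolding K_def by auto
  qed
  have ex: "\<exists>x\<in>space M. bits r = {n. x \<in> A n}" if "K r" for r
  proof -
    have fil: "\<exists>p. p \<in> bits r \<and> (A p \<noteq> {} \<and> T closure_of A p \<subseteq> A n \<inter> A m \<and>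
          (\<exists>a. A p \<subseteq> mcball a (inverse (Suc j))))" if "n \<in> bits r" "m \<in> bits r" for n m and j :: nat
      using \<open>K r\<close> that unfolding K_def by blast
    have up: "n \<in> bits r" if "m \<in> bits r" "A m \<subseteq> A n" for m n
      using \<open>K r\<close> that unfolding K_def by blast
    obtain n0 where n0: "n0 \<in> bits r" using \<open>K r\<close> unfolding K_def by blast
    \<comment> \<open>A sequence of members, each containing the closure of the next, with radii
      tending to 0. Completeness of the metric then gives a common point, the one that r
      codes.\<close>
    have "\<exists>p. \<forall>j::nat. (p j \<in> bits r \<and> A (p j) \<noteq> {}) \<and>
       (T closure_of A (p (Suc j)) \<subseteq> A (p j) \<and> (\<exists>a. A (p (Suc j)) \<subseteq> mcball a (inverse (Suc j))))"
    proof (rule dependent_nat_choice)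
      show "\<exists>p. p \<in> bits r \<and> A p \<noteq> {}" using fil[OF n0 n0, of 0] by blast
      show "\<exists>q. (q \<in> bits r \<and> A q \<noteq> {}) \<and> T closure_of A q \<subseteq> A p \<and>
           (\<exists>a. A q \<subseteq> mcball a (inverse (Suc j)))" if "p \<in> bits r \<and> A p \<noteq> {}" for p j
        using fil[of p p j] that by auto
    qed
    then obtain p where p: "\<And>j::nat. p j \<in> bits r" "\<And>j. A (p j) \<noteq> {}"
       "\<And>j. T closure_of A (p (Suc j)) \<subseteq> A (p j)"
       "\<And>j. \<exists>a. A (p (Suc j)) \<subseteq> mcball a (inverse (Suc j))" by blast
    have sub: "A q \<subseteq> T closure_of A q" for q
      using A_sub top S by (intro closure_of_subset) auto
    define C where "C j = T closure_of A (p j)" for j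
    have "(\<forall>n. closedin mtopology (C n)) \<and> (\<forall>n. C n \<noteq> {}) \<and> decseq C \<and>
       (\<forall>\<epsilon>>0. \<exists>n a. C n \<subseteq> mcball a \<epsilon>)"
    proof (intro conjI allI impI)
      show "closedin mtopology (C n)" for n by (simp add: C_def TS)
      show "C n \<noteq> {}" for n using p(2)[of n] sub[of "p n"] by (auto simp: C_def)
      show "decseq C" unfolding C_def using p(3) sub by (intro decseq_SucI) blast
      fix \<epsilon> :: real assume "\<epsilon> > 0"
      then obtain j where j: "inverse (Suc j) < \<epsilon>" using reals_Archimedean by blast
      obtain a where a: "A (p (Suc j)) \<subseteq> mcball a (inverse (Suc j))" using p(4) by blast
      then have "C (Suc j) \<subseteq> mcball a (inverse (Suc j))" unfolding C_def TS
        by (intro closure_of_minimal) auto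
      also have "\<dots> \<subseteq> mcball a \<epsilon>" using j by (intro mcball_subset_concentric) simp
      finally show "\<exists>n a. C n \<subseteq> mcball a \<epsilon>" by blast
    qed
    then have "\<Inter> (range C) \<noteq> {}" using mc[unfolded mcomplete_nest] by blast
    then obtain x where "\<And>j. x \<in> C j" by blast
    then have x: "x \<in> A (p j)" for j using p(3)[of j] by (auto simp: C_def)
    have xS: "x \<in> S" using x A_sub by blast
    have small: "\<exists>j. A (p j) \<subseteq> mball x e" if e: "e > 0" for e
    proof -
      obtain j where j: "inverse (Suc j) < e/2" using reals_Archimedean[of "e/2"] e by auto
      obtain a where a: "A (p (Suc j)) \<subseteq> mcball a (inverse (Suc j))" using p(4) by blast
      have "A (p (Suc j)) \<subseteq> mball x e"
      proof
        fix y assume "y \<in> A (p (Suc j))"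
        then have y: "y \<in> mcball a (inverse (Suc j))" and xa: "x \<in> mcball a (inverse (Suc j))"
          using a x by blast+
        then have "d x y \<le> d x a + d a y" by (intro triangle) auto
        also have "\<dots> < e" using y xa j commute[of x a] by auto
        finally show "y \<in> mball x e" using y xS by auto
      qed
      then show ?thesis by blast
    qed
    have "n \<in> bits r \<longleftrightarrow> x \<in> A n" for n
    proof
      assume n: "n \<in> bits r"
      obtain q where q: "q \<in> bits r" "T closure_of A q \<subseteq> A n" using fil[OF n n, of 0] by blast
      \<comment> \<open>Otherwise some small member \<open>A (p j)\<close> around x would miss the
        closure of \<open>A q\<close>, but two members of the filter always have a nonempty common
        part.\<close>
      have "x \<in> T closure_of A q"
      proof (rule ccontr)
        assume "x \<notin> T closure_of A q"
        moreover have "openin mtopology (topspace T - T closure_of A q)"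
          unfolding TS[symmetric] by (intro openin_diff openin_topspace closedin_closure_of)
        ultimately obtain e where e: "e > 0" "mball x e \<subseteq> topspace T - T closure_of A q"
          using xS S top unfolding openin_mtopology by blast
        obtain j where j: "A (p j) \<subseteq> mball x e" using small[OF e(1)] by blast
        obtain q' where "A q' \<noteq> {}" "T closure_of A q' \<subseteq> A q \<inter> A (p j)"
          using fil[OF q(1) p(1)[of j], of 0] by (elim exE conjE)
        then obtain z where z: "z \<in> A q" "z \<in> A (p j)" using sub[of q'] by blast
        have "z \<in> T closure_of A q" using sub z(1) by (rule subsetD)
        moreover have "z \<in> topspace T - T closure_of A q" using j e(2) z(2) by (meson subsetD)
        ultimately show False by simp
      qed
      then show "x \<in> A n" using q(2) by blast
    next
      assume "x \<in> A n"
      then obtain e where e: "e > 0" "mball x e \<subseteq> A n"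
        using opA[of n] unfolding TS openin_mtopology by blast
      then show "n \<in> bits r" using small[OF e(1)] up p(1) by (meson subset_trans)
    qed
    then show ?thesis using xS S by auto
  qed
  have uniq: "x = y" if "x \<in> space M" "y \<in> space M" "{n. x \<in> A n} = {n. y \<in> A n}" for x y
  proof (rule ccontr)
    assume "x \<noteq> y"
    then have "d x y > 0" using that S by simp
    then have "x \<in> mball x (d x y)" using that(1)[folded S] by simp
    then obtain k where "x \<in> A k" "A k \<subseteq> mball x (d x y)"
      using base[OF openin_mball[of x "d x y", folded TS]] by blast
    then show False using that by auto
  qed
  \<comment> \<open>Reals that code no point are sent to x0, which keeps \<psi> total and
    measurable.\<close>
  define \<psi> where "\<psi> r = (if K r then SOME x. x \<in> space M \<and> bits r = {n. x \<in> A n} else x0)" for r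
  have \<psi>: "\<psi> r \<in> space M" "bits r = {n. \<psi> r \<in> A n}" if "K r" for r
    using someI_ex[of "\<lambda>x. x \<in> space M \<and> bits r = {n. x \<in> A n}"] ex[OF that] that
    by (auto simp: \<psi>_def)
  have "\<psi> \<in> measurable cantor M"
  proof (rule measurable_sigma_sets[OF sets_M])
    show "range A \<subseteq> Pow (space M)" using A_sub S by blast
    show "\<psi> \<in> space cantor \<rightarrow> space M" 
    proof
      fix r show "\<psi> r \<in> space M"
        using \<psi>(1)[of r] x0 by (cases "K r") (simp_all, simp add: \<psi>_def)
    qed
    fix y assume "y \<in> range A"
    then obtain k where y: "y = A k" by blast
    have "\<psi> -` y \<inter> space cantor = {r \<in> space cantor. if K r then k \<in> bits r else x0 \<in> A k}"
    proof -
      have "\<psi> r \<in> A k \<longleftrightarrow> (if K r then k \<in> bits r else x0 \<in> A k)" for r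
        using \<psi>(2)[of r] by (cases "K r") (simp_all, simp add: \<psi>_def)
      then show ?thesis by (auto simp: y)
    qed
    also have "\<dots> \<in> sets cantor" by measurable
    finally show "\<psi> -` y \<inter> space cantor \<in> sets cantor" .
  qed
  moreover have "\<psi> (code A x) = x" if "x \<in> space M" for x
    using \<psi>[OF K_code[OF that]] uniq that by auto
  ultimately show ?thesis using that A_sets by blast
qed

section \<open>Poisson transforms and factor maps\<close>

definition poisson :: "('g, 'x) gspace \<Rightarrow> 'x set \<Rightarrow> 'g \<Rightarrow> real" where
  "poisson X A g = measure (msr X) (act X g -` A \<inter> space (msr X))"

context random_walk
begin

definition zero_one :: "('g \<Rightarrow> real) \<Rightarrow> bool" where
  "zero_one \<phi> \<longleftrightarrow> (AE w in \<Omega>. (\<lambda>n. \<phi> (W w n)) \<longlonglongrightarrow> 0 \<or> (\<lambda>n. \<phi> (W w n)) \<longlonglongrightarrow> 1)"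

definition zero_one_space :: "('g, 'x) gspace \<Rightarrow> bool" where
  "zero_one_space X \<longleftrightarrow> stationary G \<mu> X \<and> (\<forall>A\<in>sets (msr X). zero_one (poisson X A))"

text \<open>Sets of two spaces without a map between them are matched through functions on the
  group. In a space with the 0-1 property the partner is unique up to null sets, by
  \<open>corr_AE_eq\<close>.\<close>

definition corr :: "('g, 'x) gspace \<Rightarrow> 'x set \<Rightarrow> ('g, 'y) gspace \<Rightarrow> 'y set \<Rightarrow> bool" where
  "corr X A Y B \<longleftrightarrow> A \<in> sets (msr X) \<and> B \<in> sets (msr Y) \<and> (\<forall>g\<in>carrier G. poisson X A g = poisson Y B g)"

abbreviation pull :: "('g, 'x) gspace \<Rightarrow> 'g \<Rightarrow> 'x set \<Rightarrow> 'x set" where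
  "pull X g A \<equiv> act X g -` A \<inter> space (msr X)"

lemma stationary_measured: "stationary G \<mu> X \<Longrightarrow> measured_gspace G X"
  by (simp add: stationary_def)

lemma zero_one_stationary: "zero_one_space X \<Longrightarrow> stationary G \<mu> X"
  by (simp add: zero_one_space_def)

context
  fixes X :: "('g, 'x) gspace"
  assumes X: "measured_gspace G X"
begin

lemma prob_space_msr: "prob_space (msr X)"
  using X by (simp add: measured_gspace_def)

lemma standard_borel_msr: "standard_borel (msr X)"
  using X by (simp add: measured_gspace_def)

lemma act_measurable: "g \<in> carrier G \<Longrightarrow> act X g \<in> measurable (msr X) (msr X)"
  using X by (simp add: measured_gspace_def)

lemma act_closed: "g \<in> carrier G \<Longrightarrow> x \<in> space (msr X) \<Longrightarrow> act X g x \<in> space (msr X)"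
  using act_measurable measurable_space by metis

lemma act_one: "x \<in> space (msr X) \<Longrightarrow> act X \<one> x = x"
  using X group_action.id_eq_one[of G "space (msr X)" "act X"]
  by (metis measured_gspace_def restrict_apply')

lemma act_mult:
  "x \<in> space (msr X) \<Longrightarrow> g \<in> carrier G \<Longrightarrow> h \<in> carrier G \<Longrightarrow> act X (g \<otimes> h) x = act X g (act X h x)"
  using X group_action.composition_rule[of G "space (msr X)" "act X" x g h]
  by (simp add: measured_gspace_def)

lemma pull_sets: "g \<in> carrier G \<Longrightarrow> A \<in> sets (msr X) \<Longrightarrow> pull X g A \<in> sets (msr X)"
  using measurable_sets[OF act_measurable] .

lemma pull_one: "A \<in> sets (msr X) \<Longrightarrow> pull X \<one> A = A"
  using sets.sets_into_space[of A "msr X"] by (auto simp: act_one subset_iff)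

lemma pull_mult:
  "g \<in> carrier G \<Longrightarrow> h \<in> carrier G \<Longrightarrow> pull X (g \<otimes> h) A = pull X h (pull X g A)"
  by (auto simp: act_mult act_closed)

lemma pull_inv:
  "g \<in> carrier G \<Longrightarrow> A \<in> sets (msr X) \<Longrightarrow> pull X g (pull X (inv g) A) = A"
  "g \<in> carrier G \<Longrightarrow> A \<in> sets (msr X) \<Longrightarrow> pull X (inv g) (pull X g A) = A"
  using pull_mult[of "inv g" g A] pull_mult[of g "inv g" A] by (simp_all add: pull_one del: vimage_Int)

lemma translate_emeasure:
  "g \<in> carrier G \<Longrightarrow> A \<in> sets (msr X) \<Longrightarrow> emeasure (translate X g) A = ennreal (poisson X A g)"
  unfolding translate_def poisson_def
  using prob_space.finite_measure[OF prob_space_msr]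
  by (simp add: emeasure_distr act_measurable finite_measure.emeasure_eq_measure)

lemma sets_translate [simp]: "sets (translate X g) = sets (msr X)"
  and space_translate [simp]: "space (translate X g) = space (msr X)"
  by (simp_all add: translate_def)

lemma prob_space_translate: "g \<in> carrier G \<Longrightarrow> prob_space (translate X g)"
  unfolding translate_def by (rule prob_space.prob_space_distr[OF prob_space_msr act_measurable])

lemma poisson_eq: "g \<in> carrier G \<Longrightarrow> A \<in> sets (msr X) \<Longrightarrow> poisson X A g = measure (translate X g) A"
  unfolding measure_def by (simp add: translate_emeasure poisson_def)

lemma poisson_mult:
  "g \<in> carrier G \<Longrightarrow> h \<in> carrier G \<Longrightarrow> poisson X A (g \<otimes> h) = poisson X (pull X g A) h"
  by (simp add: poisson_def pull_mult)

lemma poisson_one: "A \<in> sets (msr X) \<Longrightarrow> poisson X A \<one> = measure (msr X) A"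
  by (simp add: poisson_def pull_one)

lemma poisson_bounds: "0 \<le> poisson X A g" "poisson X A g \<le> 1"
  by (simp_all add: poisson_def prob_space.prob_le_1[OF prob_space_msr])

lemma poisson_null:
  assumes "A \<in> null_sets (msr X)" "g \<in> carrier G"
  shows "poisson X A g = 0"
proof -
  have "A \<in> null_sets (translate X g)"
    using X assms unfolding measured_gspace_def absolutely_continuous_def by blast
  then show ?thesis
    using poisson_eq[OF assms(2), of A] assms(1) by (simp add: measure_def null_sets_def)
qed

lemma poisson_Compl:
  assumes "A \<in> sets (msr X)" "g \<in> carrier G"
  shows "poisson X (space (msr X) - A) g = 1 - poisson X A g"
proof -
  interpret prob_space "translate X g" using prob_space_translate[OF assms(2)] .
  show ?thesis using assms prob_compl[of A] poisson_eq[of g] by simp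
qed

lemma poisson_mono:
  assumes "A \<subseteq> B" "B \<in> sets (msr X)" "g \<in> carrier G"
  shows "poisson X A g \<le> poisson X B g"
  unfolding poisson_def
  using assms pull_sets prob_space.finite_measure[OF prob_space_msr]
  by (intro finite_measure.finite_measure_mono) auto

lemma poisson_Un_le:
  assumes "A \<in> sets (msr X)" "B \<in> sets (msr X)" "g \<in> carrier G"
  shows "poisson X (A \<union> B) g \<le> poisson X A g + poisson X B g"
proof -
  interpret prob_space "translate X g" using prob_space_translate[OF assms(3)] .
  show ?thesis using assms measure_subadditive[of A "translate X g" B] poisson_eq[of g]
    by (simp add: emeasure_eq_measure)
qed

lemma poisson_UN_tendsto:
  fixes A :: "nat \<Rightarrow> 'x set"
  assumes "\<And>n. A n \<in> sets (msr X)" "incseq A" "g \<in> carrier G"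
  shows "(\<lambda>n. poisson X (A n) g) \<longlonglongrightarrow> poisson X (\<Union>n. A n) g"
proof -
  interpret prob_space "translate X g" using prob_space_translate[OF assms(3)] .
  have "range A \<subseteq> sets (translate X g)" using assms(1) by auto
  from finite_Lim_measure_incseq[OF this assms(2)] show ?thesis
    using assms poisson_eq[of g] by (simp add: sets.countable_UN)
qed

text \<open>A limit 0 passes down to subsets, and two limits 1 pass to the intersection by the bound
  P(A) + P(B) - 1. For limits strictly between 0 and 1 the limit of the intersection would not be
  determined.\<close>

lemma poisson_Int_tendsto:
  assumes AB: "A \<in> sets (msr X)" "B \<in> sets (msr X)" and s: "\<And>n. s n \<in> carrier G"
    and lim: "(\<lambda>n. poisson X A (s n)) \<longlonglongrightarrow> a" "(\<lambda>n. poisson X B (s n)) \<longlonglongrightarrow> b"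
    and ab: "a = 0 \<or> a = 1" "b = 0 \<or> b = 1"
  shows "(\<lambda>n. poisson X (A \<inter> B) (s n)) \<longlonglongrightarrow> a * b"
proof -
  have le: "poisson X (A \<inter> B) (s n) \<le> poisson X A (s n)" "poisson X (A \<inter> B) (s n) \<le> poisson X B (s n)" for n
    using AB s by (auto intro: poisson_mono)
  have ge: "poisson X A (s n) + poisson X B (s n) - 1 \<le> poisson X (A \<inter> B) (s n)" for n
  proof -
    have "space (msr X) - (A \<inter> B) = (space (msr X) - A) \<union> (space (msr X) - B)" by auto
    then have "1 - poisson X (A \<inter> B) (s n) \<le> (1 - poisson X A (s n)) + (1 - poisson X B (s n))"
      using poisson_Un_le[of "space (msr X) - A" "space (msr X) - B" "s n"] AB s
      by (simp add: poisson_Compl[symmetric] sets.Int)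
    then show ?thesis by linarith
  qed
  have squeeze: "g \<longlonglongrightarrow> c"
    if "\<And>n. f n \<le> g n" "\<And>n. g n \<le> h n" "f \<longlonglongrightarrow> c" "h \<longlonglongrightarrow> c" for f g h :: "nat \<Rightarrow> real" and c
    by (rule tendsto_sandwich[OF _ _ that(3,4)]) (simp_all add: that(1,2))
  consider "a = 0" | "b = 0" | "a = 1" "b = 1" using ab by blast
  then show ?thesis
  proof cases
    case 1
    then show ?thesis using squeeze[of "\<lambda>_. 0", OF poisson_bounds(1) le(1) tendsto_const] lim(1) by simp
  next
    case 2
    then show ?thesis using squeeze[of "\<lambda>_. 0", OF poisson_bounds(1) le(2) tendsto_const] lim(2) by simp
  next
    case 3
    have "(\<lambda>n. poisson X A (s n) + poisson X B (s n) - 1) \<longlonglongrightarrow> 1 + 1 - 1"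
      using lim 3 by (intro tendsto_intros) auto
    then show ?thesis using squeeze[OF ge poisson_bounds(2) _ tendsto_const] 3 by simp
  qed
qed

end

text \<open>Stationarity, tested on the pulled back set \<open>pull X g A\<close>, is the mean value
  property at g.\<close>

lemma harmonic_poisson:
  assumes X: "stationary G \<mu> X" and A: "A \<in> sets (msr X)"
  shows "harmonic (poisson X A)"
  unfolding harmonic_def
proof (intro ballI conjI)
  note mX = stationary_measured[OF X]
  fix g assume g: "g \<in> carrier G"
  show "0 \<le> poisson X A g" "poisson X A g \<le> 1" using poisson_bounds[OF mX] by auto
  have "(\<integral>\<^sup>+ s. ennreal (poisson X A (g \<otimes> s)) \<partial>measure_pmf \<mu>)
      = (\<integral>\<^sup>+ s. emeasure (translate X s) (pull X g A) \<partial>measure_pmf \<mu>)"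
    using set_pmf_subset g A
    by (intro nn_integral_cong_AE AE_pmfI)
      (auto simp: poisson_mult[OF mX] translate_emeasure[OF mX] pull_sets[OF mX])
  also have "\<dots> = emeasure (msr X) (pull X g A)"
    using X pull_sets[OF mX g A] by (simp add: stationary_def)
  also have "\<dots> = ennreal (poisson X A g)"
    using prob_space.finite_measure[OF prob_space_msr[OF mX]]
    by (simp add: poisson_def finite_measure.emeasure_eq_measure)
  finally show "(\<integral>\<^sup>+ s. ennreal (poisson X A (g \<otimes> s)) \<partial>measure_pmf \<mu>) = ennreal (poisson X A g)" .
qed

lemma zero_one_spaceD:
  "zero_one_space X \<Longrightarrow> A \<in> sets (msr X) \<Longrightarrow>
   AE w in \<Omega>. \<exists>a. (a = 0 \<or> a = 1) \<and> (\<lambda>n. poisson X A (W w n)) \<longlonglongrightarrow> a"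
  by (auto simp: zero_one_space_def zero_one_def elim!: eventually_mono)

lemma corr_sym: "corr X A Y B \<Longrightarrow> corr Y B X A"
  by (simp add: corr_def)

lemma corr_trans: "corr X A Y B \<Longrightarrow> corr Y B Z C \<Longrightarrow> corr X A Z C"
  by (simp add: corr_def)

lemma corr_refl: "A \<in> sets (msr X) \<Longrightarrow> corr X A X A"
  by (simp add: corr_def)

lemma corr_pull:
  assumes "measured_gspace G X" "measured_gspace G Y" "corr X A Y B" "g \<in> carrier G"
  shows "corr X (pull X g A) Y (pull Y g B)"
  using assms by (auto simp: corr_def pull_sets poisson_mult[symmetric])

lemma corr_Compl:
  assumes "measured_gspace G X" "measured_gspace G Y" "corr X A Y B"
  shows "corr X (space (msr X) - A) Y (space (msr Y) - B)"
  using assms by (auto simp: corr_def poisson_Compl)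

lemma corr_empty: "corr X {} Y {}"
  by (simp add: corr_def poisson_def)

text \<open>The measures of corresponding sets are the expectations of their limits along the walk. These
  limits are 0 or 1, so the limit for an intersection is the product of the limits.\<close>

lemma corr_Int:
  assumes X: "zero_one_space X" and Y: "zero_one_space Y"
    and c: "corr X A Y B" "corr X A' Y B'"
  shows "corr X (A \<inter> A') Y (B \<inter> B')"
proof -
  note mX = stationary_measured[OF zero_one_stationary[OF X]]
  note mY = stationary_measured[OF zero_one_stationary[OF Y]]
  have "measure (msr X) (A \<inter> A') = measure (msr Y) (B \<inter> B')"
    if c: "corr X A Y B" "corr X A' Y B'" for A A' B B'
  proof -
    have S: "A \<in> sets (msr X)" "A' \<in> sets (msr X)" "B \<in> sets (msr Y)" "B' \<in> sets (msr Y)"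
      using c by (auto simp: corr_def)
    have "AE w in \<Omega>. (\<lambda>n. poisson X (A \<inter> A') (W w n) - poisson Y (B \<inter> B') (W w n)) \<longlonglongrightarrow> 0"
      using zero_one_spaceD[OF X S(1)] zero_one_spaceD[OF X S(2)]
    proof eventually_elim
      case (elim w)
      then obtain a a' where a: "a = 0 \<or> a = 1" "a' = 0 \<or> a' = 1"
        and lim: "(\<lambda>n. poisson X A (W w n)) \<longlonglongrightarrow> a" "(\<lambda>n. poisson X A' (W w n)) \<longlonglongrightarrow> a'"
        by blast
      moreover have "(\<lambda>n. poisson Y B (W w n)) \<longlonglongrightarrow> a" "(\<lambda>n. poisson Y B' (W w n)) \<longlonglongrightarrow> a'"
        using lim c by (simp_all add: corr_def)
      ultimately have "(\<lambda>n. poisson X (A \<inter> A') (W w n) - poisson Y (B \<inter> B') (W w n)) \<longlonglongrightarrow> a * a' - a * a'"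
        using S by (intro tendsto_diff poisson_Int_tendsto[OF mX] poisson_Int_tendsto[OF mY]) auto
      then show ?case by simp
    qed
    then have "poisson X (A \<inter> A') \<one> = poisson Y (B \<inter> B') \<one>"
      using S by (intro harmonic_eqI harmonic_poisson zero_one_stationary X Y) auto
    then show ?thesis using S by (simp add: poisson_one mX mY sets.Int)
  qed
  \<comment> \<open>So far the transforms of the intersections agree at the identity. Applied to the
    pulled back sets, this extends to every group element.\<close>
  from this[OF corr_pull[OF mX mY c(1)] corr_pull[OF mX mY c(2)]]
  have "poisson X (A \<inter> A') g = poisson Y (B \<inter> B') g" if "g \<in> carrier G" for g
    using that unfolding poisson_def by (simp add: Int_ac vimage_Int Int_assoc Int_left_commute)
  then show ?thesis using c by (simp add: corr_def sets.Int)
qed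

lemma corr_finite_UN:
  fixes A :: "nat \<Rightarrow> 'x set"
  assumes X: "zero_one_space X" and Y: "zero_one_space Y"
    and c: "\<And>n. corr X (A n) Y (B n)"
  shows "corr X (\<Union>i<n. A i) Y (\<Union>i<n. B i)"
proof (induction n)
  case 0
  then show ?case by (simp add: corr_empty)
next
  case (Suc n)
  note mX = stationary_measured[OF zero_one_stationary[OF X]]
  note mY = stationary_measured[OF zero_one_stationary[OF Y]]
  have "corr X (space (msr X) - (space (msr X) - (\<Union>i<n. A i)) \<inter> (space (msr X) - A n))
     Y (space (msr Y) - (space (msr Y) - (\<Union>i<n. B i)) \<inter> (space (msr Y) - B n))"
    by (intro corr_Compl[OF mX mY] corr_Int[OF X Y] Suc c)
  moreover have "space (msr X) - (space (msr X) - (\<Union>i<n. A i)) \<inter> (space (msr X) - A n) = (\<Union>i<Suc n. A i)"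
    using Suc c[of n] sets.sets_into_space[of "A n" "msr X"] sets.sets_into_space[of "\<Union>i<n. A i" "msr X"]
    unfolding corr_def lessThan_Suc by blast
  moreover have "space (msr Y) - (space (msr Y) - (\<Union>i<n. B i)) \<inter> (space (msr Y) - B n) = (\<Union>i<Suc n. B i)"
    using Suc c[of n] sets.sets_into_space[of "B n" "msr Y"] sets.sets_into_space[of "\<Union>i<n. B i" "msr Y"]
    unfolding corr_def lessThan_Suc by blast
  ultimately show ?case by simp
qed

text \<open>Continuity of the translated measures at each fixed g; the walk enters only through the
  finite unions.\<close>

lemma corr_UN:
  fixes A :: "nat \<Rightarrow> 'x set"
  assumes X: "zero_one_space X" and Y: "zero_one_space Y"
    and c: "\<And>n. corr X (A n) Y (B n)"
  shows "corr X (\<Union>n. A n) Y (\<Union>n. B n)"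
proof -
  note mX = stationary_measured[OF zero_one_stationary[OF X]]
  note mY = stationary_measured[OF zero_one_stationary[OF Y]]
  note fin = corr_finite_UN[of X Y A B, OF X Y c]
  have incA: "incseq (\<lambda>n. \<Union>i<n. A i)" and incB: "incseq (\<lambda>n. \<Union>i<n. B i)" by (fastforce simp: incseq_def)+
  have UA: "(\<Union>n. A n) = (\<Union>n. \<Union>i<n. A i)" and UB: "(\<Union>n. B n) = (\<Union>n. \<Union>i<n. B i)" by blast+
  have "poisson X (\<Union>n. A n) g = poisson Y (\<Union>n. B n) g" if g: "g \<in> carrier G" for g
  proof -
    have "(\<lambda>n. poisson X (\<Union>i<n. A i) g) \<longlonglongrightarrow> poisson X (\<Union>n. A n) g"
      unfolding UA using fin by (intro poisson_UN_tendsto[OF mX] incA g) (simp add: corr_def)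
    moreover have "(\<lambda>n. poisson Y (\<Union>i<n. B i) g) \<longlonglongrightarrow> poisson Y (\<Union>n. B n) g"
      unfolding UB using fin by (intro poisson_UN_tendsto[OF mY] incB g) (simp add: corr_def)
    moreover have "poisson X (\<Union>i<n. A i) g = poisson Y (\<Union>i<n. B i) g" for n
      using fin[of n] g by (simp add: corr_def)
    ultimately show ?thesis by (simp add: LIMSEQ_unique)
  qed
  then show ?thesis using c by (auto simp: corr_def)
qed

text \<open>The sets with corresponding preimages form a sigma-algebra on S, so the matching is
  checked on a generator.\<close>

lemma corr_vimage:
  assumes X: "zero_one_space X" and Y: "zero_one_space Y"
    and f: "f \<in> space (msr X) \<rightarrow> S" and h: "h \<in> space (msr Y) \<rightarrow> S"
    and gen: "\<And>E. E \<in> \<E> \<Longrightarrow> corr X (f -` E \<inter> space (msr X)) Y (h -` E \<inter> space (msr Y))"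
    and E: "E \<in> sigma_sets S \<E>"
  shows "corr X (f -` E \<inter> space (msr X)) Y (h -` E \<inter> space (msr Y))"
  using E
proof induction
  case (Basic E)
  then show ?case by (rule gen)
next
  case Empty
  then show ?case by (simp add: corr_empty)
next
  case (Compl E)
  note mX = stationary_measured[OF zero_one_stationary[OF X]]
  note mY = stationary_measured[OF zero_one_stationary[OF Y]]
  have "f -` (S - E) \<inter> space (msr X) = space (msr X) - (f -` E \<inter> space (msr X))"
    "h -` (S - E) \<inter> space (msr Y) = space (msr Y) - (h -` E \<inter> space (msr Y))"
    using f h by auto
  then show ?case using corr_Compl[OF mX mY Compl.IH] by simp
next
  case (Union E)
  have "f -` (\<Union>i. E i) \<inter> space (msr X) = (\<Union>i. f -` E i \<inter> space (msr X))"
    "h -` (\<Union>i. E i) \<inter> space (msr Y) = (\<Union>i. h -` E i \<inter> space (msr Y))"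
    by auto
  then show ?case using corr_UN[OF X Y Union.IH] by (simp only:)
qed

text \<open>Intersecting the correspondence with A and with B shows that A and B each have the
  measure of A \<inter> B, so both differences are null.\<close>

lemma corr_AE_eq:
  assumes X: "zero_one_space X" and c: "corr X A X B"
  shows "AE x in msr X. x \<in> A \<longleftrightarrow> x \<in> B"
proof -
  note mX = stationary_measured[OF zero_one_stationary[OF X]]
  interpret prob_space "msr X" using prob_space_msr[OF mX] .
  have S: "A \<in> events" "B \<in> events" using c by (auto simp: corr_def)
  have m: "prob C = prob D" if "corr X C X D" for C D
    using that poisson_one[OF mX] one_closed unfolding corr_def by metis
  have "corr X (A \<inter> A) X (B \<inter> A)" "corr X (A \<inter> B) X (B \<inter> B)"
    by (intro corr_Int[OF X X] c corr_refl S)+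
  then have "prob A = prob (A \<inter> B)" "prob B = prob (A \<inter> B)"
    using m by (simp_all add: Int_commute)
  then have "prob (A - B) = 0" "prob (B - A) = 0"
    using finite_measure_Diff'[of A B] finite_measure_Diff'[of B A] S by (simp_all add: Int_commute)
  then have "A - B \<in> null_sets (msr X)" "B - A \<in> null_sets (msr X)"
    using S by (auto simp: null_sets_def emeasure_eq_measure)
  from AE_not_in[OF this(1)] AE_not_in[OF this(2)]
  show ?thesis by eventually_elim blast
qed


section \<open>Factor maps and the order they define\<close>

abbreviation factors :: "('g, 'x) gspace \<Rightarrow> ('g, 'y) gspace \<Rightarrow> bool" where
  "factors X Y \<equiv> \<exists>f. factor_map G X Y f"

text \<open>Almost everywhere equivariance lets the preimage under f and the pullback by g be
  interchanged up to null sets.\<close>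

lemma factor_map_corr:
  assumes mX: "measured_gspace G X" and mY: "measured_gspace G Y"
    and f: "factor_map G X Y f" and B: "B \<in> sets (msr Y)"
  shows "corr X (f -` B \<inter> space (msr X)) Y B"
proof -
  have fm: "f \<in> measurable (msr X) (msr Y)" and d: "distr (msr X) (msr Y) f = msr Y"
    using f by (auto simp: factor_map_def)
  have S: "f -` B \<inter> space (msr X) \<in> sets (msr X)" using fm B by (rule measurable_sets)
  interpret prob_space "msr X" using prob_space_msr[OF mX] .
  have "poisson X (f -` B \<inter> space (msr X)) g = poisson Y B g" if g: "g \<in> carrier G" for g
  proof -
    have fy: "f x \<in> space (msr Y)" if "x \<in> space (msr X)" for x using fm that by (rule measurable_space)
    have "poisson Y B g = measure (distr (msr X) (msr Y) f) (pull Y g B)"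
      by (simp add: poisson_def d)
    also have "\<dots> = prob (f -` pull Y g B \<inter> space (msr X))"
      using pull_sets[OF mY g B] by (simp add: measure_distr[OF fm])
    also have "\<dots> = prob (pull X g (f -` B \<inter> space (msr X)))"
    proof (rule finite_measure_eq_AE)
      have "AE x in msr X. f (act X g x) = act Y g (f x)"
        using f g by (simp add: factor_map_def)
      then show "AE x in msr X. x \<in> f -` pull Y g B \<inter> space (msr X)
         \<longleftrightarrow> x \<in> pull X g (f -` B \<inter> space (msr X))"
        using AE_space
      proof eventually_elim
        case (elim x)
        then show ?case using act_closed[OF mX g] fy by auto
      qed
      show "f -` pull Y g B \<inter> space (msr X) \<in> events"
        using fm pull_sets[OF mY g B] by (rule measurable_sets)
      show "pull X g (f -` B \<inter> space (msr X)) \<in> events"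
        using g S by (rule pull_sets[OF mX])
    qed
    finally show ?thesis by (simp add: poisson_def)
  qed
  then show ?thesis using S B by (simp add: corr_def)
qed

lemma separating_coding:
  assumes mY: "measured_gspace G Y"
  obtains B and \<psi> :: "real \<Rightarrow> 'y" where "\<And>k::nat. B k \<in> sets (msr Y)" "\<psi> \<in> measurable cantor (msr Y)"
    "\<And>x. x \<in> space (msr Y) \<Longrightarrow> \<psi> (code B x) = x"
    "\<And>x y. x \<in> space (msr Y) \<Longrightarrow> y \<in> space (msr Y) \<Longrightarrow> (\<And>k. x \<in> B k \<longleftrightarrow> y \<in> B k) \<Longrightarrow> x = y"
proof -
  have ne: "space (msr Y) \<noteq> {}" using prob_space.not_empty[OF prob_space_msr[OF mY]] .
  obtain B and \<psi> :: "real \<Rightarrow> 'y" where 1: "\<And>k. B k \<in> sets (msr Y)" "\<psi> \<in> measurable cantor (msr Y)"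
    "\<And>x. x \<in> space (msr Y) \<Longrightarrow> \<psi> (code B x) = x"
    using standard_borel_coding[OF standard_borel_msr[OF mY] ne] by metis
  have "x = y" if "x \<in> space (msr Y)" "y \<in> space (msr Y)" "\<And>k. x \<in> B k \<longleftrightarrow> y \<in> B k" for x y
  proof -
    have "code B x = code B y" using that(3) by (simp add: code_def)
    then show ?thesis using 1(3) that(1,2) by metis
  qed
  then show ?thesis using that 1 by metis
qed

text \<open>A correspondence of sets is turned into a point map by sending \<open>x\<close> to the point whose basic
  neighbourhoods are the ones that correspond to the sets containing \<open>x\<close>.\<close>

lemma factors_if_corr:
  assumes X: "zero_one_space X" and Y: "zero_one_space Y"
    and c: "\<And>B. B \<in> sets (msr Y) \<Longrightarrow> \<exists>A. corr X A Y B"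
  shows "factors X Y"
proof -
  note mX = stationary_measured[OF zero_one_stationary[OF X]]
  note mY = stationary_measured[OF zero_one_stationary[OF Y]]
  obtain B \<psi> where B: "\<And>k::nat. B k \<in> sets (msr Y)" and \<psi>: "\<psi> \<in> measurable cantor (msr Y)"
    and \<psi>_code: "\<And>x. x \<in> space (msr Y) \<Longrightarrow> \<psi> (code B x) = x"
    and sep: "\<And>x y. x \<in> space (msr Y) \<Longrightarrow> y \<in> space (msr Y) \<Longrightarrow> (\<And>k. x \<in> B k \<longleftrightarrow> y \<in> B k) \<Longrightarrow> x = y"
    using separating_coding[OF mY] by metis
  obtain A where A: "\<And>k. corr X (A k) Y (B k)" using c[OF B] by metis
  have A_sets: "A k \<in> sets (msr X)" for k using A by (simp add: corr_def)
  define f where "f x = \<psi> (code A x)" for x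
  have fm: "f \<in> measurable (msr X) (msr Y)"
    unfolding f_def using code_measurable[OF A_sets] \<psi> by (rule measurable_compose)
  have key: "corr X (f -` C \<inter> space (msr X)) Y C" if C: "C \<in> sets (msr Y)" for C
  proof -
    have "corr X (code A -` (\<psi> -` C) \<inter> space (msr X)) Y (code B -` (\<psi> -` C) \<inter> space (msr Y))"
    proof (rule corr_vimage[OF X Y])
      have "\<psi> -` C \<in> sets cantor" using measurable_sets[OF \<psi> C] by simp
      then show "\<psi> -` C \<in> sigma_sets UNIV (range digit)" by (simp add: sets_cantor)
      fix E assume "E \<in> range digit"
      then obtain k where E: "E = digit k" by blast
      have "code A -` E \<inter> space (msr X) = A k"
        using sets.sets_into_space[OF A_sets] by (auto simp: E digit_def)
      moreover have "code B -` E \<inter> space (msr Y) = B k"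
        using sets.sets_into_space[OF B] by (auto simp: E digit_def)
      ultimately show "corr X (code A -` E \<inter> space (msr X)) Y (code B -` E \<inter> space (msr Y))"
        using A by simp
    qed auto
    moreover have "code A -` (\<psi> -` C) \<inter> space (msr X) = f -` C \<inter> space (msr X)"
      by (auto simp: f_def)
    moreover have "code B -` (\<psi> -` C) \<inter> space (msr Y) = C"
      using sets.sets_into_space[OF C] by (auto simp: \<psi>_code)
    ultimately show ?thesis by simp
  qed
  have "factor_map G X Y f"
    unfolding factor_map_def
  proof (intro conjI ballI fm)
    show "distr (msr X) (msr Y) f = msr Y"
    proof (rule measure_eqI)
      fix C assume "C \<in> sets (distr (msr X) (msr Y) f)"
      then have C: "C \<in> sets (msr Y)" by simp
      have "poisson X (f -` C \<inter> space (msr X)) \<one> = poisson Y C \<one>"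
        using key[OF C] by (simp add: corr_def)
      then have "measure (msr X) (f -` C \<inter> space (msr X)) = measure (msr Y) C"
        using C measurable_sets[OF fm C] by (simp add: poisson_one mX mY)
      then show "emeasure (distr (msr X) (msr Y) f) C = emeasure (msr Y) C"
        using C prob_space.finite_measure[OF prob_space_msr[OF mX]]
          prob_space.finite_measure[OF prob_space_msr[OF mY]]
        by (simp add: emeasure_distr fm finite_measure.emeasure_eq_measure)
    qed simp
    \<comment> \<open>Both sets compared below have the same partner \<open>pull Y g (B k)\<close>,
      so they agree almost everywhere. Over all k this identifies the two points of Y, because the
      sets \<open>B k\<close> separate points.\<close>
    fix g assume g: "g \<in> carrier G"
    have "AE x in msr X. x \<in> pull X g (f -` B k \<inter> space (msr X)) \<longleftrightarrow> x \<in> f -` pull Y g (B k) \<inter> space (msr X)" for k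
    proof (rule corr_AE_eq[OF X])
      have "corr X (pull X g (f -` B k \<inter> space (msr X))) Y (pull Y g (B k))"
        by (intro corr_pull mX mY key B g)
      moreover have "corr X (f -` pull Y g (B k) \<inter> space (msr X)) Y (pull Y g (B k))"
        by (intro key pull_sets mY B g)
      ultimately show "corr X (pull X g (f -` B k \<inter> space (msr X))) X (f -` pull Y g (B k) \<inter> space (msr X))"
        using corr_sym corr_trans by metis
    qed
    then have "AE x in msr X. \<forall>k. x \<in> pull X g (f -` B k \<inter> space (msr X)) \<longleftrightarrow> x \<in> f -` pull Y g (B k) \<inter> space (msr X)"
      by (simp only: AE_all_countable simp_thms)
    then show "AE x in msr X. f (act X g x) = act Y g (f x)"
      using AE_space
    proof eventually_elim
      case (elim x)
      have 1: "act X g x \<in> space (msr X)" "f x \<in> space (msr Y)" "f (act X g x) \<in> space (msr Y)"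
        "act Y g (f x) \<in> space (msr Y)"
        using elim(2) act_closed[OF mX g] act_closed[OF mY g] measurable_space[OF fm] by auto
      show ?case
        by (rule sep[OF 1(3,4)]) (use elim 1 in simp)
    qed
  qed
  then show ?thesis by blast
qed

lemma factors_iff_corr:
  assumes X: "zero_one_space X" and Y: "zero_one_space Y"
  shows "factors X Y \<longleftrightarrow> (\<forall>B\<in>sets (msr Y). \<exists>A. corr X A Y B)"
  using factors_if_corr[OF X Y]
    factor_map_corr[OF stationary_measured[OF zero_one_stationary[OF X]]
      stationary_measured[OF zero_one_stationary[OF Y]]]
  by blast

lemma factors_trans:
  assumes "zero_one_space X" "zero_one_space Y" "zero_one_space Z" "factors X Y" "factors Y Z"
  shows "factors X Z"
  using assms by (meson factors_iff_corr corr_trans corr_def)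

lemma factors_refl: "zero_one_space X \<Longrightarrow> factors X X"
  by (auto simp: factors_iff_corr intro: corr_refl)

text \<open>Rigidity: the composite pulls each \<open>A k\<close> back to a set with the same
  transform, hence to \<open>A k\<close> up to a null set, and these countably many sets separate
  points. It makes the order antisymmetric up to isomorphism.\<close>

lemma factor_map_self_AE_id:
  assumes X: "zero_one_space X" and Y: "zero_one_space Y"
    and f: "factor_map G X Y f" and h: "factor_map G Y X h"
  shows "AE x in msr X. h (f x) = x"
proof -
  note mX = stationary_measured[OF zero_one_stationary[OF X]]
  note mY = stationary_measured[OF zero_one_stationary[OF Y]]
  have fm: "f \<in> measurable (msr X) (msr Y)" and hm: "h \<in> measurable (msr Y) (msr X)"
    using f h by (auto simp: factor_map_def)
  obtain A and \<psi> :: "real \<Rightarrow> 'a" where A: "\<And>k::nat. A k \<in> sets (msr X)"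
    and sep: "\<And>x y. x \<in> space (msr X) \<Longrightarrow> y \<in> space (msr X) \<Longrightarrow> (\<And>k. x \<in> A k \<longleftrightarrow> y \<in> A k) \<Longrightarrow> x = y"
    using separating_coding[OF mX] by metis
  have "AE x in msr X. x \<in> f -` (h -` A k \<inter> space (msr Y)) \<inter> space (msr X) \<longleftrightarrow> x \<in> A k" for k
    using factor_map_corr[OF mX mY f measurable_sets[OF hm A]] factor_map_corr[OF mY mX h A]
    by (intro corr_AE_eq[OF X]) (rule corr_trans)
  then have "AE x in msr X. \<forall>k. x \<in> f -` (h -` A k \<inter> space (msr Y)) \<inter> space (msr X) \<longleftrightarrow> x \<in> A k"
    by (simp only: AE_all_countable simp_thms)
  then show ?thesis
    using AE_space
  proof eventually_elim
    case (elim x)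
    then have "f x \<in> space (msr Y)" "h (f x) \<in> space (msr X)"
      using measurable_space[OF fm] measurable_space[OF hm] by auto
    then show ?case by (intro sep) (use elim in simp_all)
  qed
qed

lemma isomorphic_iff_factors:
  assumes X: "zero_one_space X" and Y: "zero_one_space Y"
  shows "isomorphic_gspaces G X Y \<longleftrightarrow> factors X Y \<and> factors Y X"
  using factor_map_self_AE_id[OF X Y] factor_map_self_AE_id[OF Y X]
  unfolding isomorphic_gspaces_def by blast

section \<open>Invariant sigma-algebras and the factors they describe\<close>

definition invariant_algebra :: "('g, 'x) gspace \<Rightarrow> 'x set set \<Rightarrow> bool" where
  "invariant_algebra X F \<longleftrightarrow> sigma_algebra (space (msr X)) F \<and> F \<subseteq> sets (msr X) \<and>
     null_sets (msr X) \<subseteq> F \<and> (\<forall>g\<in>carrier G. \<forall>A\<in>F. pull X g A \<in> F)"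

text \<open>The sigma-algebra of X that belongs to Y. It is defined by transforms and not by a
  factor map, so it makes sense for any Y; if Y is not a factor of X, it records what the two spaces
  have in common.\<close>

definition trace_algebra :: "('g, 'x) gspace \<Rightarrow> ('g, 'y) gspace \<Rightarrow> 'x set set" where
  "trace_algebra X Y = {A. \<exists>B. corr X A Y B}"

lemma invariant_algebra_trace:
  assumes X: "zero_one_space X" and Y: "zero_one_space Y"
  shows "invariant_algebra X (trace_algebra X Y)"
  unfolding invariant_algebra_def
proof (intro conjI ballI)
  note mX = stationary_measured[OF zero_one_stationary[OF X]]
  note mY = stationary_measured[OF zero_one_stationary[OF Y]]
  show sub: "trace_algebra X Y \<subseteq> sets (msr X)" by (auto simp: trace_algebra_def corr_def)
  show "sigma_algebra (space (msr X)) (trace_algebra X Y)"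
    unfolding sigma_algebra_iff2
  proof (intro conjI allI ballI impI)
    show "trace_algebra X Y \<subseteq> Pow (space (msr X))" using sub sets.sets_into_space by blast
    show "{} \<in> trace_algebra X Y" by (auto simp: trace_algebra_def intro: corr_empty)
    show "space (msr X) - A \<in> trace_algebra X Y" if "A \<in> trace_algebra X Y" for A
      using that corr_Compl[OF mX mY] by (auto simp: trace_algebra_def)
    fix A :: "nat \<Rightarrow> 'a set" assume "range A \<subseteq> trace_algebra X Y"
    then have "\<forall>n. \<exists>B. corr X (A n) Y B" by (auto simp: trace_algebra_def)
    then obtain B where "\<And>n. corr X (A n) Y (B n)" by metis
    then have "corr X (\<Union>n. A n) Y (\<Union>n. B n)" by (rule corr_UN[OF X Y])
    then show "(\<Union>n. A n) \<in> trace_algebra X Y" unfolding trace_algebra_def by blast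
  qed
  show "null_sets (msr X) \<subseteq> trace_algebra X Y"
  proof
    fix N assume N: "N \<in> null_sets (msr X)"
    \<comment> \<open>Quasi-invariance makes the transform of a null set vanish at every group
      element.\<close>
    then have "corr X N Y {}" using poisson_null[OF mX N] by (auto simp: corr_def poisson_def[of Y])
    then show "N \<in> trace_algebra X Y" by (auto simp: trace_algebra_def)
  qed
  show "pull X g A \<in> trace_algebra X Y" if "g \<in> carrier G" "A \<in> trace_algebra X Y" for g A
    using that corr_pull[OF mX mY] by (auto simp: trace_algebra_def)
qed

text \<open>Every set of Y has a partner in X, so it has one in Z exactly if that partner has one.
  Inclusion of sigma-algebras of a single ambient space X thus describes the order.\<close>

lemma factors_iff_trace_subset:
  assumes X: "zero_one_space X" and Y: "zero_one_space Y" and Z: "zero_one_space Z"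
    and XY: "factors X Y"
  shows "factors Z Y \<longleftrightarrow> trace_algebra X Y \<subseteq> trace_algebra X Z"
proof
  assume "factors Z Y"
  then show "trace_algebra X Y \<subseteq> trace_algebra X Z"
    unfolding factors_iff_corr[OF Z Y] trace_algebra_def by (auto, metis corr_def corr_sym corr_trans)
next
  assume sub: "trace_algebra X Y \<subseteq> trace_algebra X Z"
  show "factors Z Y"
    unfolding factors_iff_corr[OF Z Y]
  proof
    fix B assume "B \<in> sets (msr Y)"
    then obtain A where A: "corr X A Y B" using XY factors_iff_corr[OF X Y] by blast
    then obtain C where "corr X A Z C" using sub by (auto simp: trace_algebra_def)
    then show "\<exists>C. corr Z C Y B" using A corr_sym corr_trans by metis
  qed
qed

lemma trace_algebra_self: "trace_algebra X X = sets (msr X)"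
  by (auto simp: trace_algebra_def corr_def)

end

section \<open>Proximality as a 0-1 law\<close>

context random_walk
begin

text \<open>Stationarity is an identity between values of transforms, so it passes to a space all of
  whose sets have partners in X.\<close>

lemma stationary_if_corr:
  assumes X: "stationary G \<mu> X" and mY: "measured_gspace G Y"
    and c: "\<And>B. B \<in> sets (msr Y) \<Longrightarrow> \<exists>A. corr X A Y B"
  shows "stationary G \<mu> Y"
  unfolding stationary_def
proof (intro conjI ballI mY)
  fix B assume B: "B \<in> sets (msr Y)"
  note mX = stationary_measured[OF X]
  obtain A where A: "corr X A Y B" using c[OF B] by blast
  then have SA: "A \<in> sets (msr X)" by (simp add: corr_def)
  have "(\<integral>\<^sup>+ g. emeasure (translate Y g) B \<partial>measure_pmf \<mu>) = (\<integral>\<^sup>+ g. emeasure (translate X g) A \<partial>measure_pmf \<mu>)"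
    using set_pmf_subset A B SA
    by (intro nn_integral_cong_AE AE_pmfI)
      (auto simp: translate_emeasure[OF mX] translate_emeasure[OF mY] corr_def)
  also have "\<dots> = emeasure (msr X) A" using X SA by (simp add: stationary_def)
  also have "\<dots> = ennreal (poisson X A \<one>)"
    using SA prob_space.finite_measure[OF prob_space_msr[OF mX]]
    by (simp add: poisson_one[OF mX] finite_measure.emeasure_eq_measure)
  also have "\<dots> = ennreal (poisson Y B \<one>)" using A by (simp add: corr_def)
  also have "\<dots> = emeasure (msr Y) B"
    using B prob_space.finite_measure[OF prob_space_msr[OF mY]]
    by (simp add: poisson_one[OF mY] finite_measure.emeasure_eq_measure)
  finally show "(\<integral>\<^sup>+ g. emeasure (translate Y g) B \<partial>measure_pmf \<mu>) = emeasure (msr Y) B" .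
qed

lemma zero_one_cong: "(\<And>g. g \<in> carrier G \<Longrightarrow> \<phi> g = \<psi> g) \<Longrightarrow> zero_one \<phi> \<longleftrightarrow> zero_one \<psi>"
  by (simp add: zero_one_def)

lemma zero_one_space_if_corr:
  assumes X: "zero_one_space X" and mY: "measured_gspace G Y"
    and c: "\<And>B. B \<in> sets (msr Y) \<Longrightarrow> \<exists>A. corr X A Y B"
  shows "zero_one_space Y"
  unfolding zero_one_space_def
proof (intro conjI ballI)
  show "stationary G \<mu> Y" by (rule stationary_if_corr[OF zero_one_stationary[OF X] mY c])
  fix B assume B: "B \<in> sets (msr Y)"
  obtain A where A: "corr X A Y B" using c[OF B] by blast
  then have "zero_one (poisson X A)" using X by (simp add: corr_def zero_one_space_def)
  then show "zero_one (poisson Y B)"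
    using A zero_one_cong[of "poisson X A" "poisson Y B"] by (simp add: corr_def)
qed

context
  fixes Y :: "('g, 'y) gspace"
  assumes Y: "stationary G \<mu> Y"
begin

private lemma mY: "measured_gspace G Y"
  by (rule stationary_measured[OF Y])

lemma zero_one_Compl:
  assumes A: "A \<in> sets (msr Y)" and z: "zero_one (poisson Y A)"
  shows "zero_one (poisson Y (space (msr Y) - A))"
  using z unfolding zero_one_def
proof eventually_elim
  case (elim w)
  have eq: "(\<lambda>n. poisson Y (space (msr Y) - A) (W w n)) = (\<lambda>n. 1 - poisson Y A (W w n))"
    using A by (simp add: poisson_Compl[OF mY])
  show ?case
    using elim tendsto_diff[OF tendsto_const, of "\<lambda>n. poisson Y A (W w n)" _ sequentially 1]
    unfolding eq by force
qed

lemma zero_one_Int: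
  assumes A: "A \<in> sets (msr Y)" "B \<in> sets (msr Y)"
    and z: "zero_one (poisson Y A)" "zero_one (poisson Y B)"
  shows "zero_one (poisson Y (A \<inter> B))"
  using z unfolding zero_one_def
proof eventually_elim
  case (elim w)
  then obtain a b where ab: "a = 0 \<or> a = 1" "b = 0 \<or> b = 1"
    "(\<lambda>n. poisson Y A (W w n)) \<longlonglongrightarrow> a" "(\<lambda>n. poisson Y B (W w n)) \<longlonglongrightarrow> b" by blast
  have "(\<lambda>n. poisson Y (A \<inter> B) (W w n)) \<longlonglongrightarrow> a * b"
    by (rule poisson_Int_tendsto[OF mY A W_closed ab(3,4,1,2)])
  then show ?case using ab(1,2) by auto
qed

lemma zero_one_finite_UN:
  fixes A :: "nat \<Rightarrow> 'y set"
  assumes A: "\<And>n. A n \<in> sets (msr Y)" and z: "\<And>n. zero_one (poisson Y (A n))"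
  shows "zero_one (poisson Y (\<Union>i<n. A i))"
proof (induction n)
  case 0
  then show ?case by (simp add: zero_one_def poisson_def)
next
  case (Suc n)
  let ?S = "space (msr Y)"
  have S: "(\<Union>i<n. A i) \<in> sets (msr Y)" using A by auto
  have "zero_one (poisson Y (?S - (?S - (\<Union>i<n. A i)) \<inter> (?S - A n)))"
    by (intro zero_one_Compl zero_one_Int Suc z A S sets.Int sets.compl_sets)
  moreover have "?S - (?S - (\<Union>i<n. A i)) \<inter> (?S - A n) = (\<Union>i<Suc n. A i)"
    using sets.sets_into_space[OF S] sets.sets_into_space[OF A[of n]] unfolding lessThan_Suc by blast
  ultimately show ?case by simp
qed

text \<open>If a finite part of the union has limit 1, so does the union. If all finite parts have
  limit 0, the remainder must be small uniformly along the path before the limit in n is taken;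
  \<open>AE_uniformly_small\<close> supplies this.\<close>

lemma zero_one_UN:
  fixes A :: "nat \<Rightarrow> 'y set"
  assumes A: "\<And>n. A n \<in> sets (msr Y)" and z: "\<And>n. zero_one (poisson Y (A n))"
  shows "zero_one (poisson Y (\<Union>n. A n))"
proof -
  interpret prob_space "msr Y" using prob_space_msr[OF mY] .
  define U where "U = (\<Union>n. A n)"
  define B where "B n = (\<Union>i<n. A i)" for n
  have B: "B n \<in> events" for n using A by (auto simp: B_def)
  have U: "U \<in> events" using A by (auto simp: U_def)
  have BU: "B n \<subseteq> U" for n by (auto simp: B_def U_def)
  have UB: "U = (\<Union>n. B n)" by (auto simp: B_def U_def)
  have "(\<lambda>n. prob (U - B n)) \<longlonglongrightarrow> prob (\<Inter>n. U - B n)"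
    using B U by (intro finite_Lim_measure_decseq) (fastforce simp: decseq_def B_def)+
  moreover have "(\<Inter>n. U - B n) = {}" using UB by blast
  ultimately have "(\<lambda>n. prob (U - B n)) \<longlonglongrightarrow> 0" by (simp only: measure_empty)
  then have lim: "(\<lambda>n. poisson Y (U - B n) \<one>) \<longlonglongrightarrow> 0"
    using B U by (simp add: poisson_one[OF mY] sets.Diff)
  have "AE w in \<Omega>. \<forall>\<epsilon>>0. \<exists>m. \<forall>n. poisson Y (U - B m) (W w n) < \<epsilon>"
    by (rule AE_uniformly_small[OF harmonic_poisson[OF Y] lim]) (use B U in auto)
  moreover have "AE w in \<Omega>. \<forall>m. (\<lambda>n. poisson Y (B m) (W w n)) \<longlonglongrightarrow> 0 \<or> (\<lambda>n. poisson Y (B m) (W w n)) \<longlonglongrightarrow> 1"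
    using zero_one_finite_UN[OF A z] unfolding AE_all_countable by (simp add: zero_one_def B_def)
  ultimately have "AE w in \<Omega>. (\<lambda>n. poisson Y U (W w n)) \<longlonglongrightarrow> 0 \<or> (\<lambda>n. poisson Y U (W w n)) \<longlonglongrightarrow> 1"
  proof eventually_elim
    case (elim w)
    have le: "poisson Y (B m) (W w n) \<le> poisson Y U (W w n)" for m n
      using BU U by (intro poisson_mono[OF mY]) auto
    have ge: "poisson Y U (W w n) \<le> poisson Y (B m) (W w n) + poisson Y (U - B m) (W w n)" for m n
      using poisson_Un_le[OF mY, of "B m" "U - B m" "W w n"] B U BU[of m]
      by (simp add: sets.Diff Un_absorb1)
    show ?case
    proof (cases "\<exists>m. (\<lambda>n. poisson Y (B m) (W w n)) \<longlonglongrightarrow> 1")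
      case True
      then obtain m where m: "(\<lambda>n. poisson Y (B m) (W w n)) \<longlonglongrightarrow> 1" by blast
      have "(\<lambda>n. poisson Y U (W w n)) \<longlonglongrightarrow> 1"
        by (rule tendsto_sandwich[OF _ _ m tendsto_const]) (simp_all add: le poisson_bounds[OF mY])
      then show ?thesis by blast
    next
      case False
      then have 0: "(\<lambda>n. poisson Y (B m) (W w n)) \<longlonglongrightarrow> 0" for m using elim(2) by blast
      have "(\<lambda>n. poisson Y U (W w n)) \<longlonglongrightarrow> 0"
      proof (rule LIMSEQ_I)
        fix r :: real assume r: "r > 0"
        then have "\<exists>m. \<forall>n. poisson Y (U - B m) (W w n) < r/2" using elim(1)[rule_format, of "r/2"] by simp
        then obtain m where m: "\<And>n. poisson Y (U - B m) (W w n) < r/2" by blast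
        obtain n0 where n0: "\<And>n. n \<ge> n0 \<Longrightarrow> norm (poisson Y (B m) (W w n) - 0) < r/2"
          using LIMSEQ_D[OF 0[of m], of "r/2"] r by auto
        have "norm (poisson Y U (W w n) - 0) < r" if "n \<ge> n0" for n
        proof -
          have "poisson Y (B m) (W w n) < r/2" using n0[OF that] by simp
          then show ?thesis
            using ge[of n m] m[of n] poisson_bounds(1)[OF mY, of U "W w n"] by simp
        qed
        then show "\<exists>no. \<forall>n\<ge>no. norm (poisson Y U (W w n) - 0) < r" by blast
      qed
      then show ?thesis by blast
    qed
  qed
  then show ?thesis by (simp add: zero_one_def U_def)
qed

end

lemma compact_model_continuous_measurable:
  assumes cm: "compact_model G Y T" and f: "continuous_map T euclideanreal f"
  shows "f \<in> borel_measurable (msr Y)"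
proof (rule borel_measurableI)
  fix S :: "real set" assume "open S"
  then have "openin T {x \<in> topspace T. f x \<in> S}"
    using f by (intro openin_continuous_map_preimage[OF f]) simp
  then have "{x \<in> topspace T. f x \<in> S} \<in> sets (msr Y)"
    using cm unfolding compact_model_def borel_sets_def by (metis mem_Collect_eq sigma_sets.Basic)
  moreover have "{x \<in> topspace T. f x \<in> S} = f -` S \<inter> space (msr Y)"
    using cm by (auto simp: compact_model_def)
  ultimately show "f -` S \<inter> space (msr Y) \<in> sets (msr Y)" by simp
qed

lemma weak_star_limit_tendsto:
  assumes cm: "compact_model G Y T" and y: "y \<in> topspace T"
    and lim: "weak_star_limit T N (return (msr Y) y)" and f: "continuous_map T euclideanreal f"
  shows "(\<lambda>n. \<integral>x. f x \<partial>N n) \<longlonglongrightarrow> f y"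
proof -
  have "y \<in> space (msr Y)" using y cm by (simp add: compact_model_def)
  then have "(\<integral>x. f x \<partial>return (msr Y) y) = f y"
    using compact_model_continuous_measurable[OF cm f] by (intro integral_return)
  then show ?thesis using lim f unfolding weak_star_limit_def by metis
qed

text \<open>K is an intersection of decreasing open sets \<open>C m\<close>, and a Urysohn function
  between K and \<open>C m\<close> has integrals converging to its value at the limit point y. These
  integrals exceed the transform of K by at most that of \<open>C m - K\<close>, which for a
  suitable m is small at all times. The limit is 1 if y lies in K and 0 otherwise.\<close>

lemma zero_one_closed:
  fixes Y :: "('g, 'y) gspace"
  assumes Y: "stationary G \<mu> Y" and cm: "compact_model G Y T"
    and lim: "AE w in \<Omega>. \<exists>y\<in>topspace T. weak_star_limit T (\<lambda>n. translate Y (walk G w n)) (return (msr Y) y)"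
    and K: "closedin T K"
  shows "zero_one (poisson Y K)"
proof -
  note mY = stationary_measured[OF Y]
  interpret prob_space "msr Y" using prob_space_msr[OF mY] .
  have T: "metrizable_space T" and top: "topspace T = space (msr Y)" and bor: "borel_sets T = events"
    using cm by (auto simp: compact_model_def)
  have opn: "openin T U \<Longrightarrow> U \<in> events" for U
    unfolding bor[symmetric] borel_sets_def by (simp add: sigma_sets.Basic)
  have KS: "K \<in> events"
  proof -
    have "topspace T - K \<in> events" using K by (intro opn) auto
    then have "space (msr Y) - (topspace T - K) \<in> events" by (rule sets.compl_sets)
    moreover have "space (msr Y) - (topspace T - K) = K" using closedin_subset[OF K] top by auto
    ultimately show ?thesis by simp
  qed
  obtain C where C: "\<And>n::nat. openin T (C n)" "\<And>n. C (Suc n) \<subseteq> C n" "\<Inter>(range C) = K"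
    using closed_imp_gdelta_in[OF T K] unfolding gdelta_in_descending by metis
  have norm: "normal_space T" using T by (rule metrizable_imp_normal_space)
  have "(\<lambda>m. prob (C m - K)) \<longlonglongrightarrow> prob (\<Inter>m. C m - K)"
    using opn C(1) KS C(2) by (intro finite_Lim_measure_decseq decseq_SucI) auto
  moreover have "(\<Inter>m. C m - K) = {}" using C(3) by blast
  ultimately have "(\<lambda>m. prob (C m - K)) \<longlonglongrightarrow> 0" by (simp only: measure_empty)
  then have "(\<lambda>m. poisson Y (C m - K) \<one>) \<longlonglongrightarrow> 0"
    using opn[OF C(1)] KS by (simp add: poisson_one[OF mY] sets.Diff)
  then have "AE w in \<Omega>. \<forall>\<epsilon>>0. \<exists>m. \<forall>n. poisson Y (C m - K) (W w n) < \<epsilon>"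
    using opn[OF C(1)] KS by (intro AE_uniformly_small harmonic_poisson[OF Y]) auto
  then show ?thesis
    unfolding zero_one_def using lim AE_walk_eq_W
  proof eventually_elim
    case (elim w)
    obtain y where y: "y \<in> topspace T"
      and ws: "weak_star_limit T (\<lambda>n. translate Y (W w n)) (return (msr Y) y)"
      using elim(2,3) by auto
    note limf = weak_star_limit_tendsto[OF cm y ws]
    have ub: "poisson Y K (W w n) \<le> (\<integral>x. f x \<partial>translate Y (W w n))"
      and lb: "(\<integral>x. f x \<partial>translate Y (W w n)) \<le> poisson Y K (W w n) + poisson Y (C m - K) (W w n)"
      if f: "continuous_map T (top_of_set {0..1}) f" and fK: "f ` K \<subseteq> {1}" and f0: "f ` (topspace T - C m) \<subseteq> {0}"
      for f m n
    proof -
      interpret t: prob_space "translate Y (W w n)" by (rule prob_space_translate[OF mY W_closed])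
      have fr: "continuous_map T euclideanreal f" "\<And>x. x \<in> topspace T \<Longrightarrow> 0 \<le> f x \<and> f x \<le> 1"
        using f by (auto simp: continuous_map_in_subtopology)
      have fm: "f \<in> borel_measurable (translate Y (W w n))"
        using compact_model_continuous_measurable[OF cm fr(1)]
        by (simp cong: measurable_cong_sets add: sets_translate[OF mY])
      have sp: "space (translate Y (W w n)) = topspace T" using top by (simp add: translate_def)
      have int: "integrable (translate Y (W w n)) f"
        by (rule t.integrable_const_bound[where B = 1]) (use fr(2) fm sp in auto)
      have ev: "t.events = events" by (simp add: translate_def)
      have CS: "C m \<in> events" using opn C(1) .
      have "poisson Y K (W w n) = (\<integral>x. indicator K x \<partial>translate Y (W w n))"
        using KS ev by (simp add: poisson_eq[OF mY])
      also have "\<dots> \<le> (\<integral>x. f x \<partial>translate Y (W w n))"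
        using fK fr(2) KS ev sp
        by (intro integral_mono int integrable_real_indicator) (auto simp: indicator_def t.emeasure_eq_measure)
      finally show "poisson Y K (W w n) \<le> (\<integral>x. f x \<partial>translate Y (W w n))" .
      have "(\<integral>x. f x \<partial>translate Y (W w n)) \<le> (\<integral>x. indicator (C m) x \<partial>translate Y (W w n))"
        using f0 fr(2) CS ev sp
        by (intro integral_mono int integrable_real_indicator) (auto simp: indicator_def t.emeasure_eq_measure)
      also have "\<dots> = poisson Y (K \<union> (C m - K)) (W w n)"
      proof -
        have "K \<union> (C m - K) = C m" using C(3) by blast
        then show ?thesis using CS ev by (simp add: poisson_eq[OF mY])
      qed
      also have "\<dots> \<le> poisson Y K (W w n) + poisson Y (C m - K) (W w n)"
        using KS CS by (intro poisson_Un_le[OF mY]) auto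
      finally show "(\<integral>x. f x \<partial>translate Y (W w n)) \<le> poisson Y K (W w n) + poisson Y (C m - K) (W w n)" .
    qed
    have dis: "disjnt K (topspace T - C m)" for m using C(3) by (auto simp: disjnt_def)
    show ?case
    proof (cases "y \<in> K")
      case True
      have "(\<lambda>n. poisson Y K (W w n)) \<longlonglongrightarrow> 1"
      proof (rule LIMSEQ_I)
        fix r :: real assume r: "r > 0"
        \<comment> \<open>The index m is fixed before the Urysohn function, so the error r/2 holds
          for all times at once.\<close>
        then obtain m where m: "\<And>n. poisson Y (C m - K) (W w n) < r/2"
          using elim(1)[rule_format, of "r/2"] by auto
        have "closedin T (topspace T - C m)" using C(1) by blast
        then obtain f where f: "continuous_map T (top_of_set {0..1}) f" "f ` K \<subseteq> {1}" "f ` (topspace T - C m) \<subseteq> {0::real}"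
          using Urysohn_lemma[OF norm _ K, of "topspace T - C m" 0 1] dis by (metis disjnt_sym zero_le_one)
        have "f y = 1" using f(2) True by auto
        then have "(\<lambda>n. \<integral>x. f x \<partial>translate Y (W w n)) \<longlonglongrightarrow> 1"
          using limf[of f] f(1) by (simp add: continuous_map_in_subtopology)
        then obtain n0 where n0: "\<And>n. n \<ge> n0 \<Longrightarrow> norm ((\<integral>x. f x \<partial>translate Y (W w n)) - 1) < r/2"
          using LIMSEQ_D[of _ 1 "r/2"] r by (metis half_gt_zero)
        have "norm (poisson Y K (W w n) - 1) < r" if "n \<ge> n0" for n
        proof -
          have "1 - (\<integral>x. f x \<partial>translate Y (W w n)) < r/2" using n0[OF that] unfolding real_norm_def by linarith
          moreover have "(\<integral>x. f x \<partial>translate Y (W w n)) \<le> poisson Y K (W w n) + poisson Y (C m - K) (W w n)"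
            by (rule lb[OF f])
          ultimately show ?thesis using m[of n] poisson_bounds(2)[OF mY, of K "W w n"] by simp
        qed
        then show "\<exists>no. \<forall>n\<ge>no. norm (poisson Y K (W w n) - 1) < r" by blast
      qed
      then show ?thesis by blast
    next
      case False
      \<comment> \<open>Outside \<open>C m\<close> the Urysohn function vanishes, so it is 0 at y,
        while its integrals dominate the transform of K.\<close>
      then obtain m where m: "y \<notin> C m" using C(3) by blast
      have "closedin T (topspace T - C m)" using C(1) by blast
      then obtain f where f: "continuous_map T (top_of_set {0..1}) f" "f ` K \<subseteq> {1}" "f ` (topspace T - C m) \<subseteq> {0::real}"
        using Urysohn_lemma[OF norm _ K, of "topspace T - C m" 0 1] dis by (metis disjnt_sym zero_le_one)
      have "f y = 0" using f(3) m y by auto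
      then have lim0: "(\<lambda>n. \<integral>x. f x \<partial>translate Y (W w n)) \<longlonglongrightarrow> 0"
        using limf[of f] f(1) by (simp add: continuous_map_in_subtopology)
      have "(\<lambda>n. poisson Y K (W w n)) \<longlonglongrightarrow> 0"
        by (rule tendsto_sandwich[OF _ _ tendsto_const lim0]) (simp_all add: ub[OF f] poisson_bounds[OF mY])
      then show ?thesis by blast
    qed
  qed
qed

text \<open>In the compact model the open sets generate the measurable sets, and the sets with the
  0-1 property form a sigma-algebra that contains all closed sets. The result returns to X through
  the inverse map h, a factor map from the model to X.\<close>

theorem boundary_imp_zero_one_space:
  fixes X :: "('g, 'x) gspace"
  assumes "boundary G \<mu> X"
  shows "zero_one_space X"
proof -
  have X: "stationary G \<mu> X" and "proximal G \<mu> X" using assms by (auto simp: boundary_def)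
  then obtain Y :: "('g, real) gspace" and T f h where cm: "compact_model G Y T"
    and f: "factor_map G X Y f" and h: "factor_map G Y X h"
    and hf: "AE x in msr X. h (f x) = x"
    and lim: "AE w in \<Omega>. \<exists>y\<in>topspace T. weak_star_limit T (\<lambda>n. translate Y (walk G w n)) (return (msr Y) y)"
    unfolding proximal_def isomorphic_gspaces_def by blast
  note mX = stationary_measured[OF X]
  have mY: "measured_gspace G Y" using cm by (simp add: compact_model_def)
  have Y: "stationary G \<mu> Y"
    using factor_map_corr[OF mX mY f] by (intro stationary_if_corr[OF X mY]) blast
  have top: "topspace T = space (msr Y)" and bor: "sets (msr Y) = sigma_sets (topspace T) {U. openin T U}"
    using cm by (auto simp: compact_model_def borel_sets_def)
  have *: "B \<in> sets (msr Y) \<and> zero_one (poisson Y B)" if "B \<in> sigma_sets (topspace T) {U. openin T U}" for B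
    using that
  proof induction
    case (Basic U)
    then have U: "U \<in> sets (msr Y)" unfolding bor by (rule sigma_sets.Basic)
    have C: "closedin T (topspace T - U)" using Basic by blast
    have CS: "topspace T - U \<in> sets (msr Y)" unfolding top using U by (rule sets.compl_sets)
    have "zero_one (poisson Y (space (msr Y) - (topspace T - U)))"
      by (intro zero_one_Compl[OF Y CS] zero_one_closed[OF Y cm lim C])
    moreover have "space (msr Y) - (topspace T - U) = U" using sets.sets_into_space[OF U] top by auto
    ultimately show ?case using U by simp
  next
    case Empty
    then show ?case by (simp add: zero_one_def poisson_def)
  next
    case (Compl B)
    then show ?case unfolding top using zero_one_Compl[OF Y] by auto
  next
    case (Union B)
    then show ?case using zero_one_UN[OF Y, of B] by auto
  qed
  have zY: "zero_one_space Y"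
    unfolding zero_one_space_def
  proof (intro conjI ballI Y)
    fix B assume "B \<in> sets (msr Y)"
    then have "B \<in> sigma_sets (topspace T) {U. openin T U}" by (simp only: bor)
    from *[OF this] show "zero_one (poisson Y B)" ..
  qed
  show ?thesis
    by (rule zero_one_space_if_corr[OF zY mX]) (rule exI, rule factor_map_corr[OF mY mX h])
qed

end

section \<open>Point realization of factors\<close>

text \<open>Cantor space as a topology on the type of reals. Spaces realized on it are objects of
  \<open>BL\<close> and come with a compact model.\<close>

definition cantor_top :: "real topology" where
  "cantor_top = pullback_topology UNIV (\<lambda>r k. k \<in> bits r)
     (product_topology (\<lambda>_. discrete_topology UNIV) UNIV)"

lemma topspace_cantor_top [simp]: "topspace cantor_top = UNIV"
  by (auto simp: cantor_top_def topspace_pullback_topology)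

lemma openin_cantor_top:
  "openin cantor_top U \<longleftrightarrow> (\<forall>r\<in>U. \<exists>n. {s. \<forall>k<n. k \<in> bits s \<longleftrightarrow> k \<in> bits r} \<subseteq> U)"
    (is "_ \<longleftrightarrow> ?R U")
proof
  assume "openin cantor_top U"
  then obtain V where V: "openin (product_topology (\<lambda>_::nat. discrete_topology (UNIV :: bool set)) UNIV) V"
    and U: "U = (\<lambda>r k. k \<in> bits r) -` V"
    by (auto simp: cantor_top_def openin_pullback_topology)
  show "?R U"
  proof
    fix r assume "r \<in> U"
    then have "(\<lambda>k. k \<in> bits r) \<in> V" by (simp add: U)
    then obtain S where S: "finite {i. S i \<noteq> (UNIV :: bool set)}" "(\<lambda>k. k \<in> bits r) \<in> Pi\<^sub>E UNIV S" "Pi\<^sub>E UNIV S \<subseteq> V"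
      using V unfolding openin_product_topology_alt topspace_discrete_topology by (simp, metis)
    obtain n where n: "\<And>i. S i \<noteq> UNIV \<Longrightarrow> i < n"
      using S(1)[unfolded finite_nat_set_iff_bounded] by blast
    have "s \<in> U" if s: "\<forall>k<n. k \<in> bits s \<longleftrightarrow> k \<in> bits r" for s
    proof -
      have "(k \<in> bits s) \<in> S k" for k
      proof (cases "k < n")
        case True
        then have "(k \<in> bits s) = (k \<in> bits r)" using s by simp
        then show ?thesis using S(2) by (simp add: PiE_iff)
      next
        case False
        then show ?thesis using n by blast
      qed
      then have "(\<lambda>k. k \<in> bits s) \<in> Pi\<^sub>E UNIV S" by (simp add: PiE_iff)
      then show ?thesis using S(3) by (auto simp: U)
    qed
    then show "\<exists>n. {s. \<forall>k<n. k \<in> bits s \<longleftrightarrow> k \<in> bits r} \<subseteq> U" by blast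
  qed
next
  assume R: "?R U"
  define V where "V = {x. inv_into UNIV bits {k. x k} \<in> U}"
  have "openin (product_topology (\<lambda>_::nat. discrete_topology (UNIV :: bool set)) UNIV) V"
    unfolding openin_product_topology_alt
  proof
    fix x assume x: "x \<in> V"
    then obtain n where n: "{s. \<forall>k<n. k \<in> bits s \<longleftrightarrow> x k} \<subseteq> U"
      using R by (fastforce simp: V_def)
    define S where "S i = (if i < n then {x i} else UNIV)" for i
    have "{i. S i \<noteq> UNIV} \<subseteq> {..<n}" by (auto simp: S_def split: if_splits)
    then have "finite {i. S i \<noteq> UNIV}" by (rule finite_subset) simp
    moreover have "x \<in> Pi\<^sub>E UNIV S" by (simp add: PiE_iff S_def)
    moreover have "Pi\<^sub>E UNIV S \<subseteq> V"
    proof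
      fix y assume y: "y \<in> Pi\<^sub>E UNIV S"
      have "y k = x k" if "k < n" for k
      proof -
        have "y k \<in> S k" using y by auto
        then show ?thesis using that by (simp add: S_def)
      qed
      then have "inv_into UNIV bits {k. y k} \<in> {s. \<forall>k<n. k \<in> bits s \<longleftrightarrow> x k}" by simp
      then show "y \<in> V" using n by (auto simp: V_def)
    qed
    ultimately show "\<exists>S. finite {i \<in> UNIV. S i \<noteq> topspace (discrete_topology (UNIV :: bool set))} \<and>
       (\<forall>i\<in>UNIV. openin (discrete_topology UNIV) (S i)) \<and> x \<in> Pi\<^sub>E UNIV S \<and> Pi\<^sub>E UNIV S \<subseteq> V"
      by (intro exI[of _ S]) simp
  qed
  moreover have "U = (\<lambda>r k. k \<in> bits r) -` V"
    using bits_eq_iff by (auto simp: V_def bij_bits bij_is_inj)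
  ultimately show "openin cantor_top U"
    by (auto simp: cantor_top_def openin_pullback_topology)
qed

lemma cantor_top_homeomorphic:
  "cantor_top homeomorphic_space product_topology (\<lambda>_::nat. discrete_topology (UNIV :: bool set)) UNIV"
proof -
  let ?P = "product_topology (\<lambda>_::nat. discrete_topology (UNIV :: bool set)) UNIV"
  let ?f = "\<lambda>r k. k \<in> bits r" and ?g = "\<lambda>x. inv_into UNIV bits {k. x k}"
  have "continuous_map cantor_top ?P (id \<circ> ?f)"
    unfolding cantor_top_def by (rule continuous_map_pullback) simp
  moreover have "continuous_map ?P cantor_top ?g"
    unfolding cantor_top_def by (rule continuous_map_pullback') (simp_all add: o_def)
  ultimately have "homeomorphic_maps cantor_top ?P ?f ?g"
    by (simp add: homeomorphic_maps_def bij_bits bij_is_inj)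
  then show ?thesis unfolding homeomorphic_space_def by blast
qed

lemma compact_space_cantor_top: "compact_space cantor_top"
  unfolding homeomorphic_compact_space[OF cantor_top_homeomorphic]
  by (simp add: compact_space_product_topology compact_space_discrete_topology)

lemma metrizable_space_cantor_top: "metrizable_space cantor_top"
  unfolding homeomorphic_metrizable_space[OF cantor_top_homeomorphic]
  by (simp add: metrizable_space_product_topology)

definition cylinder :: "bool list \<Rightarrow> real set" where
  "cylinder l = {s. \<forall>k<length l. k \<in> bits s \<longleftrightarrow> l ! k}"

lemma openin_cylinder: "openin cantor_top (cylinder l)"
  unfolding openin_cantor_top by (intro ballI exI[of _ "length l"]) (auto simp: cylinder_def)

lemma cantor_top_base:
  assumes "openin cantor_top U" "r \<in> U"
  shows "\<exists>l. r \<in> cylinder l \<and> cylinder l \<subseteq> U"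
proof -
  obtain n where n: "{s. \<forall>k<n. k \<in> bits s \<longleftrightarrow> k \<in> bits r} \<subseteq> U"
    using assms unfolding openin_cantor_top by blast
  have "cylinder (map (\<lambda>k. k \<in> bits r) [0..<n]) = {s. \<forall>k<n. k \<in> bits s \<longleftrightarrow> k \<in> bits r}"
    by (simp add: cylinder_def)
  then show ?thesis using n by (intro exI[of _ "map (\<lambda>k. k \<in> bits r) [0..<n]"]) auto
qed

lemma cylinder_sets: "cylinder l \<in> sets cantor"
proof -
  have "{s \<in> space cantor. \<forall>k<length l. k \<in> bits s \<longleftrightarrow> l ! k} \<in> sets cantor" by measurable
  then show ?thesis by (simp add: cylinder_def)
qed

lemma second_countable_cantor_top: "second_countable cantor_top"
  unfolding second_countable_def using openin_cylinder cantor_top_base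
  by (intro exI[of _ "range cylinder"]) auto

lemma borel_sets_cantor_top: "borel_sets cantor_top = sets cantor"
proof
  have "U \<in> sets cantor" if U: "openin cantor_top U" for U
  proof -
    have "U = (\<Union>l\<in>{l. cylinder l \<subseteq> U}. cylinder l)" using cantor_top_base[OF U] by blast
    also have "\<dots> \<in> sets cantor" by (intro sets.countable_UN' cylinder_sets) (auto simp: cylinder_sets)
    finally show ?thesis .
  qed
  then show "borel_sets cantor_top \<subseteq> sets cantor"
    unfolding borel_sets_def using sets.sigma_sets_subset[of "{U. openin cantor_top U}" cantor] by auto
  have "openin cantor_top (digit k)" for k
    unfolding openin_cantor_top by (intro ballI exI[of _ "Suc k"]) (auto simp: digit_def)
  then show "sets cantor \<subseteq> borel_sets cantor_top"
    unfolding borel_sets_def sets_cantor topspace_cantor_top by (intro sigma_sets_mono') auto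
qed

lemma standard_borel_cantor:
  assumes "sets M = sets cantor"
  shows "standard_borel M"
  unfolding standard_borel_def
proof (intro exI conjI)
  show "completely_metrizable_space cantor_top"
    by (intro locally_compact_imp_completely_metrizable_space compact_imp_locally_compact_space
      metrizable_space_cantor_top compact_space_cantor_top)
qed (use assms sets_eq_imp_space_eq[OF assms] in
  \<open>auto simp: second_countable_cantor_top borel_sets_cantor_top\<close>)

section \<open>Group actions on Cantor space by permuting coordinates\<close>

definition permute_bits :: "('g \<Rightarrow> nat \<Rightarrow> nat) \<Rightarrow> 'g \<Rightarrow> real \<Rightarrow> real" where
  "permute_bits \<tau> g r = inv_into UNIV bits {k. \<tau> g k \<in> bits r}"

lemma bits_permute_bits [simp]: "k \<in> bits (permute_bits \<tau> g r) \<longleftrightarrow> \<tau> g k \<in> bits r"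
  by (simp add: permute_bits_def)

lemma permute_bits_measurable: "sets M = sets cantor \<Longrightarrow> permute_bits \<tau> g \<in> measurable M M"
proof -
  assume M: "sets M = sets cantor"
  have "permute_bits \<tau> g \<in> measurable cantor cantor"
  proof (rule measurable_into_cantor)
    fix k
    have "{r \<in> space cantor. \<tau> g k \<in> bits r} \<in> sets cantor" by measurable
    then show "{r \<in> space cantor. k \<in> bits (permute_bits \<tau> g r)} \<in> sets cantor" by simp
  qed
  then show ?thesis using M by (simp cong: measurable_cong_sets)
qed

lemma continuous_permute_bits: "continuous_map cantor_top cantor_top (permute_bits \<tau> g)"
  unfolding continuous_map_def
proof (intro conjI allI impI)
  fix U assume U: "openin cantor_top U"
  show "openin cantor_top {r \<in> topspace cantor_top. permute_bits \<tau> g r \<in> U}"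
    unfolding openin_cantor_top
  proof
    fix r assume "r \<in> {r \<in> topspace cantor_top. permute_bits \<tau> g r \<in> U}"
    then obtain n where n: "{s. \<forall>k<n. k \<in> bits s \<longleftrightarrow> k \<in> bits (permute_bits \<tau> g r)} \<subseteq> U"
      using U unfolding openin_cantor_top by blast
    \<comment> \<open>This exceeds every index \<open>\<tau> g k\<close> with k < n. For n = 0 the
      maximum of the empty set does no harm, since then no digit is constrained.\<close>
    define n' where "n' = Suc (Max (\<tau> g ` {..<n}))"
    have "\<tau> g k < n'" if "k < n" for k
      using that by (auto simp: n'_def less_Suc_eq_le intro!: Max_ge)
    then have "{s. \<forall>k<n'. k \<in> bits s \<longleftrightarrow> k \<in> bits r} \<subseteq> {r \<in> topspace cantor_top. permute_bits \<tau> g r \<in> U}"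
      using n by (auto intro!: subsetD[OF n])
    then show "\<exists>n. {s. \<forall>k<n. k \<in> bits s \<longleftrightarrow> k \<in> bits r} \<subseteq> {r \<in> topspace cantor_top. permute_bits \<tau> g r \<in> U}"
      by blast
  qed
qed simp

context random_walk
begin

text \<open>The order of composition makes \<tau> a right action on indices:
  \<open>permute_bits\<close> reads digits through \<tau>, which turns it into a left action on
  points.\<close>

definition permutation_action :: "('g \<Rightarrow> nat \<Rightarrow> nat) \<Rightarrow> bool" where
  "permutation_action \<tau> \<longleftrightarrow> (\<forall>k. \<tau> \<one> k = k) \<and>
     (\<forall>g\<in>carrier G. \<forall>h\<in>carrier G. \<forall>k. \<tau> (g \<otimes> h) k = \<tau> h (\<tau> g k))"

context
  fixes \<tau> :: "'g \<Rightarrow> nat \<Rightarrow> nat" and m :: "real measure" and Z :: "('g, real) gspace"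
  assumes \<tau>: "permutation_action \<tau>"
    and prob_m: "prob_space m" and sets_m: "sets m = sets cantor"
    and Z_def: "Z = \<lparr>msr = m, act = permute_bits \<tau>\<rparr>"
begin

private lemma sp: "space m = UNIV"
  using sets_eq_imp_space_eq[OF sets_m] by simp

lemma group_action_permute_bits: "group_action G UNIV (permute_bits \<tau>)"
proof -
  have one: "permute_bits \<tau> \<one> r = r" for r
    unfolding bits_eq_iff[symmetric] using \<tau> by (auto simp: permutation_action_def)
  have mult: "permute_bits \<tau> (g \<otimes> h) r = permute_bits \<tau> g (permute_bits \<tau> h r)"
    if "g \<in> carrier G" "h \<in> carrier G" for g h r
    unfolding bits_eq_iff[symmetric] using \<tau> that by (auto simp: permutation_action_def)
  have bij: "bij (permute_bits \<tau> g)" if "g \<in> carrier G" for g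
  proof (rule o_bij)
    show "permute_bits \<tau> (inv g) \<circ> permute_bits \<tau> g = id"
      using that by (simp add: fun_eq_iff mult[symmetric] one)
    show "permute_bits \<tau> g \<circ> permute_bits \<tau> (inv g) = id"
      using that by (simp add: fun_eq_iff mult[symmetric] one)
  qed
  have "permute_bits \<tau> \<in> hom G (BijGroup UNIV)"
    using bij mult by (auto simp: hom_def BijGroup_def Bij_def extensional_def compose_def fun_eq_iff)
  then show ?thesis
    unfolding group_action_def group_hom_def group_hom_axioms_def
    using group_BijGroup group_axioms by blast
qed

lemma measured_gspace_permute_bits:
  assumes "\<And>g N. g \<in> carrier G \<Longrightarrow> N \<in> null_sets m \<Longrightarrow> measure m (permute_bits \<tau> g -` N) = 0"
  shows "measured_gspace G Z"
proof -
  interpret prob_space m by (rule prob_m)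
  note meas = permute_bits_measurable[OF sets_m, of \<tau>]
  have "absolutely_continuous m (distr m m (permute_bits \<tau> g))" if g: "g \<in> carrier G" for g
    unfolding absolutely_continuous_def
  proof
    fix N assume N: "N \<in> null_sets m"
    then have "N \<in> sets m" by blast
    then have "emeasure (distr m m (permute_bits \<tau> g)) N = emeasure m (permute_bits \<tau> g -` N)"
      using meas by (simp add: emeasure_distr sp)
    also have "\<dots> = 0" using assms[OF g N] by (simp add: emeasure_eq_measure)
    finally show "N \<in> null_sets (distr m m (permute_bits \<tau> g))"
      using \<open>N \<in> sets m\<close> by (simp add: null_sets_def)
  qed
  then show ?thesis
    using meas standard_borel_cantor[OF sets_m] prob_m group_action_permute_bits
    by (simp add: measured_gspace_def Z_def sp translate_def)
qed

text \<open>The Cantor topology itself is a compact model, as permuting coordinates is continuous.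
  The limit point has digit k exactly if the transform of \<open>digit k\<close> tends to 1.
  Cylinders are finite intersections of digit sets and their complements, so the 0-1 property of
  digits is enough.\<close>

lemma proximal_permute_bits:
  assumes mZ: "measured_gspace G Z" and zo: "\<And>k. zero_one (poisson Z (digit k))"
  shows "proximal G \<mu> Z"
proof -
  have cm: "compact_model G Z cantor_top"
    unfolding compact_model_def using mZ compact_space_cantor_top metrizable_space_cantor_top
    by (simp add: Z_def sp sets_m borel_sets_cantor_top continuous_permute_bits)
  have iso: "isomorphic_gspaces G Z Z"
    unfolding isomorphic_gspaces_def factor_map_def
    by (intro exI[of _ "\<lambda>x. x"]) (simp add: distr_id2)
  have DS: "digit k \<in> sets (msr Z)" for k by (simp add: Z_def sets_m)
  have "AE w in \<Omega>. \<forall>k. (\<lambda>n. poisson Z (digit k) (W w n)) \<longlonglongrightarrow> 0 \<or> (\<lambda>n. poisson Z (digit k) (W w n)) \<longlonglongrightarrow> 1"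
    using zo by (simp add: AE_all_countable zero_one_def)
  then have "AE w in \<Omega>. \<exists>y\<in>topspace cantor_top.
      weak_star_limit cantor_top (\<lambda>n. translate Z (walk G w n)) (return (msr Z) y)"
    using AE_walk_eq_W
  proof eventually_elim
    case (elim w)
    define y where "y = inv_into UNIV bits {k. (\<lambda>n. poisson Z (digit k) (W w n)) \<longlonglongrightarrow> 1}"
    define D where "D k = (if k \<in> bits y then digit k else UNIV - digit k)" for k
    have DD: "D k \<in> sets (msr Z)" for k
      using DS[of k] sets.compl_sets[OF DS[of k]] by (simp add: D_def Z_def sp)
    have D1: "(\<lambda>n. poisson Z (D k) (W w n)) \<longlonglongrightarrow> 1" for k
    proof (cases "k \<in> bits y")
      case True
      then show ?thesis by (simp add: D_def y_def)
    next
      case False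
      then have "(\<lambda>n. poisson Z (digit k) (W w n)) \<longlonglongrightarrow> 0" using elim(1) by (auto simp: y_def)
      from tendsto_diff[OF tendsto_const[of 1] this] have "(\<lambda>n. 1 - poisson Z (digit k) (W w n)) \<longlonglongrightarrow> 1" by simp
      moreover have "poisson Z (D k) (W w n) = 1 - poisson Z (digit k) (W w n)" for n
        using False poisson_Compl[OF mZ DS[of k] W_closed, of w n] by (simp add: D_def Z_def sp)
      ultimately show ?thesis by simp
    qed
    have C: "(\<Inter>k<n. D k) \<inter> UNIV \<in> sets (msr Z) \<and>
      (\<lambda>i. poisson Z ((\<Inter>k<n. D k) \<inter> UNIV) (W w i)) \<longlonglongrightarrow> 1" for n
    proof (induction n)
      case 0
      have "poisson Z UNIV (W w i) = 1" for i
        using prob_space.prob_space[OF prob_m] by (simp add: poisson_def Z_def sp)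
      then show ?case using sets.top[of m] by (simp add: Z_def sp)
    next
      case (Suc n)
      have eq: "(\<Inter>k<Suc n. D k) \<inter> UNIV = ((\<Inter>k<n. D k) \<inter> UNIV) \<inter> D n"
        by (auto simp: lessThan_Suc)
      have "(\<lambda>i. poisson Z (((\<Inter>k<n. D k) \<inter> UNIV) \<inter> D n) (W w i)) \<longlonglongrightarrow> 1 * 1"
        using Suc DD D1 by (intro poisson_Int_tendsto[OF mZ]) auto
      then show ?case unfolding eq using Suc DD by auto
    qed
    have "weak_star_limit cantor_top (\<lambda>n. translate Z (W w n)) (return (msr Z) y)"
      unfolding weak_star_limit_def
    proof (intro allI impI)
      fix f assume f: "continuous_map cantor_top euclideanreal f"
      have fm: "f \<in> borel_measurable (msr Z)" by (rule compact_model_continuous_measurable[OF cm f])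
      have "compact (f ` UNIV)"
        using image_compactin[OF _ f, of UNIV] compact_space_cantor_top by (simp add: compact_space_def)
      then obtain K where K: "\<And>x. \<bar>f x\<bar> \<le> K"
        using compact_imp_bounded[of "range f"] unfolding bounded_iff by auto
      have "(\<integral>x. f x \<partial>return (msr Z) y) = f y"
        using fm by (intro integral_return) (simp add: Z_def sp)
      moreover have "(\<lambda>n. \<integral>x. f x \<partial>translate Z (W w n)) \<longlonglongrightarrow> f y"
      proof (rule LIMSEQ_I)
        fix e :: real assume e: "e > 0"
        have "openin cantor_top {r \<in> topspace cantor_top. f r \<in> ball (f y) (e/2)}"
          by (rule openin_continuous_map_preimage[OF f]) simp
        moreover have "y \<in> {r \<in> topspace cantor_top. f r \<in> ball (f y) (e/2)}" using e by simp
        ultimately obtain n where n: "{s. \<forall>k<n. k \<in> bits s \<longleftrightarrow> k \<in> bits y} \<subseteq> {r \<in> topspace cantor_top. f r \<in> ball (f y) (e/2)}"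
          unfolding openin_cantor_top by blast
        define E where "E = (\<Inter>k<n. D k) \<inter> UNIV"
        have E: "E \<in> sets (msr Z)" "(\<lambda>i. poisson Z E (W w i)) \<longlonglongrightarrow> 1" using C[of n] by (auto simp: E_def)
        have "E \<subseteq> {s. \<forall>k<n. k \<in> bits s \<longleftrightarrow> k \<in> bits y}"
          by (auto simp: E_def D_def digit_def split: if_splits)
        then have fE: "\<bar>f x - f y\<bar> < e/2" if "x \<in> E" for x
          using subsetD[OF n subsetD[OF _ that]] by (simp add: dist_real_def abs_minus_commute)
        \<comment> \<open>On the cylinder E the function stays within e/2 of f y, elsewhere within 2
          * K; the mass outside E tends to 0.\<close>
        have bound: "\<bar>f x - f y\<bar> \<le> e/2 + 2 * K * (1 - indicator E x)" for x
        proof (cases "x \<in> E")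
          case True
          then show ?thesis using fE by (simp add: less_imp_le)
        next
          case False
          then show ?thesis using K[of x] K[of y] e by simp
        qed
        have le: "\<bar>(\<integral>x. f x \<partial>translate Z (W w i)) - f y\<bar> \<le> e/2 + 2 * K * (1 - poisson Z E (W w i))" for i
        proof -
          interpret t: prob_space "translate Z (W w i)" by (rule prob_space_translate[OF mZ W_closed])
          have ev: "t.events = sets (msr Z)" by (simp add: translate_def)
          have fm': "f \<in> borel_measurable (translate Z (W w i))"
            using fm by (simp cong: measurable_cong_sets add: ev)
          have int: "integrable (translate Z (W w i)) f"
            using K fm' by (intro t.integrable_const_bound[where B = K]) auto
          have intE: "integrable (translate Z (W w i)) (\<lambda>x. indicator E x :: real)"
            using E(1) ev by (intro integrable_real_indicator) (auto simp: t.emeasure_eq_measure)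
          have "\<bar>(\<integral>x. f x \<partial>translate Z (W w i)) - f y\<bar> = \<bar>\<integral>x. (f x - f y) \<partial>translate Z (W w i)\<bar>"
            using int by (simp add: t.prob_space)
          also have "\<dots> \<le> (\<integral>x. \<bar>f x - f y\<bar> \<partial>translate Z (W w i))"
            by (rule integral_abs_bound)
          also have "\<dots> \<le> (\<integral>x. e/2 + 2 * K * (1 - indicator E x) \<partial>translate Z (W w i))"
            using int intE bound by (intro integral_mono) auto
          also have "\<dots> = e/2 + 2 * K * (1 - poisson Z E (W w i))"
            using intE E(1) ev by (simp add: t.prob_space poisson_eq[OF mZ] )
          finally show ?thesis .
        qed
        have "(\<lambda>i. e/2 + 2 * K * (1 - poisson Z E (W w i))) \<longlonglongrightarrow> e/2 + 2 * K * (1 - 1)"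
          by (intro tendsto_intros E)
        then have "eventually (\<lambda>i. e/2 + 2 * K * (1 - poisson Z E (W w i)) < e) sequentially"
          using order_tendstoD(2)[of _ _ sequentially e] e by fastforce
        then have "eventually (\<lambda>i. norm ((\<integral>x. f x \<partial>translate Z (W w i)) - f y) < e) sequentially"
          by eventually_elim (use le in \<open>auto intro: le_less_trans\<close>)
        then show "\<exists>no. \<forall>i\<ge>no. norm ((\<integral>x. f x \<partial>translate Z (W w i)) - f y) < e"
          by (simp add: eventually_sequentially)
      qed
      ultimately show "(\<lambda>n. \<integral>x. f x \<partial>translate Z (W w n)) \<longlonglongrightarrow> (\<integral>x. f x \<partial>return (msr Z) y)" by simp
    qed
    then show ?case using elim(2) by auto
  qed
  then show ?thesis unfolding proximal_def using cm iso by blast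
qed

end


section \<open>Realizing an invariant sigma-algebra as a boundary\<close>

lemma subfield_invariant_algebra:
  assumes "measured_gspace G X" "invariant_algebra X F"
  shows "prob_space.subfield (msr X) F"
  using assms by (simp add: prob_space.subfield_def[OF prob_space_msr] invariant_algebra_def)

lemma invariant_algebra_AE:
  assumes mX: "measured_gspace G X" and F: "invariant_algebra X F" and "C \<in> F" "A \<in> sets (msr X)"
    and "AE x in msr X. x \<in> A \<longleftrightarrow> x \<in> C"
  shows "A \<in> F"
  using prob_space.subfield_AE_mem[OF prob_space_msr[OF mX] subfield_invariant_algebra[OF mX F]] assms(2-)
  by (auto simp: invariant_algebra_def)

text \<open>Approximants with geometric errors have a lower limit in F that agrees with A almost
  everywhere; completeness of F finishes.\<close>

lemma invariant_algebra_closed: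
  assumes mX: "measured_gspace G X" and F: "invariant_algebra X F" and A: "A \<in> sets (msr X)"
    and close: "\<And>\<epsilon>. 0 < \<epsilon> \<Longrightarrow> \<exists>C\<in>F. measure (msr X) (sym_diff A C) < \<epsilon>"
  shows "A \<in> F"
proof -
  interpret prob_space "msr X" using prob_space_msr[OF mX] .
  interpret F: sigma_algebra "space (msr X)" F using F by (simp add: invariant_algebra_def)
  have "\<exists>C\<in>F. prob (sym_diff A C) < (1/2)^n" for n :: nat by (intro close) simp
  then obtain C where C: "\<And>n::nat. C n \<in> F" "\<And>n. prob (sym_diff A (C n)) < (1/2)^n" by metis
  have CS: "C n \<in> events" for n using F C(1) by (auto simp: invariant_algebra_def)
  have "(\<Union>n. \<Inter>m. C (n + m)) \<in> F" using C(1) by (intro F.countable_UN F.countable_INT) auto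
  then show ?thesis
    using AE_eventually_mem_iff[OF A CS C(2)] by (intro invariant_algebra_AE[OF mX F _ A])
qed

text \<open>The coordinate that carries the p-translate of the n-th basic set or function.\<close>

definition index :: "nat \<Rightarrow> 'g \<Rightarrow> nat" where
  "index n p = prod_encode (n, to_nat_on (carrier G) p)"

definition indices :: "nat set" where
  "indices = {index n p | n p. p \<in> carrier G}"

definition index_fst :: "nat \<Rightarrow> nat" where
  "index_fst k = fst (prod_decode k)"

definition index_snd :: "nat \<Rightarrow> 'g" where
  "index_snd k = inv_into (carrier G) (to_nat_on (carrier G)) (snd (prod_decode k))"

lemma index_simps [simp]:
  "index_fst (index n p) = n" "p \<in> carrier G \<Longrightarrow> index_snd (index n p) = p"
  "p \<in> carrier G \<Longrightarrow> index n p \<in> indices"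
  using countable_carrier inj_on_to_nat_on[of "carrier G"]
  by (auto simp: index_fst_def index_snd_def index_def indices_def)

lemma indices_cases:
  assumes "k \<in> indices"
  obtains n p where "p \<in> carrier G" "k = index n p"
  using assms by (auto simp: indices_def)

text \<open>A translation by g multiplies the group part of a code by g on the right. If the carrier
  is finite, some numbers code no pair; they are left fixed.\<close>

definition index_action :: "'g \<Rightarrow> nat \<Rightarrow> nat" where
  "index_action g k = (if k \<in> indices then index (index_fst k) (index_snd k \<otimes> g) else k)"

lemma index_action_index: "p \<in> carrier G \<Longrightarrow> index_action g (index n p) = index n (p \<otimes> g)"
  by (simp add: index_action_def)

lemma permutation_action_index: "permutation_action index_action"
  unfolding permutation_action_def
proof (intro conjI allI ballI)
  show "index_action \<one> k = k" for k
    by (cases "k \<in> indices") (auto elim!: indices_cases simp: index_action_index, simp add: index_action_def)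
  show "index_action (g \<otimes> h) k = index_action h (index_action g k)"
    if "g \<in> carrier G" "h \<in> carrier G" for g h k
    using that
    by (cases "k \<in> indices") (auto elim!: indices_cases simp: index_action_index m_assoc, simp add: index_action_def)
qed

lemma trace_algebraI:
  "corr X A Y B \<Longrightarrow> A \<in> trace_algebra X Y"
  by (auto simp: trace_algebra_def)

text \<open>Mackey's point realization: coding \<open>x\<close> by the translates of countably many sets that contain it
  maps \<open>X\<close> equivariantly onto a Cantor space on which the group permutes the coordinates.\<close>

theorem point_realization:
  assumes X: "zero_one_space X" and F: "invariant_algebra X F"
  obtains Z :: "('g, real) gspace" where "boundary G \<mu> Z" "factors X Z" "trace_algebra X Z = F"
proof -
  note mX = stationary_measured[OF zero_one_stationary[OF X]]
  interpret prob_space "msr X" using prob_space_msr[OF mX] .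
  interpret F: sigma_algebra "space (msr X)" F using F by (simp add: invariant_algebra_def)
  have FS: "F \<subseteq> events" and Fnull: "null_sets (msr X) \<subseteq> F"
    and Fpull: "\<And>g A. g \<in> carrier G \<Longrightarrow> A \<in> F \<Longrightarrow> pull X g A \<in> F"
    using F by (auto simp: invariant_algebra_def)
  obtain B and \<psi> :: "real \<Rightarrow> 'a" where B: "\<And>k::nat. B k \<in> events" and \<psi>: "\<psi> \<in> measurable cantor (msr X)"
    and \<psi>_code: "\<And>x. x \<in> space (msr X) \<Longrightarrow> \<psi> (code B x) = x"
    using separating_coding[OF mX] by metis
  \<comment> \<open>F lies in a countably generated sigma-algebra, which is what yields a countable
    subfamily of F that is dense in measure. F itself, being complete, need not be countably
    generated.\<close>
  have sub: "F \<subseteq> sigma_sets (space (msr X)) (range B)"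
  proof
    fix A assume "A \<in> F"
    then have A: "A \<in> events" using FS by blast
    have "\<psi> -` A \<in> sigma_sets UNIV (range digit)"
      using measurable_sets[OF \<psi> A] by (simp add: sets_cantor)
    then have "code B -` (\<psi> -` A) \<inter> space (msr X) \<in> {code B -` E \<inter> space (msr X) |E. E \<in> sigma_sets UNIV (range digit)}"
      by blast
    also have "\<dots> = sigma_sets (space (msr X)) {code B -` E \<inter> space (msr X) |E. E \<in> range digit}"
      by (rule sigma_sets_vimage_commute) simp
    also have "\<dots> \<subseteq> sigma_sets (space (msr X)) (range B)"
    proof (rule sigma_sets_mono', clarify)
      fix k
      have "code B -` digit k \<inter> space (msr X) = B k"
        using sets.sets_into_space[OF B] by (auto simp: digit_def)
      then show "code B -` digit k \<inter> space (msr X) \<in> range B" by simp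
    qed
    finally have "code B -` (\<psi> -` A) \<inter> space (msr X) \<in> sigma_sets (space (msr X)) (range B)" .
    moreover have "code B -` (\<psi> -` A) \<inter> space (msr X) = A"
      using sets.sets_into_space[OF A] by (auto simp: \<psi>_code)
    ultimately show "A \<in> sigma_sets (space (msr X)) (range B)" by simp
  qed
  have "F \<noteq> {}" using F.empty_sets by blast
  then obtain D :: "nat \<Rightarrow> 'a set" where D: "range D \<subseteq> F"
    and dense: "\<And>S \<epsilon>. S \<in> F \<Longrightarrow> 0 < \<epsilon> \<Longrightarrow> \<exists>k. prob (sym_diff S (D k)) < \<epsilon>"
    by (rule countable_dense_subfamily[OF B sub]) (rule that)
  have DF: "D n \<in> F" for n using D by blast
  define E where "E k = (if k \<in> indices then pull X (index_snd k) (D (index_fst k)) else {})" for k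
  have Ei: "E (index n p) = pull X p (D n)" if "p \<in> carrier G" for n p
    using that by (simp add: E_def)
  have EF: "E k \<in> F" for k
  proof (cases "k \<in> indices")
    case True
    then obtain n p where "p \<in> carrier G" "k = index n p" by (rule indices_cases)
    then show ?thesis using Ei Fpull DF by simp
  qed (simp add: E_def)
  have ES: "E k \<in> events" for k using EF FS by blast
  have E_act: "E (index_action g k) = pull X g (E k)" if "g \<in> carrier G" for g k
  proof (cases "k \<in> indices")
    case True
    then obtain n p where "p \<in> carrier G" "k = index n p" by (rule indices_cases)
    then show ?thesis using that by (simp only: index_action_index Ei m_closed pull_mult[OF mX])
  qed (simp add: E_def index_action_def)
  define \<phi> where "\<phi> = code E"
  have \<phi>: "\<phi> \<in> measurable (msr X) cantor" unfolding \<phi>_def by (rule code_measurable[OF ES])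
  define m where "m = distr (msr X) cantor \<phi>"
  define Z :: "('g, real) gspace" where "Z = \<lparr>msr = m, act = permute_bits index_action\<rparr>"
  have prob_m: "prob_space m" unfolding m_def by (rule prob_space_distr[OF \<phi>])
  have sets_m: "sets m = sets cantor" by (simp add: m_def)
  have equi: "\<phi> (act X g x) = permute_bits index_action g (\<phi> x)" if "g \<in> carrier G" "x \<in> space (msr X)" for g x
    unfolding bits_eq_iff[symmetric] using that by (auto simp: \<phi>_def E_act)
  note Zl = permutation_action_index prob_m sets_m Z_def
  have mZ: "measured_gspace G Z"
  proof (rule measured_gspace_permute_bits[OF Zl])
    fix g N assume g: "g \<in> carrier G" and N: "N \<in> null_sets m"
    have NS: "N \<in> sets cantor" using N sets_m by blast
    have pN: "permute_bits index_action g -` N \<in> sets cantor"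
      using measurable_sets[OF permute_bits_measurable[OF refl] NS] by simp
    have "\<phi> -` N \<inter> space (msr X) \<in> null_sets (msr X)"
      using N unfolding m_def null_sets_distr_iff[OF \<phi>] by blast
    from poisson_null[OF mX this g] have "poisson X (\<phi> -` N \<inter> space (msr X)) g = 0" .
    moreover have "measure m (permute_bits index_action g -` N) = poisson X (\<phi> -` N \<inter> space (msr X)) g"
      unfolding m_def measure_distr[OF \<phi> pN] poisson_def
      by (rule arg_cong[of _ _ prob]) (auto simp: equi[OF g] act_closed[OF mX g])
    ultimately show "measure m (permute_bits index_action g -` N) = 0" by simp
  qed
  have msrZ: "msr Z = m" by (simp add: Z_def)
  have "distr (msr X) (msr Z) \<phi> = distr (msr X) cantor \<phi>"
    by (rule distr_cong) (simp_all add: msrZ sets_m)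
  then have fac: "factor_map G X Z \<phi>"
    using \<phi> equi by (auto simp: factor_map_def msrZ m_def Z_def cong: measurable_cong_sets)
  note fc = factor_map_corr[OF mX mZ fac]
  have zoZ: "zero_one_space Z" using fc by (intro zero_one_space_if_corr[OF X mZ]) blast
  have "zero_one (poisson Z (digit k))" for k
    using zoZ by (simp add: zero_one_space_def msrZ sets_m)
  from proximal_permute_bits[OF Zl mZ this] have bZ: "boundary G \<mu> Z"
    using zero_one_stationary[OF zoZ] by (simp add: boundary_def)
  have inv: "invariant_algebra X (trace_algebra X Z)" by (rule invariant_algebra_trace[OF X zoZ])
  \<comment> \<open>A set of Z corresponds to its preimage under \<phi>, which lies in F because all
    digit sets of \<phi> do. Any other partner differs from it by a null set.\<close>
  have "trace_algebra X Z \<subseteq> F"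
  proof
    fix A assume "A \<in> trace_algebra X Z"
    then obtain C where c: "corr X A Z C" by (auto simp: trace_algebra_def)
    then have CS: "C \<in> sets (msr Z)" and AS: "A \<in> events" by (auto simp: corr_def)
    have ae: "AE x in msr X. x \<in> A \<longleftrightarrow> x \<in> \<phi> -` C \<inter> space (msr X)"
      by (rule corr_AE_eq[OF X corr_trans[OF c corr_sym[OF fc[OF CS]]]])
    have "\<phi> \<in> measurable (sigma (space (msr X)) F) cantor"
      unfolding \<phi>_def using EF by (intro code_measurable) simp
    from measurable_sets[OF this, of C] have "\<phi> -` C \<inter> space (msr X) \<in> F"
      using CS F.space_closed by (simp add: msrZ sets_m space_measure_of)
    then show "A \<in> F" by (rule invariant_algebra_AE[OF mX F _ AS ae])
  qed
  \<comment> \<open>The dense sets \<open>D n\<close> are the digits with the identity as group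
    part, and a trace algebra is closed under approximation in measure.\<close>
  moreover have "F \<subseteq> trace_algebra X Z"
  proof
    fix A assume A: "A \<in> F"
    have "D n \<in> trace_algebra X Z" for n
    proof (rule trace_algebraI)
      have DS: "D n \<in> events" using DF FS by blast
      have "\<phi> -` digit (index n \<one>) \<inter> space (msr X) = E (index n \<one>) \<inter> space (msr X)"
        by (auto simp: \<phi>_def digit_def)
      also have "\<dots> = D n"
        unfolding Ei[OF one_closed] pull_one[OF mX DS] using sets.sets_into_space[OF DS] by blast
      finally have "\<phi> -` digit (index n \<one>) \<inter> space (msr X) = D n" .
      then show "corr X (D n) Z (digit (index n \<one>))"
        using fc[of "digit (index n \<one>)"] by (simp add: msrZ sets_m)
    qed
    then show "A \<in> trace_algebra X Z"
      using dense[OF A] A FS by (intro invariant_algebra_closed[OF mX inv]) blast+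
  qed
  ultimately show ?thesis using that bZ fac by blast
qed

end

section \<open>Entropy of factors\<close>

context random_walk
begin

definition rho :: "('g, 'x) gspace \<Rightarrow> 'g \<Rightarrow> 'x \<Rightarrow> real" where
  "rho X g x = enn2real (RN_deriv (msr X) (translate X (inv g)) x)"

lemma rho_density:
  assumes mX: "measured_gspace G X" and g: "g \<in> carrier G"
  shows "integrable (msr X) (rho X g)"
    and "A \<in> sets (msr X) \<Longrightarrow> (\<integral>x\<in>A. rho X g x \<partial>msr X) = poisson X A (inv g)"
proof -
  interpret prob_space "msr X" by (rule prob_space_msr[OF mX])
  have g': "inv g \<in> carrier G" using g by simp
  interpret t: prob_space "translate X (inv g)" by (rule prob_space_translate[OF mX g'])
  let ?R = "RN_deriv (msr X) (translate X (inv g))"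
  have ac: "absolutely_continuous (msr X) (translate X (inv g))"
    using mX g' by (simp add: measured_gspace_def)
  have ev: "sets (translate X (inv g)) = events" by (simp add: translate_def)
  have Rm [measurable]: "?R \<in> borel_measurable (msr X)" by simp
  have em: "emeasure (translate X (inv g)) A = (\<integral>\<^sup>+x. ?R x * indicator A x \<partial>msr X)" if "A \<in> events" for A
    using density_RN_deriv[OF ac ev] emeasure_density[OF Rm that] by simp
  have "space (translate X (inv g)) = space (msr X)" by (simp add: translate_def)
  then have "(\<integral>\<^sup>+x. ?R x * indicator (space (msr X)) x \<partial>msr X) = 1"
    using em[OF sets.top] t.emeasure_space_1 by simp
  moreover have "(\<integral>\<^sup>+x. ?R x * indicator (space (msr X)) x \<partial>msr X) = (\<integral>\<^sup>+x. ?R x \<partial>msr X)"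
    by (intro nn_integral_cong) simp
  ultimately have "(\<integral>\<^sup>+x. ?R x \<partial>msr X) \<noteq> \<infinity>" by simp
  \<comment> \<open>The derivative has total mass 1, hence is finite almost everywhere, and
    \<open>enn2real\<close> loses nothing.\<close>
  then have "AE x in msr X. ?R x \<noteq> \<infinity>" by (intro nn_integral_PInf_AE Rm)
  then have eq: "AE x in msr X. ennreal (rho X g x) = ?R x"
    by eventually_elim (simp add: rho_def top.not_eq_extremum)
  have rm [measurable]: "rho X g \<in> borel_measurable (msr X)" unfolding rho_def by measurable
  have nn: "0 \<le> rho X g x" for x by (simp add: rho_def)
  have set_eq: "(\<integral>\<^sup>+x. ennreal (indicator A x * rho X g x) \<partial>msr X) = ennreal (poisson X A (inv g))"
    if A: "A \<in> events" for A
  proof -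
    have "(\<integral>\<^sup>+x. ennreal (indicator A x * rho X g x) \<partial>msr X) = (\<integral>\<^sup>+x. ?R x * indicator A x \<partial>msr X)"
      using eq by (intro nn_integral_cong_AE) (auto elim!: eventually_mono simp: indicator_def)
    then show ?thesis using em[OF A] translate_emeasure[OF mX g' A] by simp
  qed
  have "(\<integral>\<^sup>+x. ennreal (rho X g x) \<partial>msr X) = (\<integral>\<^sup>+x. ennreal (indicator (space (msr X)) x * rho X g x) \<partial>msr X)"
    by (intro nn_integral_cong) simp
  then have "(\<integral>\<^sup>+x. ennreal (rho X g x) \<partial>msr X) < \<infinity>" using set_eq[OF sets.top] by simp
  then show "integrable (msr X) (rho X g)"
    by (intro integrableI_nonneg) (auto simp: nn)
  show "(\<integral>x\<in>A. rho X g x \<partial>msr X) = poisson X A (inv g)" if A: "A \<in> events"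
  proof -
    have "(\<integral>x\<in>A. rho X g x \<partial>msr X) = enn2real (\<integral>\<^sup>+x. ennreal (indicator A x * rho X g x) \<partial>msr X)"
      unfolding set_lebesgue_integral_def using A nn
      by (subst integral_eq_nn_integral) auto
    then show ?thesis using set_eq[OF A] poisson_bounds(1)[OF mX] by simp
  qed
qed

text \<open>A single term of the convolution \<mu> * \<lambda> = \<lambda> is at most the
  whole.\<close>

lemma poisson_le_stationary:
  assumes X: "stationary G \<mu> X" and A: "A \<in> sets (msr X)" and g: "g \<in> set_pmf \<mu>"
  shows "pmf \<mu> g * poisson X A g \<le> measure (msr X) A"
proof -
  note mX = stationary_measured[OF X]
  interpret prob_space "msr X" by (rule prob_space_msr[OF mX])
  have gc: "g \<in> carrier G" using g set_pmf_subset by blast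
  have "ennreal (pmf \<mu> g * poisson X A g) = emeasure (translate X g) A * pmf \<mu> g"
    using translate_emeasure[OF mX gc A] poisson_bounds(1)[OF mX, of A g]
    by (simp add: ennreal_mult' mult.commute)
  also have "\<dots> = (\<integral>\<^sup>+s. emeasure (translate X s) A * indicator {g} s \<partial>measure_pmf \<mu>)"
    by (subst nn_integral_measure_pmf_support[of "{g}"]) auto
  also have "\<dots> \<le> (\<integral>\<^sup>+s. emeasure (translate X s) A \<partial>measure_pmf \<mu>)"
    by (intro nn_integral_mono) (auto simp: indicator_def)
  also have "\<dots> = ennreal (prob A)"
    using X A by (simp add: stationary_def emeasure_eq_measure)
  finally show ?thesis by simp
qed

text \<open>Applied to the pullback of A by \<open>inv g\<close>,
  \<open>poisson_le_stationary\<close> bounds the translate by \<open>inv g\<close> below by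
  \<mu>(g) times \<lambda> on every set, and the density inherits the bound.\<close>

lemma rho_ge:
  assumes X: "stationary G \<mu> X" and g: "g \<in> set_pmf \<mu>"
  shows "AE x in msr X. pmf \<mu> g \<le> rho X g x"
proof -
  note mX = stationary_measured[OF X]
  interpret prob_space "msr X" by (rule prob_space_msr[OF mX])
  have gc: "g \<in> carrier G" using g set_pmf_subset by blast
  note r = rho_density[OF mX gc]
  have "AE x in msr X. 0 \<le> rho X g x - pmf \<mu> g"
  proof (rule density_nonneg)
    show "integrable (msr X) (\<lambda>x. rho X g x - pmf \<mu> g)" using r(1) by simp
    fix A assume A: "A \<in> events"
    have "(\<integral>x\<in>A. rho X g x - pmf \<mu> g \<partial>msr X) = poisson X A (inv g) - pmf \<mu> g * prob A"
    proof -
      have "(\<integral>x\<in>A. rho X g x - pmf \<mu> g \<partial>msr X) = (\<integral>x\<in>A. rho X g x \<partial>msr X) - (\<integral>x\<in>A. pmf \<mu> g \<partial>msr X)"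
        using A r(1) by (intro set_integral_diff integrable_mult_indicator[folded set_integrable_def]) auto
      also have "(\<integral>x\<in>A. pmf \<mu> g \<partial>msr X) = pmf \<mu> g * prob A"
        using A by (simp add: set_lebesgue_integral_def mult.commute)
      finally show ?thesis using r(2)[OF A] by simp
    qed
    moreover have "pmf \<mu> g * prob A \<le> poisson X A (inv g)"
    proof -
      have P: "pull X (inv g) A \<in> events" using pull_sets[OF mX _ A] gc by simp
      have "poisson X (pull X (inv g) A) g = prob A"
        unfolding poisson_def by (simp only: pull_inv(1)[OF mX gc A])
      then show ?thesis using poisson_le_stationary[OF X P g] by (simp add: poisson_def)
    qed
    ultimately show "0 \<le> (\<integral>x\<in>A. rho X g x - pmf \<mu> g \<partial>msr X)" by simp
  qed
  then show ?thesis by eventually_elim simp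
qed

lemma rho_integral:
  assumes mX: "measured_gspace G X" and g: "g \<in> carrier G"
  shows "(\<integral>x. rho X g x \<partial>msr X) = 1"
proof -
  interpret prob_space "msr X" by (rule prob_space_msr[OF mX])
  have "(\<integral>x. rho X g x \<partial>msr X) = (\<integral>x\<in>space (msr X). rho X g x \<partial>msr X)"
    unfolding set_lebesgue_integral_def by (intro Bochner_Integration.integral_cong) auto
  also have "\<dots> = poisson X (space (msr X)) (inv g)" by (rule rho_density(2)[OF mX g sets.top])
  also have "\<dots> = 1" using poisson_Compl[OF mX sets.empty_sets, of "inv g"] g by (simp add: poisson_def)
  finally show ?thesis .
qed

text \<open>Over corresponding sets both densities integrate to the same value of the transform, and
  these integrals characterize the conditional expectation.\<close>

lemma rho_factor:
  assumes X: "zero_one_space X" and Y: "zero_one_space Y" and f: "factor_map G X Y f"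
    and g: "g \<in> carrier G"
  shows "AE x in msr X. prob_space.cexp (msr X) (trace_algebra X Y) (rho X g) x = rho Y g (f x)"
proof -
  note mX = stationary_measured[OF zero_one_stationary[OF X]]
  note mY = stationary_measured[OF zero_one_stationary[OF Y]]
  interpret prob_space "msr X" by (rule prob_space_msr[OF mX])
  have fm: "f \<in> measurable (msr X) (msr Y)" and d: "distr (msr X) (msr Y) f = msr Y"
    using f by (auto simp: factor_map_def)
  note fc = factor_map_corr[OF mX mY f]
  have sF: "subfield (trace_algebra X Y)"
    by (rule subfield_invariant_algebra[OF mX invariant_algebra_trace[OF X Y]])
  note rX = rho_density[OF mX g] and rY = rho_density[OF mY g]
  have rYm: "rho Y g \<in> borel_measurable (msr Y)" using rY(1) by auto
  show ?thesis
  proof (rule cexp_unique[OF sF rX(1)])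
    have "integrable (distr (msr X) (msr Y) f) (rho Y g)" using rY(1) by (simp add: d)
    then show vi: "integrable (msr X) (\<lambda>x. rho Y g (f x))"
      using integrable_distr_eq[OF fm rYm] by simp
    show "(\<lambda>x. rho Y g (f x)) \<in> borel_measurable (sigma (space (msr X)) (trace_algebra X Y))"
      unfolding borel_measurable_subfield_iff[OF sF]
    proof
      fix S :: "real set" assume S: "S \<in> sets borel"
      have "(\<lambda>x. rho Y g (f x)) -` S \<inter> space (msr X) = f -` (rho Y g -` S \<inter> space (msr Y)) \<inter> space (msr X)"
        using measurable_space[OF fm] by auto
      then show "(\<lambda>x. rho Y g (f x)) -` S \<inter> space (msr X) \<in> trace_algebra X Y"
        using trace_algebraI[OF fc[OF measurable_sets[OF rYm S]]] by simp
    qed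
    fix A assume "A \<in> trace_algebra X Y"
    then obtain B where c: "corr X A Y B" by (auto simp: trace_algebra_def)
    then have S: "A \<in> events" "B \<in> sets (msr Y)" by (auto simp: corr_def)
    have "(\<integral>x\<in>A. rho X g x \<partial>msr X) = (\<integral>y\<in>B. rho Y g y \<partial>msr Y)"
      using rX(2)[OF S(1)] rY(2)[OF S(2)] c g by (simp add: corr_def)
    also have "\<dots> = (\<integral>y. indicator B y *\<^sub>R rho Y g y \<partial>distr (msr X) (msr Y) f)"
      by (simp add: d set_lebesgue_integral_def)
    also have "\<dots> = (\<integral>x. indicator B (f x) *\<^sub>R rho Y g (f x) \<partial>msr X)"
      using S(2) rYm by (intro integral_distr[OF fm]) auto
    also have "\<dots> = (\<integral>x\<in>A. rho Y g (f x) \<partial>msr X)"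
      unfolding set_lebesgue_integral_def
    proof (rule integral_cong_AE)
      have "AE x in msr X. x \<in> A \<longleftrightarrow> x \<in> f -` B \<inter> space (msr X)"
        by (rule corr_AE_eq[OF X corr_trans[OF c corr_sym[OF fc[OF S(2)]]]])
      then show "AE x in msr X. indicator B (f x) *\<^sub>R rho Y g (f x) = indicator A x *\<^sub>R rho Y g (f x)"
        using AE_space by eventually_elim (auto simp: indicator_def)
      have [measurable]: "(\<lambda>x. rho Y g (f x)) \<in> borel_measurable (msr X)" using vi by auto
      show "(\<lambda>x. indicator A x *\<^sub>R rho Y g (f x)) \<in> borel_measurable (msr X)" using S(1) by measurable
      show "(\<lambda>x. indicator B (f x) *\<^sub>R rho Y g (f x)) \<in> borel_measurable (msr X)"
        using measurable_compose[OF fm, of "\<lambda>y. indicator B y *\<^sub>R rho Y g y" borel] S(2) rYm by simp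
    qed
    finally show "(\<integral>x\<in>A. rho X g x \<partial>msr X) = (\<integral>x\<in>A. rho Y g (f x) \<partial>msr X)" .
  qed
qed

lemma inner_entropy_factor:
  assumes X: "zero_one_space X" and Y: "zero_one_space Y" and XY: "factors X Y"
    and g: "g \<in> carrier G"
  shows "(\<integral>y. - ln (rho Y g y) \<partial>msr Y) = prob_space.field_entropy (msr X) (trace_algebra X Y) (rho X g)"
proof -
  note mX = stationary_measured[OF zero_one_stationary[OF X]]
  note mY = stationary_measured[OF zero_one_stationary[OF Y]]
  interpret prob_space "msr X" by (rule prob_space_msr[OF mX])
  obtain f where f: "factor_map G X Y f" using XY by blast
  then have fm: "f \<in> measurable (msr X) (msr Y)" and d: "distr (msr X) (msr Y) f = msr Y"
    by (auto simp: factor_map_def)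
  have rYm: "rho Y g \<in> borel_measurable (msr Y)" using rho_density(1)[OF mY g] by auto
  have "(\<integral>y. - ln (rho Y g y) \<partial>msr Y) = (\<integral>y. - ln (rho Y g y) \<partial>distr (msr X) (msr Y) f)"
    by (simp add: d)
  also have "\<dots> = (\<integral>x. - ln (rho Y g (f x)) \<partial>msr X)"
    using rYm by (intro integral_distr[OF fm]) auto
  also have "\<dots> = (\<integral>x. - ln (cexp (trace_algebra X Y) (rho X g) x) \<partial>msr X)"
  proof (rule integral_cong_AE)
    show "AE x in msr X. - ln (rho Y g (f x)) = - ln (cexp (trace_algebra X Y) (rho X g) x)"
      using rho_factor[OF X Y f g] by eventually_elim simp
    show "(\<lambda>x. - ln (rho Y g (f x))) \<in> borel_measurable (msr X)"
      using measurable_compose[OF fm rYm] by measurable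
  qed measurable
  finally show ?thesis by (simp add: field_entropy_def)
qed

lemma AE_increment_carrier: "AE g in measure_pmf \<mu>. g \<in> set_pmf \<mu> \<and> g \<in> carrier G"
  using set_pmf_subset by (intro AE_pmfI) auto

lemma furstenberg_entropy_factor:
  assumes "zero_one_space X" "zero_one_space Y" "factors X Y"
  shows "furstenberg_entropy G \<mu> Y
    = (\<integral>g. prob_space.field_entropy (msr X) (trace_algebra X Y) (rho X g) \<partial>measure_pmf \<mu>)"
  unfolding furstenberg_entropy_def rho_def[symmetric]
proof (rule integral_cong_AE)
  show "AE g in measure_pmf \<mu>. (\<integral>x. - ln (rho Y g x) \<partial>msr Y)
      = prob_space.field_entropy (msr X) (trace_algebra X Y) (rho X g)"
    using AE_increment_carrier
  proof eventually_elim
    case (elim g)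
    then show ?case by (intro inner_entropy_factor[OF assms]) blast
  qed
qed auto

lemma field_entropy_pmf_bounds:
  assumes X: "stationary G \<mu> X" and F: "prob_space.subfield (msr X) F" and g: "g \<in> set_pmf \<mu>"
  shows "0 \<le> prob_space.field_entropy (msr X) F (rho X g)"
    "prob_space.field_entropy (msr X) F (rho X g) \<le> - ln (pmf \<mu> g)"
proof -
  note mX = stationary_measured[OF X]
  have gc: "g \<in> carrier G" using g set_pmf_subset by blast
  have "0 < pmf \<mu> g" using g by (simp add: pmf_positive)
  note * = prob_space.field_entropy_bounds[OF prob_space_msr[OF mX] this rho_density(1)[OF mX gc]
      rho_ge[OF X g] rho_integral[OF mX gc] F]
  show "0 \<le> prob_space.field_entropy (msr X) F (rho X g)"
    "prob_space.field_entropy (msr X) F (rho X g) \<le> - ln (pmf \<mu> g)" using * by blast+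
qed

text \<open>If the densities of the increments are \<open>F\<close>-measurable, a bound \<open>E(1\<^sub>A|F) \<le> c\<close> is inherited by
  the pullbacks of \<open>A\<close> along the walk. For \<open>c < 1\<close> it rules out the limit 1, so \<open>A\<close> is a null set.\<close>

lemma cexp_le_pull:
  assumes X: "stationary G \<mu> X" and F: "invariant_algebra X F" and g: "g \<in> set_pmf \<mu>"
    and r: "AE x in msr X. prob_space.cexp (msr X) F (rho X g) x = rho X g x"
    and A: "A \<in> sets (msr X)"
    and le: "AE x in msr X. prob_space.cexp (msr X) F (indicator A) x \<le> c"
  shows "AE x in msr X. prob_space.cexp (msr X) F (indicator (pull X g A)) x \<le> c"
proof -
  note mX = stationary_measured[OF X]
  interpret prob_space "msr X" by (rule prob_space_msr[OF mX])
  have gc: "g \<in> carrier G" and gi: "inv g \<in> carrier G" using g set_pmf_subset by auto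
  have sF: "subfield F" by (rule subfield_invariant_algebra[OF mX F])
  define B where "B = pull X g A"
  have B: "B \<in> events" unfolding B_def by (rule pull_sets[OF mX gc A])
  have AB: "pull X (inv g) B = A" unfolding B_def by (rule pull_inv(2)[OF mX gc A])
  have ind: "integrable (msr X) (indicator C :: _ \<Rightarrow> real)" if "C \<in> events" for C
    using that by (intro integrable_real_indicator) (auto simp: emeasure_eq_measure)
  define a where "a = cexp F (rho X g)"
  define e where "e = cexp F (indicator B)"
  \<comment> \<open>D is to be shown null. Integrating over D with weight a, that is with the
    density of the translate by \<open>inv g\<close>, turns D \<inter> B into
    \<open>pull X (inv g) D \<inter> A\<close>. There the bound for A applies, because the pullback
    of D lies again in F.\<close>
  define D where "D = {x \<in> space (msr X). c < e x}"
  note rd = rho_density[OF mX gc]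
  have em: "e \<in> borel_measurable (sigma (space (msr X)) F)" unfolding e_def by (rule cexp_measurable_subfield)
  have am: "a \<in> borel_measurable (sigma (space (msr X)) F)" unfolding a_def by (rule cexp_measurable_subfield)
  have "D = e -` {c<..} \<inter> space (msr X)" by (auto simp: D_def)
  then have DF: "D \<in> F" using em by (simp add: borel_measurable_subfield_iff[OF sF])
  then have DE: "D \<in> events" using sF by (auto simp: subfield_def)
  have D'F: "pull X (inv g) D \<in> F" using F DF gi by (simp add: invariant_algebra_def)
  have D'E: "pull X (inv g) D \<in> events" using sF D'F by (auto simp: subfield_def)
  have fm: "(\<lambda>x. indicator D x * a x) \<in> borel_measurable (sigma (space (msr X)) F)"
    using am DF by (intro borel_measurable_times borel_measurable_indicator) (auto simp: sets_subfield[OF sF])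
  have ai: "integrable (msr X) a" unfolding a_def by (rule cexp_integrable[OF sF rd(1)])
  have Dai: "integrable (msr X) (\<lambda>x. indicator D x * a x)"
    using integrable_mult_indicator[OF DE ai] by simp
  have i1: "integrable (msr X) (\<lambda>x. (indicator D x * a x) * indicator B x)"
    using integrable_mult_indicator[OF B Dai] by (simp add: mult.commute)
  note me = cexp_mult_integral[OF sF fm _ i1, folded e_def]
  have "(\<integral>x. (indicator D x * a x) * e x \<partial>msr X) = (\<integral>x. (indicator D x * a x) * indicator B x \<partial>msr X)"
    by (rule me(2)) (use B in auto)
  also have "\<dots> = (\<integral>x\<in>D \<inter> B. rho X g x \<partial>msr X)"
    unfolding set_lebesgue_integral_def
  proof (rule integral_cong_AE)
    show "AE x in msr X. indicator D x * a x * indicator B x = indicator (D \<inter> B) x *\<^sub>R rho X g x"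
      using r by eventually_elim (simp add: a_def indicator_def)
    show "(\<lambda>x. indicator D x * a x * indicator B x) \<in> borel_measurable (msr X)" using i1 by auto
    show "(\<lambda>x. indicator (D \<inter> B) x *\<^sub>R rho X g x) \<in> borel_measurable (msr X)"
      using rd(1) DE B by measurable
  qed
  also have "\<dots> = prob (pull X (inv g) (D \<inter> B))"
    using rd(2)[of "D \<inter> B"] DE B by (simp add: poisson_def)
  also have "pull X (inv g) (D \<inter> B) = pull X (inv g) D \<inter> A" using AB by auto
  also have "prob (pull X (inv g) D \<inter> A) = (\<integral>x\<in>pull X (inv g) D. indicator A x \<partial>msr X)"
    using D'E A by (simp add: set_lebesgue_integral_def indicator_inter_arith[symmetric])
  also have "\<dots> = (\<integral>x\<in>pull X (inv g) D. cexp F (indicator A) x \<partial>msr X)"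
    by (rule cexp_set_integral[OF sF ind[OF A] D'F, symmetric])
  also have "\<dots> \<le> (\<integral>x\<in>pull X (inv g) D. c \<partial>msr X)"
    unfolding set_lebesgue_integral_def
  proof (rule integral_mono_AE)
    show "integrable (msr X) (\<lambda>x. indicator (pull X (inv g) D) x *\<^sub>R cexp F (indicator A) x)"
      by (intro integrable_mult_indicator D'E cexp_integrable[OF sF ind[OF A]])
    show "integrable (msr X) (\<lambda>x. indicator (pull X (inv g) D) x *\<^sub>R c)"
      by (intro integrable_mult_indicator D'E integrable_const)
    show "AE x in msr X. indicator (pull X (inv g) D) x *\<^sub>R cexp F (indicator A) x
        \<le> indicator (pull X (inv g) D) x *\<^sub>R c"
      using le by eventually_elim (simp add: indicator_def)
  qed
  also have "\<dots> = c * prob (pull X (inv g) D)"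
    using D'E by (simp add: set_lebesgue_integral_def mult.commute)
  also have "prob (pull X (inv g) D) = (\<integral>x\<in>D. rho X g x \<partial>msr X)"
    using rd(2)[OF DE] by (simp add: poisson_def)
  also have "\<dots> = (\<integral>x. indicator D x * a x \<partial>msr X)"
    unfolding set_lebesgue_integral_def
  proof (rule integral_cong_AE)
    show "AE x in msr X. indicator D x *\<^sub>R rho X g x = indicator D x * a x"
      using r by eventually_elim (simp add: a_def)
    show "(\<lambda>x. indicator D x *\<^sub>R rho X g x) \<in> borel_measurable (msr X)"
      using rd(1) DE by measurable
    show "(\<lambda>x. indicator D x * a x) \<in> borel_measurable (msr X)" using Dai by auto
  qed
  finally have main: "(\<integral>x. (indicator D x * a x) * e x \<partial>msr X) \<le> c * (\<integral>x. indicator D x * a x \<partial>msr X)" .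
  have i2: "integrable (msr X) (\<lambda>x. (indicator D x * a x) * e x)" by (rule me(1)) (use B in auto)
  \<comment> \<open>The integrand is nonnegative and, by \<open>main\<close>, has an integral that
    is not positive. Since a is positive, it can vanish only where e \<le> c.\<close>
  define d where "d x = (indicator D x * a x) * e x - c * (indicator D x * a x)" for x
  have di: "integrable (msr X) d" unfolding d_def[abs_def] using i2 Dai by simp
  have apos: "AE x in msr X. 0 < a x"
    using r rho_ge[OF X g]
  proof eventually_elim
    case (elim x)
    then show ?case using pmf_positive[OF g] by (simp add: a_def)
  qed
  have dnn: "AE x in msr X. 0 \<le> d x"
    using apos
  proof eventually_elim
    case (elim x)
    have "d x = indicator D x * (a x * (e x - c))" by (simp add: d_def algebra_simps)
    then show ?case using elim by (auto simp: indicator_def D_def)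
  qed
  have "(\<integral>x. d x \<partial>msr X) = (\<integral>x. (indicator D x * a x) * e x \<partial>msr X) - c * (\<integral>x. indicator D x * a x \<partial>msr X)"
    unfolding d_def using i2 Dai by simp
  then have "(\<integral>x. d x \<partial>msr X) = 0"
    using main integral_nonneg_AE[OF dnn] by linarith
  then have "AE x in msr X. d x = 0" using integral_nonneg_eq_0_iff_AE[OF di dnn] by blast
  then have "AE x in msr X. e x \<le> c"
    using apos AE_space
  proof eventually_elim
    case (elim x)
    show ?case
    proof (rule ccontr)
      assume "\<not> e x \<le> c"
      then have "x \<in> D" using elim(3) by (simp add: D_def)
      then have "a x * (e x - c) = 0" using elim(1) by (simp add: d_def algebra_simps)
      then show False using elim(2) \<open>\<not> e x \<le> c\<close> by simp
    qed
  qed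
  then show ?thesis by (simp add: e_def B_def)
qed

lemma null_if_cexp_le:
  assumes X: "zero_one_space X" and F: "invariant_algebra X F"
    and r: "\<And>g. g \<in> set_pmf \<mu> \<Longrightarrow> AE x in msr X. prob_space.cexp (msr X) F (rho X g) x = rho X g x"
    and A: "A \<in> sets (msr X)" and c: "c < 1"
    and le: "AE x in msr X. prob_space.cexp (msr X) F (indicator A) x \<le> c"
  shows "measure (msr X) A = 0"
proof -
  note sX = zero_one_stationary[OF X]
  note mX = stationary_measured[OF sX]
  interpret prob_space "msr X" by (rule prob_space_msr[OF mX])
  have sF: "subfield F" by (rule subfield_invariant_algebra[OF mX F])
  have ind: "integrable (msr X) (indicator C :: _ \<Rightarrow> real)" if "C \<in> events" for C
    using that by (intro integrable_real_indicator) (auto simp: emeasure_eq_measure)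
  have "AE w in \<Omega>. (\<lambda>n. poisson X A (W w n)) \<longlonglongrightarrow> 0"
    using zero_one_spaceD[OF X A] AE_set_pmf
  proof eventually_elim
    case (elim w)
    have le_n: "AE x in msr X. cexp F (indicator (pull X (W w n) A)) x \<le> c" for n
    proof (induction n)
      case 0
      then show ?case using le by (simp add: pull_one[OF mX A] del: vimage_Int)
    next
      case (Suc n)
      have s: "w n \<in> set_pmf \<mu>" "w n \<in> carrier G" using elim(2) set_pmf_subset by auto
      \<comment> \<open>The newest increment is the rightmost factor, so its pullback is applied
        last and the bound passes on one increment at a time.\<close>
      have "pull X (W w (Suc n)) A = pull X (w n) (pull X (W w n) A)"
        using s by (simp only: W_Suc clip_id pull_mult[OF mX W_closed])
      then show ?case
        using cexp_le_pull[OF sX F s(1) r[OF s(1)] pull_sets[OF mX W_closed A] Suc] by simp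
    qed
    have "poisson X A (W w n) \<le> c" for n
    proof -
      have P: "pull X (W w n) A \<in> events" by (rule pull_sets[OF mX W_closed A])
      have "poisson X A (W w n) = (\<integral>x. indicator (pull X (W w n) A) x \<partial>msr X)"
        using P by (simp add: poisson_def)
      also have "\<dots> = (\<integral>x. cexp F (indicator (pull X (W w n) A)) x \<partial>msr X)"
        by (rule cexp_integral[OF sF ind[OF P], symmetric])
      also have "\<dots> \<le> (\<integral>x. c \<partial>msr X)"
        by (intro integral_mono_AE cexp_integrable[OF sF ind[OF P]] integrable_const le_n)
      finally show ?thesis by (simp add: prob_space)
    qed
    moreover obtain a where a: "a = 0 \<or> a = 1" "(\<lambda>n. poisson X A (W w n)) \<longlonglongrightarrow> a" using elim(1) by blast
    ultimately have "a \<le> c" by (intro LIMSEQ_le_const2[OF a(2)]) auto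
    then show ?case using a c by auto
  qed
  then have "poisson X A \<one> = 0" by (intro harmonic_eq_0I harmonic_poisson[OF sX A])
  then show ?thesis by (simp add: poisson_one[OF mX A])
qed

text \<open>On the F-measurable set where E(1_A | F) is at most some c < 1, the part of A is null by
  \<open>null_if_cexp_le\<close>; letting c tend to 1, the conditional expectation is at least 1 on
  A. The same holds for the complement, and the two sum to at most 1, so A is the set where E(1_A |
  F) is at least 1, up to a null set.\<close>

lemma invariant_algebra_eq_sets:
  assumes X: "zero_one_space X" and F: "invariant_algebra X F"
    and r: "\<And>g. g \<in> set_pmf \<mu> \<Longrightarrow> AE x in msr X. prob_space.cexp (msr X) F (rho X g) x = rho X g x"
  shows "F = sets (msr X)"
proof
  note sX = zero_one_stationary[OF X]
  note mX = stationary_measured[OF sX]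
  interpret prob_space "msr X" by (rule prob_space_msr[OF mX])
  have sF: "subfield F" by (rule subfield_invariant_algebra[OF mX F])
  have nF: "null_sets (msr X) \<subseteq> F" using F by (simp add: invariant_algebra_def)
  show "F \<subseteq> events" using sF by (simp add: subfield_def)
  have ind: "integrable (msr X) (indicator C :: _ \<Rightarrow> real)" if "C \<in> events" for C
    using that by (intro integrable_real_indicator) (auto simp: emeasure_eq_measure)
  have ge1: "AE x in msr X. x \<in> A \<longrightarrow> 1 \<le> cexp F (indicator A) x" if A: "A \<in> events" for A
  proof -
    define e where "e = cexp F (indicator A)"
    have em: "e \<in> borel_measurable (sigma (space (msr X)) F)" unfolding e_def by (rule cexp_measurable_subfield)
    have ei: "integrable (msr X) e" unfolding e_def by (rule cexp_integrable[OF sF ind[OF A]])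
    have "AE x in msr X. x \<in> A \<longrightarrow> 1 - inverse (real (Suc k)) < e x" for k
    proof -
      define c where "c = 1 - inverse (real (Suc k))"
      have c: "0 \<le> c" "c < 1" by (auto simp: c_def field_simps)
      define D where "D = {x \<in> space (msr X). e x \<le> c}"
      have "D = e -` {..c} \<inter> space (msr X)" by (auto simp: D_def)
      then have DF: "D \<in> F" using em by (simp add: borel_measurable_subfield_iff[OF sF])
      then have DE: "D \<in> events" using sF by (auto simp: subfield_def)
      have AD: "A \<inter> D \<in> events" using A DE by blast
      have De: "integrable (msr X) (\<lambda>x. indicator D x * e x)"
        using integrable_mult_indicator[OF DE ei] by simp
      have "AE x in msr X. cexp F (indicator (A \<inter> D)) x = indicator D x * e x"
      proof (rule cexp_unique[OF sF ind[OF AD] De])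
        show "(\<lambda>x. indicator D x * e x) \<in> borel_measurable (sigma (space (msr X)) F)"
          using em DF by (intro borel_measurable_times borel_measurable_indicator) (auto simp: sets_subfield[OF sF])
        fix C assume C: "C \<in> F"
        interpret F: sigma_algebra "space (msr X)" F using sF by (simp add: subfield_def)
        have CD: "C \<inter> D \<in> F" using C DF by blast
        have "(\<integral>x\<in>C. indicator (A \<inter> D) x \<partial>msr X) = (\<integral>x\<in>C \<inter> D. indicator A x \<partial>msr X)"
          unfolding set_lebesgue_integral_def
          by (intro Bochner_Integration.integral_cong) (auto simp: indicator_def)
        also have "\<dots> = (\<integral>x\<in>C \<inter> D. e x \<partial>msr X)"
          unfolding e_def by (rule cexp_set_integral[OF sF ind[OF A] CD, symmetric])
        also have "\<dots> = (\<integral>x\<in>C. indicator D x * e x \<partial>msr X)"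
          unfolding set_lebesgue_integral_def
          by (intro Bochner_Integration.integral_cong) (auto simp: indicator_def)
        finally show "(\<integral>x\<in>C. indicator (A \<inter> D) x \<partial>msr X) = (\<integral>x\<in>C. indicator D x * e x \<partial>msr X)" .
      qed
      then have "AE x in msr X. cexp F (indicator (A \<inter> D)) x \<le> c"
        by eventually_elim (use c in \<open>auto simp: indicator_def D_def\<close>)
      from null_if_cexp_le[OF X F r AD c(2) this] have "A \<inter> D \<in> null_sets (msr X)"
        using AD by (auto simp: null_sets_def emeasure_eq_measure)
      from AE_not_in[OF this] show ?thesis
        using AE_space by eventually_elim (auto simp: D_def c_def)
    qed
    then have "AE x in msr X. \<forall>k. x \<in> A \<longrightarrow> 1 - inverse (real (Suc k)) < e x"
      by (simp only: AE_all_countable simp_thms)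
    then show ?thesis
    proof eventually_elim
      case (elim x)
      show ?case
      proof
        assume xA: "x \<in> A"
        have "1 \<le> e x"
        proof (rule ccontr)
          assume "\<not> 1 \<le> e x"
          then obtain k where "inverse (real (Suc k)) < 1 - e x" using reals_Archimedean[of "1 - e x"] by auto
          then show False using elim[rule_format, OF xA, of k] by linarith
        qed
        then show "1 \<le> cexp F (indicator A) x" by (simp add: e_def)
      qed
    qed
  qed
  show "events \<subseteq> F"
  proof
    fix A assume A: "A \<in> events"
    define e where "e = cexp F (indicator A)"
    have em: "e \<in> borel_measurable (sigma (space (msr X)) F)" unfolding e_def by (rule cexp_measurable_subfield)
    have Ac: "space (msr X) - A \<in> events" using A by blast
    have "AE x in msr X. cexp F (\<lambda>x. indicator A x + indicator (space (msr X) - A) x) x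
        = cexp F (indicator A) x + cexp F (indicator (space (msr X) - A)) x"
      by (rule cexp_add[OF sF ind[OF A] ind[OF Ac]])
    moreover have "AE x in msr X. cexp F (\<lambda>x. indicator A x + indicator (space (msr X) - A) x) x \<le> 1"
      by (intro cexp_le[OF sF] Bochner_Integration.integrable_add ind A Ac AE_I2) (auto simp: indicator_def)
    ultimately have "AE x in msr X. x \<in> A \<longleftrightarrow> x \<in> e -` {1..} \<inter> space (msr X)"
      using ge1[OF A] ge1[OF Ac] AE_space
    proof eventually_elim
      case (elim x)
      then show ?case unfolding e_def by (cases "x \<in> A") auto
    qed
    moreover have "e -` {1..} \<inter> space (msr X) \<in> F"
      using em by (simp add: borel_measurable_subfield_iff[OF sF])
    ultimately show "A \<in> F" by (intro subfield_AE_mem[OF sF nF _ A])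
  qed
qed

context
  assumes finite_entropy: "shannon_entropy G \<mu> < \<infinity>"
begin

text \<open>The mean of - ln \<mu>(g) is the Shannon entropy. This function of g dominates the inner
  entropies of all factors.\<close>

lemma integrable_ln_pmf: "integrable (measure_pmf \<mu>) (\<lambda>g. - ln (pmf \<mu> g))"
proof (rule integrableI_nonneg)
  have "(\<integral>\<^sup>+ g. ennreal (- ln (pmf \<mu> g)) \<partial>measure_pmf \<mu>)
      = (\<integral>\<^sup>+ g. ennreal (pmf \<mu> g) * ennreal (- ln (pmf \<mu> g)) \<partial>count_space UNIV)"
    by (rule nn_integral_measure_pmf)
  also have "\<dots> = (\<integral>\<^sup>+ g. ennreal (- ln (pmf \<mu> g) * pmf \<mu> g) * indicator (carrier G) g \<partial>count_space UNIV)"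
  proof (intro nn_integral_cong)
    fix g
    show "ennreal (pmf \<mu> g) * ennreal (- ln (pmf \<mu> g)) = ennreal (- ln (pmf \<mu> g) * pmf \<mu> g) * indicator (carrier G) g"
    proof (cases "g \<in> set_pmf \<mu>")
      case True
      then have "g \<in> carrier G" using set_pmf_subset by blast
      then show ?thesis by (simp add: ennreal_mult'[symmetric] mult.commute)
    next
      case False
      then show ?thesis by (simp add: set_pmf_iff)
    qed
  qed
  also have "\<dots> = shannon_entropy G \<mu>"
    unfolding shannon_entropy_def by (rule nn_integral_count_space_indicator[symmetric]) simp
  finally show "(\<integral>\<^sup>+ g. ennreal (- ln (pmf \<mu> g)) \<partial>measure_pmf \<mu>) < \<infinity>" using finite_entropy by simp
  show "AE g in measure_pmf \<mu>. 0 \<le> - ln (pmf \<mu> g)"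
    using AE_increment_carrier by eventually_elim (simp add: pmf_positive pmf_le_1)
qed simp

lemma integrable_field_entropy:
  assumes X: "stationary G \<mu> X" and F: "prob_space.subfield (msr X) F"
  shows "integrable (measure_pmf \<mu>) (\<lambda>g. prob_space.field_entropy (msr X) F (rho X g))"
proof (rule Bochner_Integration.integrable_bound[OF integrable_ln_pmf])
  show "AE g in measure_pmf \<mu>. norm (prob_space.field_entropy (msr X) F (rho X g)) \<le> norm (- ln (pmf \<mu> g))"
    using AE_increment_carrier
  proof eventually_elim
    case (elim g)
    then show ?case using field_entropy_pmf_bounds[OF X F, of g] by simp
  qed
qed simp

lemma field_entropy_sets:
  assumes X: "stationary G \<mu> X" and g: "g \<in> carrier G"
  shows "prob_space.field_entropy (msr X) (sets (msr X)) (rho X g) = (\<integral>x. - ln (rho X g x) \<partial>msr X)"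
proof -
  note mX = stationary_measured[OF X]
  interpret prob_space "msr X" by (rule prob_space_msr[OF mX])
  note rd = rho_density[OF mX g]
  have rm: "rho X g \<in> borel_measurable (msr X)" using rd(1) by auto
  then have "rho X g \<in> borel_measurable (sigma (space (msr X)) events)"
    by (simp add: borel_measurable_subfield_iff[OF subfield_events] measurable_sets)
  from cexp_id[OF subfield_events rd(1) this]
  show ?thesis unfolding field_entropy_def using rm
    by (intro integral_cong_AE) (auto elim!: eventually_mono)
qed

text \<open>Both entropies are averages over g of terms ordered by Gibbs' inequality, so equal
  averages force equal terms at every g in the support; there the densities are measurable for the
  factor.\<close>

theorem furstenberg_entropy_factor_le:
  assumes X: "zero_one_space X" and Y: "zero_one_space Y" and XY: "factors X Y"
  shows "furstenberg_entropy G \<mu> Y \<le> furstenberg_entropy G \<mu> X"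
    and "furstenberg_entropy G \<mu> Y = furstenberg_entropy G \<mu> X \<Longrightarrow> trace_algebra X Y = sets (msr X)"
proof -
  note sX = zero_one_stationary[OF X]
  note mX = stationary_measured[OF sX]
  interpret prob_space "msr X" by (rule prob_space_msr[OF mX])
  have F: "invariant_algebra X (trace_algebra X Y)" by (rule invariant_algebra_trace[OF X Y])
  have sF: "subfield (trace_algebra X Y)" by (rule subfield_invariant_algebra[OF mX F])
  define a where "a g = field_entropy (trace_algebra X Y) (rho X g)" for g
  define b where "b g = field_entropy events (rho X g)" for g
  have hY: "furstenberg_entropy G \<mu> Y = (\<integral>g. a g \<partial>measure_pmf \<mu>)"
    unfolding a_def by (rule furstenberg_entropy_factor[OF X Y XY])
  have hX: "furstenberg_entropy G \<mu> X = (\<integral>g. b g \<partial>measure_pmf \<mu>)"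
    unfolding b_def using furstenberg_entropy_factor[OF X X factors_refl[OF X]] by (simp add: trace_algebra_self)
  have ai: "integrable (measure_pmf \<mu>) a" unfolding a_def by (rule integrable_field_entropy[OF sX sF])
  have bi: "integrable (measure_pmf \<mu>) b" unfolding b_def by (rule integrable_field_entropy[OF sX subfield_events])
  have ab: "a g \<le> b g" "a g = b g \<Longrightarrow> AE x in msr X. cexp (trace_algebra X Y) (rho X g) x = rho X g x"
    if g: "g \<in> set_pmf \<mu>" for g
  proof -
    have gc: "g \<in> carrier G" using g set_pmf_subset by blast
    note * = field_entropy_le[OF pmf_positive[OF g] rho_density(1)[OF mX gc] rho_ge[OF sX g] rho_integral[OF mX gc] sF]
    show "a g \<le> b g" using *(1) by (simp add: a_def b_def field_entropy_sets[OF sX gc])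
    show "AE x in msr X. cexp (trace_algebra X Y) (rho X g) x = rho X g x" if "a g = b g"
      using *(2) that by (simp add: a_def b_def field_entropy_sets[OF sX gc])
  qed
  have ab_AE: "AE g in measure_pmf \<mu>. 0 \<le> b g - a g" using ab(1) by (intro AE_pmfI) simp
  show "furstenberg_entropy G \<mu> Y \<le> furstenberg_entropy G \<mu> X"
    unfolding hX hY using ab_AE by (intro integral_mono_AE ai bi) simp
  assume "furstenberg_entropy G \<mu> Y = furstenberg_entropy G \<mu> X"
  then have "(\<integral>g. b g - a g \<partial>measure_pmf \<mu>) = 0" using ai bi by (simp add: hX hY)
  then have "AE g in measure_pmf \<mu>. b g - a g = 0"
    using integral_nonneg_eq_0_iff_AE[OF Bochner_Integration.integrable_diff[OF bi ai] ab_AE] by blast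
  then have "\<forall>g\<in>set_pmf \<mu>. a g = b g" by (simp add: AE_measure_pmf_iff)
  then show "trace_algebra X Y = events"
    using ab(2) by (intro invariant_algebra_eq_sets[OF X F]) blast
qed

text \<open>Dominated convergence is available for sequences, so one is extracted from the net: its
  n-th member is close to the limit for the first n+1 entries of an enumeration of the support at
  once. Each g is reached eventually, and - ln \<mu>(g) dominates.\<close>

lemma field_entropy_net:
  assumes X: "stationary G \<mu> X" and sub: "\<And>F. F \<in> \<F> \<Longrightarrow> prob_space.subfield (msr X) F"
    and H: "prob_space.subfield (msr X) H"
    and dir: "\<And>F1 F2. F1 \<in> \<F> \<Longrightarrow> F2 \<in> \<F> \<Longrightarrow> \<exists>F3\<in>\<F>. \<forall>F\<in>\<F>. R F3 F \<longrightarrow> R F1 F \<and> R F2 F"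
    and R: "\<And>F. R F F"
    and conv: "\<And>g. g \<in> set_pmf \<mu> \<Longrightarrow> prob_space.cexp_converges (msr X) R \<F> H (rho X g)"
  shows "\<exists>F. (\<forall>n. F n \<in> \<F>) \<and>
    (\<lambda>n. \<integral>g. prob_space.field_entropy (msr X) (F n) (rho X g) \<partial>measure_pmf \<mu>)
      \<longlonglongrightarrow> (\<integral>g. prob_space.field_entropy (msr X) H (rho X g) \<partial>measure_pmf \<mu>)"
proof -
  note mX = stationary_measured[OF X]
  interpret prob_space "msr X" by (rule prob_space_msr[OF mX])
  \<comment> \<open>For a finite support the enumeration repeats elements, which does no
    harm.\<close>
  define s where "s = from_nat_into (set_pmf \<mu>)"
  have s: "s k \<in> set_pmf \<mu>" for k unfolding s_def by (rule from_nat_into) (rule set_pmf_not_empty)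
  have s_surj: "\<exists>k. s k = g" if "g \<in> set_pmf \<mu>" for g
    unfolding s_def using from_nat_into_surj[OF countable_set_pmf that] by blast
  define L where "L F g = (\<integral>x. \<bar>cexp F (rho X g) x - cexp H (rho X g) x\<bar> \<partial>msr X)" for F g
  have "\<exists>F0\<in>\<F>. \<forall>F\<in>\<F>. R F0 F \<longrightarrow> (\<forall>k\<le>n. L F (s k) < \<epsilon>)" if \<epsilon>: "0 < \<epsilon>" for n \<epsilon>
  proof (induction n)
    case 0
    then show ?case using conv[OF s, unfolded cexp_converges_def, rule_format, OF \<epsilon>] by (simp add: L_def)
  next
    case (Suc n)
    obtain F1 where F1: "F1 \<in> \<F>" "\<And>F. F \<in> \<F> \<Longrightarrow> R F1 F \<Longrightarrow> \<forall>k\<le>n. L F (s k) < \<epsilon>" using Suc by blast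
    obtain F2 where F2: "F2 \<in> \<F>" "\<And>F. F \<in> \<F> \<Longrightarrow> R F2 F \<Longrightarrow> L F (s (Suc n)) < \<epsilon>"
      using conv[OF s, unfolded cexp_converges_def, rule_format, OF \<epsilon>] unfolding L_def by blast
    obtain F3 where F3: "F3 \<in> \<F>" "\<And>F. F \<in> \<F> \<Longrightarrow> R F3 F \<Longrightarrow> R F1 F \<and> R F2 F" using dir[OF F1(1) F2(1)] by blast
    have "\<forall>k\<le>Suc n. L F (s k) < \<epsilon>" if "F \<in> \<F>" "R F3 F" for F
      using F1(2)[OF that(1)] F2(2)[OF that(1)] F3(2)[OF that] by (auto simp: le_Suc_eq)
    then show ?case using F3(1) by blast
  qed
  then have "\<exists>F\<in>\<F>. \<forall>k\<le>n. L F (s k) < inverse (real (Suc n))" for n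
    using R by (meson inverse_positive_iff_positive of_nat_0_less_iff zero_less_Suc)
  then obtain F where F: "\<And>n. F n \<in> \<F>" "\<And>n k. k \<le> n \<Longrightarrow> L (F n) (s k) < inverse (real (Suc n))" by metis
  have "(\<lambda>n. \<integral>g. field_entropy (F n) (rho X g) \<partial>measure_pmf \<mu>) \<longlonglongrightarrow> (\<integral>g. field_entropy H (rho X g) \<partial>measure_pmf \<mu>)"
  proof (rule integral_dominated_convergence[OF _ _ integrable_ln_pmf])
    show "AE g in measure_pmf \<mu>. norm (field_entropy (F n) (rho X g)) \<le> - ln (pmf \<mu> g)" for n
    proof (rule AE_pmfI)
      fix g assume "g \<in> set_pmf \<mu>"
      then show "norm (field_entropy (F n) (rho X g)) \<le> - ln (pmf \<mu> g)"
        using field_entropy_pmf_bounds[OF X sub[OF F(1)[of n]], of g] by simp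
    qed
    show "AE g in measure_pmf \<mu>. (\<lambda>n. field_entropy (F n) (rho X g)) \<longlonglongrightarrow> field_entropy H (rho X g)"
    proof (rule AE_pmfI)
      fix g assume g: "g \<in> set_pmf \<mu>"
      then have gc: "g \<in> carrier G" using set_pmf_subset by blast
      obtain k where k: "s k = g" using s_surj[OF g] by blast
      \<comment> \<open>The constant 1/\<mu>(g) depends on g, so this gives convergence for each g
        separately.\<close>
      have Lip: "\<bar>field_entropy (F n) (rho X g) - field_entropy H (rho X g)\<bar> \<le> L (F n) g / pmf \<mu> g" for n
        unfolding L_def
        by (rule field_entropy_Lipschitz[OF pmf_positive[OF g] rho_density(1)[OF mX gc] rho_ge[OF X g]
              rho_integral[OF mX gc] sub[OF F(1)] H])
      have "(\<lambda>n. field_entropy (F n) (rho X g) - field_entropy H (rho X g)) \<longlonglongrightarrow> 0"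
      proof (rule Lim_null_comparison)
        show "eventually (\<lambda>n. norm (field_entropy (F n) (rho X g) - field_entropy H (rho X g))
            \<le> inverse (real (Suc n)) / pmf \<mu> g) sequentially"
          using eventually_ge_at_top[of k]
        proof eventually_elim
          case (elim n)
          have "L (F n) g / pmf \<mu> g \<le> inverse (real (Suc n)) / pmf \<mu> g"
            using F(2)[OF elim] k by (intro divide_right_mono) auto
          then show ?case using Lip[of n] by simp
        qed
        have "(\<lambda>n. inverse (real (Suc n)) / pmf \<mu> g) \<longlonglongrightarrow> 0 / pmf \<mu> g"
          by (intro tendsto_divide LIMSEQ_inverse_real_of_nat tendsto_const) (use pmf_positive[OF g] in simp)
        then show "(\<lambda>n. inverse (real (Suc n)) / pmf \<mu> g) \<longlonglongrightarrow> 0" by simp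
      qed
      then show "(\<lambda>n. field_entropy (F n) (rho X g)) \<longlonglongrightarrow> field_entropy H (rho X g)"
        by (simp add: LIM_zero_iff)
    qed
  qed auto
  then show ?thesis using F(1) by blast
qed

end

end

section \<open>The Poisson boundary\<close>

context random_walk
begin

lemma case_nat_measurable: "case_nat s \<in> measurable \<Omega> \<Omega>"
  by measurable

text \<open>A null event of paths stays null after fixing the first increment s, since s has
  positive mass.\<close>

lemma AE_first_step:
  assumes P: "AE w in \<Omega>. P w" and s: "s \<in> set_pmf \<mu>"
  shows "AE w in \<Omega>. P (case_nat s w)"
proof -
  obtain N where N: "N \<in> null_sets \<Omega>" "{w \<in> space \<Omega>. \<not> P w} \<subseteq> N"
    using P by (auto simp: eventually_ae_filter)
  have NS [measurable]: "N \<in> sets \<Omega>" using N(1) by blast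
  have "(\<integral>\<^sup>+ s. \<integral>\<^sup>+ w. indicator N (case_nat s w) \<partial>\<Omega> \<partial>measure_pmf \<mu>) = (\<integral>\<^sup>+ w. indicator N w \<partial>\<Omega>)"
    using NS by (intro nn_integral_first_step[symmetric]) simp
  also have "\<dots> = 0" using N(1) by (simp add: null_setsD1)
  finally have "AE s in measure_pmf \<mu>. (\<integral>\<^sup>+ w. indicator N (case_nat s w) \<partial>\<Omega>) = 0"
    by (subst (asm) nn_integral_0_iff_AE) auto
  then have "(\<integral>\<^sup>+ w. indicator N (case_nat s w) \<partial>\<Omega>) = 0"
    using s by (simp add: AE_measure_pmf_iff)
  moreover have "(\<lambda>w. indicator N (case_nat s w) :: ennreal) \<in> borel_measurable \<Omega>"
    using measurable_compose[OF case_nat_measurable borel_measurable_indicator[OF NS]] .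
  ultimately have "AE w in \<Omega>. (indicator N (case_nat s w) :: ennreal) = 0"
    by (subst (asm) nn_integral_0_iff_AE) auto
  then show ?thesis
    using AE_space
  proof eventually_elim
    case (elim w)
    then show ?case using N(2) by (auto simp: indicator_def space_PiM split: if_splits)
  qed
qed

text \<open>For a 0-1 limit this is the event that the limit is 1, and any threshold strictly
  between 0 and 1 would describe it. As \<open>lim\<close> is total, the event is also defined on
  paths without convergence.\<close>

definition hitting :: "('g \<Rightarrow> real) \<Rightarrow> (nat \<Rightarrow> 'g) set" where
  "hitting \<phi> = {w \<in> space \<Omega>. 1/2 < lim (\<lambda>n. \<phi> (W w n))}"

text \<open>The 0-1 limits are required from every starting point, so that translates stay in the
  class.\<close>

definition boundary_functions :: "('g \<Rightarrow> real) set" where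
  "boundary_functions = {\<phi>. harmonic \<phi> \<and> (\<forall>g\<in>carrier G. zero_one (\<lambda>h. \<phi> (g \<otimes> h)))}"

text \<open>The positions of the walk generate a countably generated sigma-algebra that contains all
  hitting events. The full product sigma-algebra may be too large for this, as the type of group
  elements may be uncountable.\<close>

definition cylinders :: "nat \<Rightarrow> (nat \<Rightarrow> 'g) set" where
  "cylinders k = {w \<in> space \<Omega>. W w (index_fst k) = index_snd k}"

lemma cylinders_sets: "cylinders k \<in> sets \<Omega>"
  unfolding cylinders_def by (rule W_pred_measurable)

lemma hitting_sigma: "hitting \<phi> \<in> sigma_sets (space \<Omega>) (range cylinders)"
proof -
  let ?M = "sigma (space \<Omega>) (range cylinders)"
  have sub: "range cylinders \<subseteq> Pow (space \<Omega>)" by (auto simp: cylinders_def)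
  have sM: "sets ?M = sigma_sets (space \<Omega>) (range cylinders)" "space ?M = space \<Omega>"
    using sub by (simp_all add: space_measure_of_conv)
  have "(\<lambda>w. W w n) \<in> measurable ?M (count_space (carrier G))" for n
    unfolding measurable_count_space_eq_countable[OF countable_carrier]
  proof (intro conjI ballI)
    show "(\<lambda>w. W w n) \<in> space ?M \<rightarrow> carrier G" by simp
    fix g assume g: "g \<in> carrier G"
    have "(\<lambda>w. W w n) -` {g} \<inter> space ?M = cylinders (index n g)"
      unfolding sM(2) using g by (auto simp: cylinders_def)
    then show "(\<lambda>w. W w n) -` {g} \<inter> space ?M \<in> sets ?M" by (auto simp: sM)
  qed
  then have "(\<lambda>w. \<phi> (W w n)) \<in> borel_measurable ?M" for n
    by (rule measurable_compose) simp
  then have "(\<lambda>w. lim (\<lambda>n. \<phi> (W w n))) \<in> borel_measurable ?M"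
    by (rule borel_measurable_lim_metric)
  then have "{w \<in> space ?M. 1/2 < lim (\<lambda>n. \<phi> (W w n))} \<in> sets ?M" by measurable
  then show ?thesis by (simp add: hitting_def sM)
qed

lemma hitting_sets [measurable]: "hitting \<phi> \<in> sets \<Omega>"
proof -
  have "sigma_sets (space \<Omega>) (range cylinders) \<subseteq> sets \<Omega>"
    using cylinders_sets by (intro sets.sigma_sets_subset) auto
  then show ?thesis using hitting_sigma by blast
qed

lemma hitting_cong: "(\<And>g. g \<in> carrier G \<Longrightarrow> \<phi> g = \<psi> g) \<Longrightarrow> hitting \<phi> = hitting \<psi>"
  by (simp add: hitting_def)

lemma lim_Suc: "lim (\<lambda>n. f (Suc n)) = lim f"
  unfolding lim_def by (simp add: filterlim_sequentially_Suc)

lemma hitting_case_nat: "case_nat s w \<in> hitting \<phi> \<longleftrightarrow> w \<in> hitting (\<lambda>h. \<phi> (clip s \<otimes> h))"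
proof -
  have "lim (\<lambda>n. \<phi> (W (case_nat s w) n)) = lim (\<lambda>n. \<phi> (W (case_nat s w) (Suc n)))"
    by (rule lim_Suc[symmetric])
  then show ?thesis by (simp add: hitting_def space_PiM W_case_nat)
qed

lemma boundary_function_zero_one: "\<phi> \<in> boundary_functions \<Longrightarrow> zero_one \<phi>"
  using zero_one_cong[of \<phi> "\<lambda>h. \<phi> (\<one> \<otimes> h)"] by (force simp: boundary_functions_def)

lemma boundary_function_shift:
  assumes "\<phi> \<in> boundary_functions" "g \<in> carrier G"
  shows "(\<lambda>h. \<phi> (g \<otimes> h)) \<in> boundary_functions"
  unfolding boundary_functions_def
proof (intro CollectI conjI ballI)
  show "harmonic (\<lambda>h. \<phi> (g \<otimes> h))" using assms by (intro harmonic_shift) (auto simp: boundary_functions_def)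
  fix k assume k: "k \<in> carrier G"
  have "zero_one (\<lambda>h. \<phi> ((g \<otimes> k) \<otimes> h))" using assms k by (auto simp: boundary_functions_def)
  moreover have "zero_one (\<lambda>h. \<phi> ((g \<otimes> k) \<otimes> h)) \<longleftrightarrow> zero_one (\<lambda>h. \<phi> (g \<otimes> (k \<otimes> h)))"
    using assms k by (intro zero_one_cong) (simp add: m_assoc)
  ultimately show "zero_one (\<lambda>h. \<phi> (g \<otimes> (k \<otimes> h)))" by simp
qed

text \<open>Along the walk the bounded values of \<phi> have constant expectation and converge to
  the indicator of the event.\<close>

lemma prob_hitting:
  assumes \<phi>: "\<phi> \<in> boundary_functions"
  shows "measure \<Omega> (hitting \<phi>) = \<phi> \<one>"
proof -
  have h: "harmonic \<phi>" using \<phi> by (simp add: boundary_functions_def)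
  have "(\<lambda>n. \<integral>w. \<phi> (W w n) \<partial>\<Omega>) \<longlonglongrightarrow> (\<integral>w. indicator (hitting \<phi>) w \<partial>\<Omega>)"
  proof (rule integral_dominated_convergence[where w = "\<lambda>_. 1"])
    show "AE w in \<Omega>. (\<lambda>n. \<phi> (W w n)) \<longlonglongrightarrow> indicator (hitting \<phi>) w"
      using boundary_function_zero_one[OF \<phi>] AE_space unfolding zero_one_def
    proof eventually_elim
      case (elim w)
      then show ?case using limI[of "\<lambda>n. \<phi> (W w n)"] by (auto simp: hitting_def indicator_def)
    qed
    show "AE w in \<Omega>. norm (\<phi> (W w n)) \<le> 1" for n using h by (simp add: harmonic_def)
    show "(\<lambda>w. \<phi> (W w n)) \<in> borel_measurable \<Omega>" for n by (rule borel_measurable_W)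
    show "(indicator (hitting \<phi>) :: _ \<Rightarrow> real) \<in> borel_measurable \<Omega>" by simp
    show "integrable \<Omega> (\<lambda>_. 1 :: real)" by (rule increments.P.integrable_const)
  qed
  then show ?thesis using integral_harmonic_W(2)[OF h] by (simp add: LIMSEQ_const_iff)
qed

lemma poisson_boundary_function:
  assumes X: "zero_one_space X" and A: "A \<in> sets (msr X)"
  shows "poisson X A \<in> boundary_functions"
  unfolding boundary_functions_def
proof (intro CollectI conjI ballI)
  note mX = stationary_measured[OF zero_one_stationary[OF X]]
  show "harmonic (poisson X A)" by (rule harmonic_poisson[OF zero_one_stationary[OF X] A])
  fix g assume g: "g \<in> carrier G"
  have "zero_one (poisson X (pull X g A))"
    using X pull_sets[OF mX g A] by (simp add: zero_one_space_def)
  then show "zero_one (\<lambda>h. poisson X A (g \<otimes> h))"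
    using zero_one_cong[of "\<lambda>h. poisson X A (g \<otimes> h)" "poisson X (pull X g A)"] poisson_mult[OF mX g] by blast
qed

text \<open>The Poisson boundary: a point is coded by the countably many boundary functions of a dense
  family that tend to 1 along the walk.\<close>

theorem top_boundary:
  assumes gen: "generating G \<mu>"
  obtains Z :: "('g, real) gspace" where "boundary G \<mu> Z"
    "\<And>Y :: ('g, 'y) gspace. zero_one_space Y \<Longrightarrow> factors Z Y"
proof -
  have "(\<lambda>_. 0) \<in> boundary_functions"
    by (simp add: boundary_functions_def harmonic_def zero_one_def)
  then have ne: "hitting ` boundary_functions \<noteq> {}" by blast
  have "hitting ` boundary_functions \<subseteq> sigma_sets (space \<Omega>) (range cylinders)" using hitting_sigma by blast
  then obtain D where D: "range D \<subseteq> hitting ` boundary_functions"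
    and dense: "\<And>S \<epsilon>. S \<in> hitting ` boundary_functions \<Longrightarrow> 0 < \<epsilon> \<Longrightarrow> \<exists>k::nat. measure \<Omega> (sym_diff S (D k)) < \<epsilon>"
    using ne by (rule increments.P.countable_dense_subfamily[OF cylinders_sets]) (rule that)
  have "\<forall>k. \<exists>\<phi>\<in>boundary_functions. D k = hitting \<phi>" using D by blast
  then obtain \<phi> where \<phi>: "\<And>k. \<phi> k \<in> boundary_functions" and D_eq: "\<And>k. D k = hitting (\<phi> k)" by metis
  define \<Phi> where "\<Phi> k = (if k \<in> indices then (\<lambda>h. \<phi> (index_fst k) (index_snd k \<otimes> h)) else (\<lambda>_. 0))" for k
  have \<Phi>i: "\<Phi> (index n p) = (\<lambda>h. \<phi> n (p \<otimes> h))" if "p \<in> carrier G" for n p using that by (simp add: \<Phi>_def)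
  have \<Phi>H: "\<Phi> k \<in> boundary_functions" for k
  proof (cases "k \<in> indices")
    case True
    then obtain n p where "p \<in> carrier G" "k = index n p" by (rule indices_cases)
    then show ?thesis using \<Phi>i boundary_function_shift[OF \<phi>] by simp
  qed (simp add: \<Phi>_def boundary_functions_def harmonic_def zero_one_def)
  have \<Phi>_act: "\<Phi> (index_action g k) h = \<Phi> k (g \<otimes> h)" if "g \<in> carrier G" "h \<in> carrier G" for g h k
  proof (cases "k \<in> indices")
    case True
    then obtain n p where "p \<in> carrier G" "k = index n p" by (rule indices_cases)
    then show ?thesis using that by (simp add: index_action_index \<Phi>i m_assoc)
  qed (simp add: \<Phi>_def index_action_def)
  define b where "b = code (\<lambda>k. hitting (\<Phi> k))"
  have b: "b \<in> measurable \<Omega> cantor" unfolding b_def by (rule code_measurable) simp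
  \<comment> \<open>A group element acts on the boundary point of a path by prepending itself to the
    path.\<close>
  have b_act: "permute_bits index_action s (b w) = b (case_nat s w)" if "s \<in> carrier G" for s w
  proof -
    have "hitting (\<Phi> (index_action s k)) = hitting (\<lambda>h. \<Phi> k (s \<otimes> h))" for k
      using \<Phi>_act[OF that] by (intro hitting_cong) simp
    then show ?thesis
      unfolding bits_eq_iff[symmetric] using that by (auto simp: b_def hitting_case_nat clip_id)
  qed
  define m where "m = distr \<Omega> cantor b"
  define Z :: "('g, real) gspace" where "Z = \<lparr>msr = m, act = permute_bits index_action\<rparr>"
  have prob_m: "prob_space m" unfolding m_def by (rule increments.P.prob_space_distr[OF b])
  have sets_m: "sets m = sets cantor" by (simp add: m_def)
  have sp_m: "space m = UNIV" by (simp add: m_def)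
  have msrZ: "msr Z = m" and actZ: "act Z = permute_bits index_action" by (simp_all add: Z_def)
  note Zl = permutation_action_index prob_m sets_m Z_def
  interpret ga: group_action G UNIV "permute_bits index_action" by (rule group_action_permute_bits[OF Zl])
  have mult: "permute_bits index_action (g \<otimes> h) r = permute_bits index_action g (permute_bits index_action h r)"
    if "g \<in> carrier G" "h \<in> carrier G" for g h r using ga.composition_rule[OF _ that] by simp
  have one: "permute_bits index_action \<one> r = r" for r
    using ga.id_eq_one by (metis UNIV_I restrict_apply')
  have pS: "permute_bits index_action g -` A \<in> sets cantor" if "A \<in> sets cantor" for g A
    using measurable_sets[OF permute_bits_measurable[OF refl] that] by simp
  \<comment> \<open>With this description of the action, stationarity is the decomposition of a path
    into its first increment and the rest.\<close>
  have stat: "(\<integral>\<^sup>+ s. emeasure m (permute_bits index_action s -` A) \<partial>measure_pmf \<mu>) = emeasure m A"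
    if A: "A \<in> sets cantor" for A
  proof -
    have "(\<integral>\<^sup>+ s. emeasure m (permute_bits index_action s -` A) \<partial>measure_pmf \<mu>)
        = (\<integral>\<^sup>+ s. \<integral>\<^sup>+ w. indicator (b -` A \<inter> space \<Omega>) (case_nat s w) \<partial>\<Omega> \<partial>measure_pmf \<mu>)"
    proof (intro nn_integral_cong_AE AE_pmfI)
      fix s assume "s \<in> set_pmf \<mu>"
      then have s: "s \<in> carrier G" using set_pmf_subset by blast
      have "emeasure m (permute_bits index_action s -` A) = emeasure \<Omega> (b -` (permute_bits index_action s -` A) \<inter> space \<Omega>)"
        unfolding m_def by (rule emeasure_distr[OF b pS[OF A]])
      also have "\<dots> = (\<integral>\<^sup>+ w. indicator (b -` (permute_bits index_action s -` A) \<inter> space \<Omega>) w \<partial>\<Omega>)"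
        by (rule nn_integral_indicator[OF measurable_sets[OF b pS[OF A]], symmetric])
      also have "\<dots> = (\<integral>\<^sup>+ w. indicator (b -` A \<inter> space \<Omega>) (case_nat s w) \<partial>\<Omega>)"
        by (intro nn_integral_cong) (auto simp: indicator_def b_act[OF s] space_PiM)
      finally show "emeasure m (permute_bits index_action s -` A) = (\<integral>\<^sup>+ w. indicator (b -` A \<inter> space \<Omega>) (case_nat s w) \<partial>\<Omega>)" .
    qed
    also have "\<dots> = (\<integral>\<^sup>+ w. indicator (b -` A \<inter> space \<Omega>) w \<partial>\<Omega>)"
      by (rule nn_integral_first_step[symmetric]) (use measurable_sets[OF b A] in simp)
    also have "\<dots> = emeasure m A"
      unfolding m_def emeasure_distr[OF b A] by (rule nn_integral_indicator[OF measurable_sets[OF b A]])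
    finally show ?thesis .
  qed
  \<comment> \<open>By stationarity the pullbacks of a null set by elements of the support have
    average measure 0, so each is null. The generating assumption reaches every other element by a
    product of such increments.\<close>
  have null_walk: "permute_bits index_action g -` N \<in> null_sets m" if gN: "g \<in> carrier G" "N \<in> null_sets m" for g N
  proof -
    have step: "permute_bits index_action s -` N \<in> null_sets m" if s: "s \<in> set_pmf \<mu>" and N: "N \<in> null_sets m" for s N
    proof -
      have NS: "N \<in> sets cantor" using N sets_m by blast
      have "(\<integral>\<^sup>+ s. emeasure m (permute_bits index_action s -` N) \<partial>measure_pmf \<mu>) = 0"
        using stat[OF NS] N by (simp add: null_setsD1)
      then have "AE s in measure_pmf \<mu>. emeasure m (permute_bits index_action s -` N) = 0"
        by (subst (asm) nn_integral_0_iff_AE) auto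
      then have "emeasure m (permute_bits index_action s -` N) = 0" using s by (simp add: AE_measure_pmf_iff)
      then show ?thesis using pS[OF NS] by (simp add: null_sets_def sets_m)
    qed
    obtain n v where v: "\<forall>i. v i \<in> set_pmf \<mu>" "walk G v n = g"
        using bspec[OF gen[unfolded generating_def] gN(1)] by (elim exE conjE) (rule that)
    have "walk G v n \<in> carrier G \<and> permute_bits index_action (walk G v n) -` N \<in> null_sets m"
    proof (induction n)
      case 0
      have "permute_bits index_action \<one> -` N = N" by (auto simp: one)
      then show ?case using gN(2) by simp
    next
      case (Suc n)
      have vc: "v n \<in> carrier G" using v(1)[rule_format, of n] set_pmf_subset by blast
      have "permute_bits index_action (walk G v (Suc n)) -` N
          = permute_bits index_action (v n) -` (permute_bits index_action (walk G v n) -` N)"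
        using Suc vc by (auto simp: mult)
      then show ?case using Suc vc step[OF v(1)[rule_format]] by simp
    qed
    then show ?thesis using v(2) by simp
  qed
  have mZ: "measured_gspace G Z"
    by (rule measured_gspace_permute_bits[OF Zl]) (use null_walk in \<open>simp add: measure_def null_setsD1\<close>)
  have sZ: "stationary G \<mu> Z"
    unfolding stationary_def
  proof (intro conjI ballI mZ)
    fix A assume "A \<in> sets (msr Z)"
    then have A: "A \<in> sets cantor" by (simp add: msrZ sets_m)
    have "A \<in> sets m" using A by (simp add: sets_m)
    from emeasure_distr[OF permute_bits_measurable[OF sets_m] this]
    have "emeasure (translate Z s) A = emeasure m (permute_bits index_action s -` A)" for s
      by (simp only: translate_def msrZ actZ sp_m Int_UNIV_right)
    then show "(\<integral>\<^sup>+ g. emeasure (translate Z g) A \<partial>measure_pmf \<mu>) = emeasure (msr Z) A"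
      using stat[OF A] by (simp add: msrZ)
  qed
  have poissonZ: "poisson Z A g = measure \<Omega> (b -` (permute_bits index_action g -` A) \<inter> space \<Omega>)"
    if A: "A \<in> sets cantor" for A g
  proof -
    have "poisson Z A g = measure m (permute_bits index_action g -` A)"
      by (simp add: poisson_def msrZ actZ sp_m)
    also have "\<dots> = measure \<Omega> (b -` (permute_bits index_action g -` A) \<inter> space \<Omega>)"
      unfolding m_def by (rule measure_distr[OF b pS[OF A]])
    finally show ?thesis .
  qed
  \<comment> \<open>The transform of a digit is the boundary function it was built from: at g it is
    the hitting probability of \<Phi> k started at g, which is the value of \<Phi> k there.\<close>
  have "zero_one (poisson Z (digit k))" for k
  proof -
    have "poisson Z (digit k) g = \<Phi> k g" if g: "g \<in> carrier G" for g
    proof -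
      have "b -` (permute_bits index_action g -` digit k) \<inter> space \<Omega> = hitting (\<Phi> (index_action g k))"
        by (auto simp: b_def digit_def hitting_def)
      also have "\<dots> = hitting (\<lambda>h. \<Phi> k (g \<otimes> h))"
        using \<Phi>_act[OF g] by (intro hitting_cong) simp
      finally have "poisson Z (digit k) g = measure \<Omega> (hitting (\<lambda>h. \<Phi> k (g \<otimes> h)))"
        by (simp add: poissonZ)
      also have "\<dots> = \<Phi> k (g \<otimes> \<one>)"
        by (rule prob_hitting[OF boundary_function_shift[OF \<Phi>H g]])
      finally show ?thesis using g by simp
    qed
    then show ?thesis using zero_one_cong[of "poisson Z (digit k)" "\<Phi> k"] boundary_function_zero_one[OF \<Phi>H] by blast
  qed
  then have bZ: "boundary G \<mu> Z"
    using sZ proximal_permute_bits[OF Zl mZ] by (simp add: boundary_def)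
  have zZ: "zero_one_space Z" by (rule boundary_imp_zero_one_space[OF bZ])
  have "factors Z Y" if Y: "zero_one_space Y" for Y :: "('g, 'y) gspace"
  proof (rule factors_if_corr[OF zZ Y])
    fix B assume B: "B \<in> sets (msr Y)"
    define \<psi> where "\<psi> = poisson Y B"
    have \<psi>: "\<psi> \<in> boundary_functions" unfolding \<psi>_def by (rule poisson_boundary_function[OF Y B])
    have "\<exists>k. measure \<Omega> (sym_diff (hitting \<psi>) (D k)) < (1/2)^n" for n :: nat
      using \<psi> by (intro dense) auto
    then obtain k where k: "\<And>n::nat. measure \<Omega> (sym_diff (hitting \<psi>) (D (k n))) < (1/2)^n" by metis
    \<comment> \<open>The lower limit of digits whose hitting events approach that of \<psi> with
      summable errors. For almost every path, its boundary point lies in A exactly if \<psi> tends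
      to 1 along the path.\<close>
    define A where "A = (\<Union>n. \<Inter>i. digit (index (k (n + i)) \<one>))"
    have AS: "A \<in> sets cantor"
      unfolding A_def by (intro sets.countable_UN sets.countable_INT image_subsetI digit_sets) auto
    have "D n = hitting (\<Phi> (index n \<one>))" for n
      unfolding D_eq \<Phi>i[OF one_closed] by (intro hitting_cong) simp
    then have bA: "b w \<in> A \<longleftrightarrow> w \<in> (\<Union>n. \<Inter>i. D (k (n + i)))" for w
      by (simp add: A_def b_def digit_def)
    have DS: "D n \<in> sets \<Omega>" for n by (simp add: D_eq)
    have ae: "AE w in \<Omega>. b w \<in> A \<longleftrightarrow> w \<in> hitting \<psi>"
      using increments.P.AE_eventually_mem_iff[OF hitting_sets DS k] by eventually_elim (simp add: bA)
    \<comment> \<open>For the identity this is the relation \<open>ae\<close>. Prepending an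
      increment preserves it by \<open>AE_first_step\<close>, and the generating assumption carries
      it to every g.\<close>
    have walk: "AE w in \<Omega>. permute_bits index_action g (b w) \<in> A \<longleftrightarrow> w \<in> hitting (\<lambda>h. \<psi> (g \<otimes> h))"
      if gc: "g \<in> carrier G" for g
    proof -
      obtain n v where v: "\<forall>i. v i \<in> set_pmf \<mu>" "walk G v n = g"
        using bspec[OF gen[unfolded generating_def] gc] by (elim exE conjE) (rule that)
      have "walk G v n \<in> carrier G \<and> (AE w in \<Omega>. permute_bits index_action (walk G v n) (b w) \<in> A
          \<longleftrightarrow> w \<in> hitting (\<lambda>h. \<psi> (walk G v n \<otimes> h)))"
      proof (induction n)
        case 0
        have "hitting (\<lambda>h. \<psi> (\<one> \<otimes> h)) = hitting \<psi>" by (intro hitting_cong) simp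
        then show ?case using ae by (simp add: one)
      next
        case (Suc n)
        have vc: "v n \<in> carrier G" using v(1)[rule_format, of n] set_pmf_subset by blast
        have wc: "walk G v n \<in> carrier G" using Suc by blast
        have ae1: "AE w in \<Omega>. permute_bits index_action (walk G v n) (b (case_nat (v n) w)) \<in> A
          \<longleftrightarrow> case_nat (v n) w \<in> hitting (\<lambda>h. \<psi> (walk G v n \<otimes> h))"
          using Suc by (intro AE_first_step[OF _ v(1)[rule_format]]) blast
        have hit: "hitting (\<lambda>h. \<psi> (walk G v n \<otimes> (v n \<otimes> h))) = hitting (\<lambda>h. \<psi> (walk G v (Suc n) \<otimes> h))"
          using vc wc by (intro hitting_cong) (simp add: m_assoc)
        have "AE w in \<Omega>. permute_bits index_action (walk G v (Suc n)) (b w) \<in> A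
          \<longleftrightarrow> w \<in> hitting (\<lambda>h. \<psi> (walk G v (Suc n) \<otimes> h))"
          using ae1
        proof eventually_elim
          case (elim w)
          then have "permute_bits index_action (walk G v n) (permute_bits index_action (v n) (b w)) \<in> A
            \<longleftrightarrow> w \<in> hitting (\<lambda>h. \<psi> (walk G v n \<otimes> (v n \<otimes> h)))"
            by (simp only: hitting_case_nat clip_id[OF vc] b_act[OF vc])
          then show ?case by (simp only: hit walk.simps mult[OF wc vc])
        qed
        then show ?case using vc wc by simp
      qed
      then show ?thesis using v(2) by simp
    qed
    have "poisson Z A g = poisson Y B g" if g: "g \<in> carrier G" for g
    proof -
      have "poisson Z A g = measure \<Omega> (hitting (\<lambda>h. \<psi> (g \<otimes> h)))"
        unfolding poissonZ[OF AS]
      proof (rule increments.P.finite_measure_eq_AE)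
        show "AE w in \<Omega>. w \<in> b -` (permute_bits index_action g -` A) \<inter> space \<Omega> \<longleftrightarrow> w \<in> hitting (\<lambda>h. \<psi> (g \<otimes> h))"
          using walk[OF g] AE_space by eventually_elim simp
        show "b -` (permute_bits index_action g -` A) \<inter> space \<Omega> \<in> sets \<Omega>"
          by (rule measurable_sets[OF b pS[OF AS]])
      qed (rule hitting_sets)
      also have "\<dots> = \<psi> (g \<otimes> \<one>)" by (rule prob_hitting[OF boundary_function_shift[OF \<psi> g]])
      finally show ?thesis using g by (simp add: \<psi>_def)
    qed
    then have "corr Z A Y B" using AS B by (simp add: corr_def msrZ sets_m)
    then show "\<exists>A. corr Z A Y B" by blast
  qed
  then show ?thesis using that bZ by blast
qed

end

section \<open>Suprema and infima\<close>

context random_walk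
begin

lemma invariant_algebra_generated:
  assumes ne: "\<F> \<noteq> {}" and inv: "\<And>F. F \<in> \<F> \<Longrightarrow> invariant_algebra X F" and mX: "measured_gspace G X"
  shows "invariant_algebra X (sigma_sets (space (msr X)) (\<Union>\<F>))"
  unfolding invariant_algebra_def
proof (intro conjI ballI)
  have sub: "\<Union>\<F> \<subseteq> sets (msr X)" using inv unfolding invariant_algebra_def by blast
  then have "\<Union>\<F> \<subseteq> Pow (space (msr X))" using sets.sets_into_space by blast
  then show "sigma_algebra (space (msr X)) (sigma_sets (space (msr X)) (\<Union>\<F>))" by (rule sigma_algebra_sigma_sets)
  show "sigma_sets (space (msr X)) (\<Union>\<F>) \<subseteq> sets (msr X)" using sub by (rule sets.sigma_sets_subset)
  obtain F where F: "F \<in> \<F>" using ne by blast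
  then have "null_sets (msr X) \<subseteq> \<Union>\<F>" using inv[OF F] by (auto simp: invariant_algebra_def)
  then show "null_sets (msr X) \<subseteq> sigma_sets (space (msr X)) (\<Union>\<F>)" by (auto intro: sigma_sets.Basic)
  fix g A assume g: "g \<in> carrier G" and A: "A \<in> sigma_sets (space (msr X)) (\<Union>\<F>)"
  from A show "pull X g A \<in> sigma_sets (space (msr X)) (\<Union>\<F>)"
  proof (induction rule: sigma_sets.induct)
    case (Basic A)
    then have "pull X g A \<in> \<Union>\<F>" using inv g unfolding invariant_algebra_def by blast
    then show ?case by (rule sigma_sets.Basic)
  next
    case Empty
    then show ?case by (simp add: sigma_sets.Empty)
  next
    case (Compl A)
    have "pull X g (space (msr X) - A) = space (msr X) - pull X g A" using act_closed[OF mX g] by auto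
    then show ?case using Compl g by (simp add: sigma_sets.Compl)
  next
    case (Union A)
    have "pull X g (\<Union>i. A i) = (\<Union>i. pull X g (A i))" by auto
    then show ?case using sigma_sets.Union[OF Union.IH] by (simp only:)
  qed
qed

lemma invariant_algebra_Inter:
  assumes ne: "\<F> \<noteq> {}" and inv: "\<And>F. F \<in> \<F> \<Longrightarrow> invariant_algebra X F" and mX: "measured_gspace G X"
  shows "invariant_algebra X (\<Inter>\<F>)"
proof -
  interpret prob_space "msr X" by (rule prob_space_msr[OF mX])
  have "subfield (\<Inter>\<F>)"
    using subfield_invariant_algebra[OF mX inv] by (rule subfield_Inter[OF ne])
  then show ?thesis using inv by (auto simp: invariant_algebra_def subfield_def)
qed

lemma le_BL [simp]: "le (BL G \<mu>) Y X \<longleftrightarrow> factors X Y"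
  and carrier_BL [simp]: "X \<in> carrier (BL G \<mu>) \<longleftrightarrow> boundary G \<mu> X"
  and eq_BL [simp]: "eq (BL G \<mu>) = isomorphic_gspaces G"
  by (simp_all add: BL_def)

lemma is_lub_BL_iff:
  assumes "\<And>X. X \<in> S \<Longrightarrow> boundary G \<mu> X"
  shows "is_lub (BL G \<mu>) P S \<longleftrightarrow> boundary G \<mu> P \<and> (\<forall>X\<in>S. factors P X) \<and>
    (\<forall>U :: ('g, real) gspace. boundary G \<mu> U \<longrightarrow> (\<forall>X\<in>S. factors U X) \<longrightarrow> factors U P)"
proof -
  have "Upper (BL G \<mu>) S = {U. boundary G \<mu> U \<and> (\<forall>X\<in>S. factors U X)}"
    using assms by (auto simp: Upper_def)
  then show ?thesis by (simp add: least_def subset_eq imp_conjL)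
qed

lemma is_glb_BL_iff:
  assumes "\<And>X. X \<in> S \<Longrightarrow> boundary G \<mu> X"
  shows "is_glb (BL G \<mu>) Q S \<longleftrightarrow> boundary G \<mu> Q \<and> (\<forall>X\<in>S. factors X Q) \<and>
    (\<forall>L :: ('g, real) gspace. boundary G \<mu> L \<longrightarrow> (\<forall>X\<in>S. factors X L) \<longrightarrow> factors Q L)"
proof -
  have "Lower (BL G \<mu>) S = {L. boundary G \<mu> L \<and> (\<forall>X\<in>S. factors X L)}"
    using assms by (auto simp: Lower_def)
  then show ?thesis by (simp add: greatest_def subset_eq imp_conjL)
qed

lemma trace_mono:
  assumes "zero_one_space X" "zero_one_space Y" "zero_one_space Z" "factors X Y" "factors Z Y"
  shows "trace_algebra X Y \<subseteq> trace_algebra X Z"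
  using factors_iff_trace_subset[OF assms(1-4)] assms(5) by blast

context
  fixes I :: "'s set" and B :: "'s \<Rightarrow> ('g, real) gspace"
  assumes ne: "I \<noteq> {}" and bB: "\<And>i. i \<in> I \<Longrightarrow> boundary G \<mu> (B i)"
begin

private lemma zB: "i \<in> I \<Longrightarrow> zero_one_space (B i)"
  by (rule boundary_imp_zero_one_space[OF bB])

text \<open>Inside the Poisson boundary T all members become sub-sigma-algebras of one space, and
  the sigma-algebra that they generate is realized as a boundary.\<close>

lemma lub_exists:
  assumes gen: "generating G \<mu>"
  shows "\<exists>P. is_lub (BL G \<mu>) P (B ` I)"
proof -
  obtain T :: "('g, real) gspace" where bT: "boundary G \<mu> T"
    and top: "\<And>Y :: ('g, real) gspace. zero_one_space Y \<Longrightarrow> factors T Y"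
    using top_boundary[OF gen] by blast
  note zT = boundary_imp_zero_one_space[OF bT]
  note mT = stationary_measured[OF zero_one_stationary[OF zT]]
  let ?F = "sigma_sets (space (msr T)) (\<Union>((\<lambda>i. trace_algebra T (B i)) ` I))"
  have inv: "invariant_algebra T ?F"
    by (rule invariant_algebra_generated[OF _ _ mT]) (use ne invariant_algebra_trace[OF zT zB] in auto)
  obtain P :: "('g, real) gspace" where bP: "boundary G \<mu> P" and tP: "factors T P" "trace_algebra T P = ?F"
    using point_realization[OF zT inv] by blast
  note zP = boundary_imp_zero_one_space[OF bP]
  have "factors P (B i)" if i: "i \<in> I" for i
    unfolding factors_iff_trace_subset[OF zT zB[OF i] zP top[OF zB[OF i]]] tP(2)
    using i by (auto intro: sigma_sets.Basic)
  moreover have "factors U P" if bU: "boundary G \<mu> U" and ub: "\<And>i. i \<in> I \<Longrightarrow> factors U (B i)" for U :: "('g, real) gspace"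
  proof -
    note zU = boundary_imp_zero_one_space[OF bU]
    have "(\<Union>((\<lambda>i. trace_algebra T (B i)) ` I)) \<subseteq> trace_algebra T U"
      using trace_mono[OF zT zB zU top[OF zB] ub] by blast
    moreover have "sigma_algebra (space (msr T)) (trace_algebra T U)"
      using invariant_algebra_trace[OF zT zU] by (simp add: invariant_algebra_def)
    ultimately have "?F \<subseteq> trace_algebra T U" using sigma_algebra.sigma_sets_subset by blast
    then show ?thesis unfolding factors_iff_trace_subset[OF zT zP zU tP(1)] tP(2) .
  qed
  ultimately show ?thesis using bP bB by (intro exI[of _ P]) (subst is_lub_BL_iff; blast)
qed

context
  assumes entropy: "shannon_entropy G \<mu> < \<infinity>"
begin

text \<open>P itself is the ambient space. The upward martingale theorem gives a sequence of members
  whose entropies tend to that of P, and monotonicity bounds all members by P.\<close>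

lemma entropy_lub:
  assumes P: "is_lub (BL G \<mu>) P (B ` I)"
    and joins: "\<And>i j. i \<in> I \<Longrightarrow> j \<in> I \<Longrightarrow> \<exists>k\<in>I. factors (B k) (B i) \<and> factors (B k) (B j)"
  shows "furstenberg_entropy G \<mu> P = (SUP i\<in>I. furstenberg_entropy G \<mu> (B i))"
proof -
  have bP: "boundary G \<mu> P" and PB: "\<And>i. i \<in> I \<Longrightarrow> factors P (B i)"
    and least: "\<And>U. boundary G \<mu> U \<Longrightarrow> (\<And>i. i \<in> I \<Longrightarrow> factors U (B i)) \<Longrightarrow> factors (U :: ('g, real) gspace) P"
    using P bB by (subst (asm) is_lub_BL_iff; blast)+
  note zP = boundary_imp_zero_one_space[OF bP]
  note sP = zero_one_stationary[OF zP]
  note mP = stationary_measured[OF sP]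
  interpret prob_space "msr P" by (rule prob_space_msr[OF mP])
  define \<F> where "\<F> = (\<lambda>i. trace_algebra P (B i)) ` I"
  have neF: "\<F> \<noteq> {}" using ne by (simp add: \<F>_def)
  have invF: "invariant_algebra P F" if "F \<in> \<F>" for F
    using that invariant_algebra_trace[OF zP zB] by (auto simp: \<F>_def)
  have inv: "invariant_algebra P (sigma_sets (space (msr P)) (\<Union>\<F>))"
    by (rule invariant_algebra_generated[OF neF invF mP])
  obtain Z :: "('g, real) gspace" where bZ: "boundary G \<mu> Z" and tZ: "factors P Z"
    "trace_algebra P Z = sigma_sets (space (msr P)) (\<Union>\<F>)"
    using point_realization[OF zP inv] by blast
  note zZ = boundary_imp_zero_one_space[OF bZ]
  have "factors Z (B i)" if i: "i \<in> I" for i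
    unfolding factors_iff_trace_subset[OF zP zB[OF i] zZ PB[OF i]] tZ(2)
    using i by (auto simp: \<F>_def intro: sigma_sets.Basic)
  \<comment> \<open>Z realizes the sigma-algebra generated by the members and is an upper bound.
    Minimality of P makes it all of P, so the members generate.\<close>
  then have "factors Z P" by (rule least[OF bZ])
  from trace_mono[OF zP zP zZ factors_refl[OF zP] this]
  have "events \<subseteq> sigma_sets (space (msr P)) (\<Union>\<F>)" by (simp add: trace_algebra_self tZ(2))
  then have gen: "events = sigma_sets (space (msr P)) (\<Union>\<F>)"
    using inv by (auto simp: invariant_algebra_def)
  have sub: "subfield F" if "F \<in> \<F>" for F by (rule subfield_invariant_algebra[OF mP invF[OF that]])
  have dir: "\<exists>F3\<in>\<F>. F1 \<subseteq> F3 \<and> F2 \<subseteq> F3" if F: "F1 \<in> \<F>" "F2 \<in> \<F>" for F1 F2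
  proof -
    obtain i j where ij: "i \<in> I" "F1 = trace_algebra P (B i)" "j \<in> I" "F2 = trace_algebra P (B j)"
      using F by (auto simp: \<F>_def)
    obtain k where k: "k \<in> I" "factors (B k) (B i)" "factors (B k) (B j)" using joins[OF ij(1,3)] by blast
    then show ?thesis
      using trace_mono[OF zP zB zB PB] ij by (auto simp: \<F>_def)
  qed
  have "\<exists>F. (\<forall>n. F n \<in> \<F>) \<and>
    (\<lambda>n. \<integral>g. field_entropy (F n) (rho P g) \<partial>measure_pmf \<mu>)
      \<longlonglongrightarrow> (\<integral>g. field_entropy events (rho P g) \<partial>measure_pmf \<mu>)"
  proof (rule field_entropy_net[OF entropy sP sub subfield_events, where R = "(\<subseteq>)"])
    show "\<exists>F3\<in>\<F>. \<forall>F\<in>\<F>. F3 \<subseteq> F \<longrightarrow> F1 \<subseteq> F \<and> F2 \<subseteq> F" if "F1 \<in> \<F>" "F2 \<in> \<F>" for F1 F2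
      using dir[OF that] by blast
    show "cexp_converges (\<subseteq>) \<F> events (rho P g)" if "g \<in> set_pmf \<mu>" for g
      by (rule cexp_converges_upward[OF neF sub dir gen rho_density(1)[OF mP subsetD[OF set_pmf_subset that]]])
  qed auto
  then obtain F where F: "\<And>n::nat. F n \<in> \<F>" and lim: "(\<lambda>n. \<integral>g. field_entropy (F n) (rho P g) \<partial>measure_pmf \<mu>)
      \<longlonglongrightarrow> (\<integral>g. field_entropy events (rho P g) \<partial>measure_pmf \<mu>)" by blast
  have hP: "(\<integral>g. field_entropy events (rho P g) \<partial>measure_pmf \<mu>) = furstenberg_entropy G \<mu> P"
    using furstenberg_entropy_factor[OF zP zP factors_refl[OF zP]] by (simp add: trace_algebra_self)
  have le: "furstenberg_entropy G \<mu> (B i) \<le> furstenberg_entropy G \<mu> P" if "i \<in> I" for i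
    by (rule furstenberg_entropy_factor_le(1)[OF entropy zP zB[OF that] PB[OF that]])
  have bdd: "bdd_above ((\<lambda>i. furstenberg_entropy G \<mu> (B i)) ` I)"
    using le by (intro bdd_aboveI2)
  have "(\<integral>g. field_entropy (F n) (rho P g) \<partial>measure_pmf \<mu>) \<le> (SUP i\<in>I. furstenberg_entropy G \<mu> (B i))" for n
  proof -
    obtain i where i: "i \<in> I" "F n = trace_algebra P (B i)" using F[of n] by (auto simp: \<F>_def)
    have "(\<integral>g. field_entropy (F n) (rho P g) \<partial>measure_pmf \<mu>) = furstenberg_entropy G \<mu> (B i)"
      unfolding i(2) by (rule furstenberg_entropy_factor[OF zP zB[OF i(1)] PB[OF i(1)], symmetric])
    then show ?thesis using cSUP_upper[OF i(1) bdd] by simp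
  qed
  then have "furstenberg_entropy G \<mu> P \<le> (SUP i\<in>I. furstenberg_entropy G \<mu> (B i))"
    using LIMSEQ_le_const2[OF lim] unfolding hP by blast
  moreover have "(SUP i\<in>I. furstenberg_entropy G \<mu> (B i)) \<le> furstenberg_entropy G \<mu> P"
    using ne le by (intro cSUP_least)
  ultimately show ?thesis by simp
qed

text \<open>A meet-closed family has the same infimum as its members below a fixed member \<open>B i0\<close>, and these
  are all traced by sub-sigma-algebras of \<open>B i0\<close>.\<close>

lemma glb_exists_entropy:
  assumes meets: "\<And>i j. i \<in> I \<Longrightarrow> j \<in> I \<Longrightarrow> \<exists>k\<in>I. factors (B i) (B k) \<and> factors (B j) (B k)"
  shows "\<exists>Q. is_glb (BL G \<mu>) Q (B ` I) \<and>
    furstenberg_entropy G \<mu> Q = (INF i\<in>I. furstenberg_entropy G \<mu> (B i))"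
proof -
  obtain i0 where i0: "i0 \<in> I" using ne by blast
  define X where "X = B i0"
  have zX: "zero_one_space X" unfolding X_def by (rule zB[OF i0])
  note sX = zero_one_stationary[OF zX]
  note mX = stationary_measured[OF sX]
  interpret prob_space "msr X" by (rule prob_space_msr[OF mX])
  define I' where "I' = {i \<in> I. factors X (B i)}"
  have I'I: "i \<in> I" and XB: "factors X (B i)" if "i \<in> I'" for i using that by (auto simp: I'_def)
  have i0': "i0 \<in> I'" using i0 factors_refl[OF zX] by (auto simp: I'_def X_def)
  have cofinal: "\<exists>k\<in>I'. factors (B i) (B k)" if i: "i \<in> I" for i
  proof -
    obtain k where "k \<in> I" "factors (B i0) (B k)" "factors (B i) (B k)" using meets[OF i0 i] by blast
    then show ?thesis by (auto simp: I'_def X_def)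
  qed
  define \<F> where "\<F> = (\<lambda>i. trace_algebra X (B i)) ` I'"
  have neF: "\<F> \<noteq> {}" using i0' by (auto simp: \<F>_def)
  have invF: "invariant_algebra X F" if "F \<in> \<F>" for F
    using that invariant_algebra_trace[OF zX zB] I'I by (auto simp: \<F>_def)
  have inv: "invariant_algebra X (\<Inter>\<F>)" by (rule invariant_algebra_Inter[OF neF invF mX])
  obtain Q :: "('g, real) gspace" where bQ: "boundary G \<mu> Q" and tQ: "factors X Q" "trace_algebra X Q = \<Inter>\<F>"
    using point_realization[OF zX inv] by blast
  note zQ = boundary_imp_zero_one_space[OF bQ]
  have lower': "factors (B i) Q" if i: "i \<in> I'" for i
    unfolding factors_iff_trace_subset[OF zX zQ zB[OF I'I[OF i]] tQ(1)] tQ(2)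
    using i by (auto simp: \<F>_def)
  \<comment> \<open>A member that is not below \<open>B i0\<close> is reached through a lower bound
    of both, which the meet with \<open>B i0\<close> provides.\<close>
  have lower: "factors (B i) Q" if i: "i \<in> I" for i
  proof -
    obtain k where k: "k \<in> I'" "factors (B i) (B k)" using cofinal[OF i] by blast
    show ?thesis by (rule factors_trans[OF zB[OF i] zB[OF I'I[OF k(1)]] zQ k(2) lower'[OF k(1)]])
  qed
  have greatest: "factors Q L" if bL: "boundary G \<mu> L" and lb: "\<And>i. i \<in> I \<Longrightarrow> factors (B i) L" for L :: "('g, real) gspace"
  proof -
    note zL = boundary_imp_zero_one_space[OF bL]
    have XL: "factors X L" unfolding X_def by (rule lb[OF i0])
    have "trace_algebra X L \<subseteq> trace_algebra X (B i)" if "i \<in> I'" for i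
      by (rule trace_mono[OF zX zL zB[OF I'I[OF that]] XL lb[OF I'I[OF that]]])
    then show ?thesis
      unfolding factors_iff_trace_subset[OF zX zL zQ XL] tQ(2) by (auto simp: \<F>_def)
  qed
  have glb: "is_glb (BL G \<mu>) Q (B ` I)"
  proof (subst is_glb_BL_iff)
    show "boundary G \<mu> X" if "X \<in> B ` I" for X using that bB by blast
    show "boundary G \<mu> Q \<and> (\<forall>X\<in>B ` I. factors X Q) \<and>
      (\<forall>L :: ('g, real) gspace. boundary G \<mu> L \<longrightarrow> (\<forall>X\<in>B ` I. factors X L) \<longrightarrow> factors Q L)"
      using bQ lower greatest by simp
  qed
  have sub: "subfield F" if "F \<in> \<F>" for F by (rule subfield_invariant_algebra[OF mX invF[OF that]])
  have null: "null_sets (msr X) \<subseteq> F" if "F \<in> \<F>" for F using invF[OF that] by (simp add: invariant_algebra_def)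
  have dir: "\<exists>F3\<in>\<F>. F3 \<subseteq> F1 \<and> F3 \<subseteq> F2" if F: "F1 \<in> \<F>" "F2 \<in> \<F>" for F1 F2
  proof -
    obtain i j where ij: "i \<in> I'" "F1 = trace_algebra X (B i)" "j \<in> I'" "F2 = trace_algebra X (B j)"
      using F by (auto simp: \<F>_def)
    obtain k where k: "k \<in> I" "factors (B i) (B k)" "factors (B j) (B k)"
      using meets[OF I'I[OF ij(1)] I'I[OF ij(3)]] by blast
    have Xk: "factors X (B k)"
      by (rule factors_trans[OF zX zB[OF I'I[OF ij(1)]] zB[OF k(1)] XB[OF ij(1)] k(2)])
    then have "k \<in> I'" using k(1) by (simp add: I'_def)
    then show ?thesis
      using trace_mono[OF zX zB[OF k(1)] zB[OF I'I[OF ij(1)]] Xk k(2)]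
        trace_mono[OF zX zB[OF k(1)] zB[OF I'I[OF ij(3)]] Xk k(3)] ij(2,4) by (auto simp: \<F>_def)
  qed
  have "\<exists>F. (\<forall>n. F n \<in> \<F>) \<and>
    (\<lambda>n. \<integral>g. field_entropy (F n) (rho X g) \<partial>measure_pmf \<mu>)
      \<longlonglongrightarrow> (\<integral>g. field_entropy (\<Inter>\<F>) (rho X g) \<partial>measure_pmf \<mu>)"
  proof (rule field_entropy_net[OF entropy sX sub subfield_Inter[OF neF sub], where R = "(\<supseteq>)"])
    show "\<exists>F3\<in>\<F>. \<forall>F\<in>\<F>. F \<subseteq> F3 \<longrightarrow> F \<subseteq> F1 \<and> F \<subseteq> F2" if "F1 \<in> \<F>" "F2 \<in> \<F>" for F1 F2
      using dir[OF that] by blast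
    show "cexp_converges (\<supseteq>) \<F> (\<Inter>\<F>) (rho X g)" if "g \<in> set_pmf \<mu>" for g
      by (rule cexp_converges_downward[OF neF sub dir null rho_density(1)[OF mX subsetD[OF set_pmf_subset that]]])
  qed auto
  then obtain F where F: "\<And>n::nat. F n \<in> \<F>" and lim: "(\<lambda>n. \<integral>g. field_entropy (F n) (rho X g) \<partial>measure_pmf \<mu>)
      \<longlonglongrightarrow> (\<integral>g. field_entropy (\<Inter>\<F>) (rho X g) \<partial>measure_pmf \<mu>)" by blast
  have hQ: "(\<integral>g. field_entropy (\<Inter>\<F>) (rho X g) \<partial>measure_pmf \<mu>) = furstenberg_entropy G \<mu> Q"
    using furstenberg_entropy_factor[OF zX zQ tQ(1)] by (simp add: tQ(2))
  have le: "furstenberg_entropy G \<mu> Q \<le> furstenberg_entropy G \<mu> (B i)" if "i \<in> I" for i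
    by (rule furstenberg_entropy_factor_le(1)[OF entropy zB[OF that] zQ lower[OF that]])
  have bdd: "bdd_below ((\<lambda>i. furstenberg_entropy G \<mu> (B i)) ` I)"
    using le by (intro bdd_belowI2)
  have "(INF i\<in>I. furstenberg_entropy G \<mu> (B i)) \<le> (\<integral>g. field_entropy (F n) (rho X g) \<partial>measure_pmf \<mu>)" for n
  proof -
    obtain i where i: "i \<in> I'" "F n = trace_algebra X (B i)" using F[of n] by (auto simp: \<F>_def)
    have "(\<integral>g. field_entropy (F n) (rho X g) \<partial>measure_pmf \<mu>) = furstenberg_entropy G \<mu> (B i)"
      unfolding i(2) by (rule furstenberg_entropy_factor[OF zX zB[OF I'I[OF i(1)]] XB[OF i(1)], symmetric])
    then show ?thesis using cINF_lower[OF bdd I'I[OF i(1)]] by simp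
  qed
  then have "(INF i\<in>I. furstenberg_entropy G \<mu> (B i)) \<le> furstenberg_entropy G \<mu> Q"
    using LIMSEQ_le_const[OF lim] unfolding hQ by blast
  moreover have "furstenberg_entropy G \<mu> Q \<le> (INF i\<in>I. furstenberg_entropy G \<mu> (B i))"
    using ne le by (intro cINF_greatest)
  ultimately show ?thesis using glb by (intro exI[of _ Q]) simp
qed

end

end

lemma furstenberg_entropy_isomorphic:
  assumes "shannon_entropy G \<mu> < \<infinity>" "zero_one_space X" "zero_one_space Y" "isomorphic_gspaces G X Y"
  shows "furstenberg_entropy G \<mu> X = furstenberg_entropy G \<mu> Y"
proof (rule antisym)
  have XY: "factors X Y" and YX: "factors Y X"
    using assms(4) unfolding isomorphic_iff_factors[OF assms(2,3)] by simp_all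
  show "furstenberg_entropy G \<mu> X \<le> furstenberg_entropy G \<mu> Y"
    by (rule furstenberg_entropy_factor_le(1)[OF assms(1,3,2) YX])
  show "furstenberg_entropy G \<mu> Y \<le> furstenberg_entropy G \<mu> X"
    by (rule furstenberg_entropy_factor_le(1)[OF assms(1,2,3) XY])
qed

text \<open>Equal entropy makes the sigma-algebra of Y in X everything, so X is a factor of Y as
  well, and mutual factors are isomorphic by rigidity.\<close>

lemma isomorphic_if_entropy_eq:
  assumes "shannon_entropy G \<mu> < \<infinity>" and X: "zero_one_space X" and Y: "zero_one_space Y" and XY: "factors X Y"
    and eq: "furstenberg_entropy G \<mu> Y = furstenberg_entropy G \<mu> X"
  shows "isomorphic_gspaces G X Y"
proof -
  have "trace_algebra X X \<subseteq> trace_algebra X Y"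
    using furstenberg_entropy_factor_le(2)[OF assms(1) X Y XY eq] by (simp add: trace_algebra_self)
  then have "factors Y X" unfolding factors_iff_trace_subset[OF X X Y factors_refl[OF X]] .
  then show ?thesis using XY isomorphic_iff_factors[OF X Y] by blast
qed

end

theorem theorem3:
  fixes G :: "('g, 'm) monoid_scheme"
    and \<mu> :: "'g pmf"
    and I :: "'s set"
    and B :: "'s \<Rightarrow> ('g, real) gspace"
  assumes "group G" and "countable (carrier G)"
    and "set_pmf \<mu> \<subseteq> carrier G"
    and "shannon_entropy G \<mu> < \<infinity>"
    and "I \<noteq> {}"
    and "\<And>i. i \<in> I \<Longrightarrow> boundary G \<mu> (B i)"
    and closed_joins: "\<And>i j. i \<in> I \<Longrightarrow> j \<in> I \<Longrightarrow> \<exists>k\<in>I. is_lub (BL G \<mu>) (B k) {B i, B j}"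
    and closed_meets: "\<And>i j. i \<in> I \<Longrightarrow> j \<in> I \<Longrightarrow> \<exists>k\<in>I. is_glb (BL G \<mu>) (B k) {B i, B j}"
  shows
    "(generating G \<mu> \<longrightarrow> (\<exists>P. is_lub (BL G \<mu>) P (B ` I))) \<and>
     (\<forall>P. is_lub (BL G \<mu>) P (B ` I) \<longrightarrow>
        (\<forall>C. boundary G \<mu> C \<longrightarrow>
           ((\<forall>i\<in>I. B i \<sqsubseteq>\<^bsub>BL G \<mu>\<^esub> C) \<and>
            furstenberg_entropy G \<mu> C = (SUP i\<in>I. furstenberg_entropy G \<mu> (B i))
            \<longleftrightarrow> C .=\<^bsub>BL G \<mu>\<^esub> P))) \<and>
     (finite (set_pmf \<mu>) \<longrightarrow>
        (\<exists>Q. is_glb (BL G \<mu>) Q (B ` I)) \<and>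
        (\<forall>Q. is_glb (BL G \<mu>) Q (B ` I) \<longrightarrow>
           (\<forall>C. boundary G \<mu> C \<longrightarrow>
              ((\<forall>i\<in>I. C \<sqsubseteq>\<^bsub>BL G \<mu>\<^esub> B i) \<and>
               furstenberg_entropy G \<mu> C = (INF i\<in>I. furstenberg_entropy G \<mu> (B i))
               \<longleftrightarrow> C .=\<^bsub>BL G \<mu>\<^esub> Q))))"
proof -
  interpret random_walk G \<mu>
    using assms(1-3) by (simp add: random_walk_def random_walk_axioms_def)
  note H = assms(4) and ne = assms(5) and bB = assms(6)
  have zB: "zero_one_space (B i)" if "i \<in> I" for i by (rule boundary_imp_zero_one_space[OF bB[OF that]])
  have joins: "\<exists>k\<in>I. factors (B k) (B i) \<and> factors (B k) (B j)" if ij: "i \<in> I" "j \<in> I" for i j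
  proof -
    obtain k where k: "k \<in> I" "is_lub (BL G \<mu>) (B k) {B i, B j}" using closed_joins[OF ij] by blast
    have "factors (B k) X" if "X \<in> {B i, B j}" for X
      using k(2) that bB \<open>i \<in> I\<close> \<open>j \<in> I\<close> by (subst (asm) is_lub_BL_iff) blast+
    then show ?thesis using k(1) by blast
  qed
  have meets: "\<exists>k\<in>I. factors (B i) (B k) \<and> factors (B j) (B k)" if ij: "i \<in> I" "j \<in> I" for i j
  proof -
    obtain k where k: "k \<in> I" "is_glb (BL G \<mu>) (B k) {B i, B j}" using closed_meets[OF ij] by blast
    have "factors X (B k)" if "X \<in> {B i, B j}" for X
      using k(2) that bB \<open>i \<in> I\<close> \<open>j \<in> I\<close> by (subst (asm) is_glb_BL_iff) blast+
    then show ?thesis using k(1) by blast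
  qed
  have sup: "(\<forall>i\<in>I. factors C (B i)) \<and>
      furstenberg_entropy G \<mu> C = (SUP i\<in>I. furstenberg_entropy G \<mu> (B i)) \<longleftrightarrow> isomorphic_gspaces G C P"
    if P: "is_lub (BL G \<mu>) P (B ` I)" and bC: "boundary G \<mu> C" for P C :: "('g, real) gspace"
  proof -
    have bP: "boundary G \<mu> P" and PB: "\<And>i. i \<in> I \<Longrightarrow> factors P (B i)"
      and least: "\<And>U. boundary G \<mu> U \<Longrightarrow> (\<And>i. i \<in> I \<Longrightarrow> factors U (B i)) \<Longrightarrow> factors (U :: ('g, real) gspace) P"
      using P bB by (subst (asm) is_lub_BL_iff; blast)+
    note zP = boundary_imp_zero_one_space[OF bP] and zC = boundary_imp_zero_one_space[OF bC]
    have hP: "furstenberg_entropy G \<mu> P = (SUP i\<in>I. furstenberg_entropy G \<mu> (B i))"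
      by (rule entropy_lub[OF ne bB H P joins])
    show ?thesis
    proof
      assume C: "(\<forall>i\<in>I. factors C (B i)) \<and>
        furstenberg_entropy G \<mu> C = (SUP i\<in>I. furstenberg_entropy G \<mu> (B i))"
      \<comment> \<open>C lies above P with the same entropy, so strict monotonicity leaves no room
        between them.\<close>
      then have "factors C P" by (intro least[OF bC]) blast
      then show "isomorphic_gspaces G C P"
        using C hP by (intro isomorphic_if_entropy_eq[OF H zC zP]) auto
    next
      assume iso: "isomorphic_gspaces G C P"
      then have CP: "factors C P" using isomorphic_iff_factors[OF zC zP] by blast
      show "(\<forall>i\<in>I. factors C (B i)) \<and>
        furstenberg_entropy G \<mu> C = (SUP i\<in>I. furstenberg_entropy G \<mu> (B i))"
        using furstenberg_entropy_isomorphic[OF H zC zP iso] hP factors_trans[OF zC zP zB CP PB] by auto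
    qed
  qed
  \<comment> \<open>The entropy is known for the infimum that was constructed; any other infimum is
    isomorphic to it and therefore has the same entropy.\<close>
  obtain Q0 where Q0: "is_glb (BL G \<mu>) Q0 (B ` I)"
    and hQ0: "furstenberg_entropy G \<mu> Q0 = (INF i\<in>I. furstenberg_entropy G \<mu> (B i))"
    using glb_exists_entropy[OF ne bB H meets] by blast
  have inf: "(\<forall>i\<in>I. factors (B i) C) \<and>
      furstenberg_entropy G \<mu> C = (INF i\<in>I. furstenberg_entropy G \<mu> (B i)) \<longleftrightarrow> isomorphic_gspaces G C Q"
    if Q: "is_glb (BL G \<mu>) Q (B ` I)" and bC: "boundary G \<mu> C" for Q C :: "('g, real) gspace"
  proof -
    have glbD: "boundary G \<mu> Q" "\<And>i. i \<in> I \<Longrightarrow> factors (B i) Q"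
      "\<And>L. boundary G \<mu> L \<Longrightarrow> (\<And>i. i \<in> I \<Longrightarrow> factors (B i) L) \<Longrightarrow> factors Q (L :: ('g, real) gspace)"
      if "is_glb (BL G \<mu>) Q (B ` I)" for Q
      using that bB by (subst (asm) is_glb_BL_iff; blast)+
    note bQ = glbD(1)[OF Q] and bQ0 = glbD(1)[OF Q0]
    note zQ = boundary_imp_zero_one_space[OF bQ] and zQ0 = boundary_imp_zero_one_space[OF bQ0]
      and zC = boundary_imp_zero_one_space[OF bC]
    have "isomorphic_gspaces G Q Q0"
      unfolding isomorphic_iff_factors[OF zQ zQ0]
      using glbD(3)[OF Q bQ0 glbD(2)[OF Q0]] glbD(3)[OF Q0 bQ glbD(2)[OF Q]] by blast
    then have hQ: "furstenberg_entropy G \<mu> Q = (INF i\<in>I. furstenberg_entropy G \<mu> (B i))"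
      using furstenberg_entropy_isomorphic[OF H zQ zQ0] hQ0 by simp
    show ?thesis
    proof
      assume C: "(\<forall>i\<in>I. factors (B i) C) \<and>
        furstenberg_entropy G \<mu> C = (INF i\<in>I. furstenberg_entropy G \<mu> (B i))"
      then have "factors Q C" by (intro glbD(3)[OF Q bC]) blast
      then have "isomorphic_gspaces G Q C"
        using C hQ by (intro isomorphic_if_entropy_eq[OF H zQ zC]) auto
      then show "isomorphic_gspaces G C Q"
        using isomorphic_iff_factors[OF zQ zC] isomorphic_iff_factors[OF zC zQ] by blast
    next
      assume iso: "isomorphic_gspaces G C Q"
      then have QC: "factors Q C" using isomorphic_iff_factors[OF zC zQ] by blast
      show "(\<forall>i\<in>I. factors (B i) C) \<and>
        furstenberg_entropy G \<mu> C = (INF i\<in>I. furstenberg_entropy G \<mu> (B i))"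
        using furstenberg_entropy_isomorphic[OF H zC zQ iso] hQ factors_trans[OF zB zQ zC glbD(2)[OF Q] QC] by auto
    qed
  qed
  show ?thesis
    unfolding le_BL eq_BL
  proof (intro conjI impI allI)
    show "\<exists>P. is_lub (BL G \<mu>) P (B ` I)" if "generating G \<mu>"
      by (rule lub_exists[OF ne bB that])
    show "\<exists>Q. is_glb (BL G \<mu>) Q (B ` I)" using Q0 by blast
  qed (rule sup inf; assumption)+
qed

end
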